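(* Let $d\ge1$, $\alpha\in(0,2]$, let $X$ be the rotationally symmetric $\alpha$-stable process on $\mathbb{R}^d$, let $D\subset\mathbb{R}^d$ be an open subset, and let $X^D$ be the $\alpha$-stable process on $D$ with Dirichlet boundary condition (the part of $X$ on $D$). Then the following are equivalent: (i) for any $1\le p\le\infty$, the semigroup of $X^D$ is a compact operator on $L^p(D,m)$; (ii) the semigroup of $X^D$ is a compact operator on $L^2(D,m)$; (iii) $\lim_{|x|\to\infty}E_x[\tau_D]=0$; (iv) $\lim_{|x|\to\infty}\int_0^\infty e^{-t}P_x[\tau_D>t]\,dt=0$.
   Context: $m$ is Lebesgue measure (restricted to $D$ where appropriate). The rotationally symmetric $\alpha$-stable process $X=(\{X_t\},\{P_x\})$ is the Lévy process with $E_x[e^{i\xi\cdot(X_t-x)}]=e^{-ct|\xi|^\alpha}$ for a fixed normalizing constant $c>0$ (Brownian motion if $\alpha=2$); $E_x$ is expectation under $P_x$. $\tau_D=\inf\{t>0\mid X_t\notin D\}$ ($\inf\emptyset=\infty$). $X^D$ is the process equal to $X_t$ for $t<\tau_D$ and killed (sent to a cemetery point) for $t\ge\tau_D$; its semigroup is $p_t^Df(x)=E_x[f(X_t):t<\tau_D]$, $x\in D$, which is symmetric with respect to $m|_D$ and extends canonically to $L^p(D,m)$, $1\le p\le\infty$. "The semigroup is a compact operator" means that $p_t^D$ is a compact operator for every $t>0$. *)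

theory Defs
  imports "HOL-Probability.Probability"
begin

definition cadlag :: "(real \<Rightarrow> 'a::topological_space) \<Rightarrow> bool" where
  "cadlag w \<longleftrightarrow>
     (\<forall>t\<ge>0. (w \<longlongrightarrow> w t) (at_right t)) \<and> (\<forall>t>0. \<exists>l. (w \<longlongrightarrow> l) (at_left t))"

text \<open>
  A Levy process given as a family of laws: all \<open>P x\<close> live on one measurable space, and under
  \<open>P x\<close> the process \<open>X\<close> is a Levy process started at \<open>x\<close>. Only times \<open>t \<ge> 0\<close> matter.
\<close>

locale levy_process =
  fixes P :: "'a::euclidean_space \<Rightarrow> 'w measure"
    and X :: "real \<Rightarrow> 'w \<Rightarrow> 'a"
  assumes prob: "prob_space (P x)"
    and sets_eq: "sets (P x) = sets (P y)"
    and measurable_X: "0 \<le> t \<Longrightarrow> X t \<in> borel_measurable (P x)"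
    and start: "AE \<omega> in P x. X 0 \<omega> = x"
    and cadlag_paths: "AE \<omega> in P x. cadlag (\<lambda>t. X t \<omega>)"
    and indep_increments:
      "0 \<le> u 0 \<Longrightarrow> mono u \<Longrightarrow>
         prob_space.indep_vars (P x) (\<lambda>_::nat. borel) (\<lambda>i \<omega>. X (u (Suc i)) \<omega> - X (u i) \<omega>) {..<n}"
    and stationary_increments:
      "0 \<le> s \<Longrightarrow> s \<le> t \<Longrightarrow>
         distr (P x) borel (\<lambda>\<omega>. X t \<omega> - X s \<omega>) = distr (P x) borel (\<lambda>\<omega>. X (t - s) \<omega> - X 0 \<omega>)"

locale rotsym_stable_process = levy_process P X
  for \<alpha> c :: real
    and P :: "'a::euclidean_space \<Rightarrow> 'w measure"
    and X :: "real \<Rightarrow> 'w \<Rightarrow> 'a" +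
  assumes characteristic_function:
    "0 \<le> t \<Longrightarrow>
       (\<integral>\<omega>. exp (\<i> * complex_of_real (\<xi> \<bullet> (X t \<omega> - x))) \<partial>P x)
         = complex_of_real (exp (- c * t * norm \<xi> powr \<alpha>))"

definition exit_time :: "(real \<Rightarrow> 'w \<Rightarrow> 'a) \<Rightarrow> 'a set \<Rightarrow> 'w \<Rightarrow> ennreal" where
  "exit_time X D \<omega> = (INF t\<in>{t. 0 < t \<and> X t \<omega> \<notin> D}. ennreal t)"

text \<open>
  Exit times are in general measurable only for the completed \<open>\<sigma>\<close>-algebras, so probabilities and
  expectations involving them are taken with respect to \<open>completion (P x)\<close>.
\<close>

definition survival_prob ::
    "('a \<Rightarrow> 'w measure) \<Rightarrow> (real \<Rightarrow> 'w \<Rightarrow> 'a) \<Rightarrow> 'a set \<Rightarrow> real \<Rightarrow> 'a \<Rightarrow> real" where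
  "survival_prob P X D t x =
     measure (completion (P x)) {\<omega> \<in> space (P x). ennreal t < exit_time X D \<omega>}"

definition mean_exit_time ::
    "('a \<Rightarrow> 'w measure) \<Rightarrow> (real \<Rightarrow> 'w \<Rightarrow> 'a) \<Rightarrow> 'a set \<Rightarrow> 'a \<Rightarrow> ennreal" where
  "mean_exit_time P X D x = (\<integral>\<^sup>+\<omega>. exit_time X D \<omega> \<partial>completion (P x))"

text \<open>
  The semigroup of the part process. For a stable process and \<open>t > 0\<close> the law of \<open>X t\<close> has a bounded
  density, so the formula makes sense for every Borel representative \<open>f\<close> of an element of
  \<open>L\<^sup>p(D)\<close> and does not depend on that representative; it is the canonical extension to \<open>L\<^sup>p(D)\<close>.
  Values of \<open>f\<close> outside \<open>D\<close> do not enter, as \<open>t < exit_time X D \<omega>\<close> forces \<open>X t \<omega> \<in> D\<close> for \<open>t > 0\<close>.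
\<close>

definition part_semigroup ::
    "('a \<Rightarrow> 'w measure) \<Rightarrow> (real \<Rightarrow> 'w \<Rightarrow> 'a) \<Rightarrow> 'a set \<Rightarrow> real \<Rightarrow> ('a \<Rightarrow> real) \<Rightarrow> 'a \<Rightarrow> real" where
  "part_semigroup P X D t f x =
     (LINT \<omega>:{\<omega> \<in> space (P x). ennreal t < exit_time X D \<omega>}|completion (P x). f (X t \<omega>))"

text \<open>
  Elements of \<open>L\<^sup>p\<close> are represented by functions, so \<open>Lp_norm\<close> is a seminorm and equality in
  \<open>L\<^sup>p\<close> is equality almost everywhere. The exponent ranges over \<open>1 \<le> p \<le> \<infinity>\<close>.
\<close>

definition Lp_space :: "ennreal \<Rightarrow> 'a measure \<Rightarrow> ('a \<Rightarrow> real) set" where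
  "Lp_space p M = {f \<in> borel_measurable M.
     if p = \<infinity> then \<exists>C. AE x in M. \<bar>f x\<bar> \<le> C
     else integrable M (\<lambda>x. \<bar>f x\<bar> powr enn2real p)}"

definition Lp_norm :: "ennreal \<Rightarrow> 'a measure \<Rightarrow> ('a \<Rightarrow> real) \<Rightarrow> real" where
  "Lp_norm p M f =
     (if p = \<infinity> then real_of_ereal (esssup M (\<lambda>x. ereal \<bar>f x\<bar>))
      else (\<integral>x. \<bar>f x\<bar> powr enn2real p \<partial>M) powr (1 / enn2real p))"

text \<open>
  The first three conditions say that \<open>T\<close> induces a linear operator on \<open>L\<^sup>p\<close>, the last one that
  it maps bounded sets to relatively compact ones.
\<close>

definition compact_operator_Lp ::
    "ennreal \<Rightarrow> 'a measure \<Rightarrow> (('a \<Rightarrow> real) \<Rightarrow> 'a \<Rightarrow> real) \<Rightarrow> bool" where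
  "compact_operator_Lp p M T \<longleftrightarrow>
     (\<forall>f\<in>Lp_space p M. T f \<in> Lp_space p M) \<and>
     (\<forall>f\<in>Lp_space p M. \<forall>g\<in>Lp_space p M.
        (AE x in M. f x = g x) \<longrightarrow> (AE x in M. T f x = T g x)) \<and>
     (\<forall>f\<in>Lp_space p M. \<forall>g\<in>Lp_space p M. \<forall>a b.
        AE x in M. T (\<lambda>y. a * f y + b * g y) x = a * T f x + b * T g x) \<and>
     (\<forall>F :: nat \<Rightarrow> 'a \<Rightarrow> real.
        (\<forall>n. F n \<in> Lp_space p M) \<and> (\<exists>B. \<forall>n. Lp_norm p M (F n) \<le> B) \<longrightarrow>
        (\<exists>g\<in>Lp_space p M. \<exists>r :: nat \<Rightarrow> nat. strict_mono r \<and>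
           (\<lambda>n. Lp_norm p M (\<lambda>x. T (F (r n)) x - g x)) \<longlonglongrightarrow> 0))"

definition compact_semigroup_Lp ::
    "ennreal \<Rightarrow> 'a measure \<Rightarrow> (real \<Rightarrow> ('a \<Rightarrow> real) \<Rightarrow> 'a \<Rightarrow> real) \<Rightarrow> bool" where
  "compact_semigroup_Lp p M T \<longleftrightarrow> (\<forall>t>0. compact_operator_Lp p M (T t))"

end

theory Submission
  imports Defs
begin

text \<open>
  All four conditions are compared with a fifth one: for every \<open>t > 0\<close> the survival probability
  \<open>P\<^sub>x[\<tau>\<^sub>D > t]\<close> tends to \<open>0\<close> as \<open>|x| \<rightarrow> \<infinity>\<close>.

  The law of \<open>X\<^sub>t - x\<close> has, by Fourier inversion, a bounded continuous density, whose supremum tends to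
  \<open>0\<close> as \<open>t \<rightarrow> \<infinity>\<close>. If survival vanishes at infinity, then some \<open>P\<^sub>x[\<tau>\<^sub>D > T]\<close> is bounded away from \<open>1\<close>
  uniformly in \<open>x\<close>, survival probabilities decay geometrically, and \<open>E\<^sub>x[\<tau>\<^sub>D]\<close> is at most
  \<open>\<delta> + C P\<^sub>x[\<tau>\<^sub>D > \<delta>]\<close>.

  For compactness write the operator as a square \<open>p\<^sub>2\<^sub>s = p\<^sub>s p\<^sub>s\<close> of operators of the part process.
  Because \<open>p\<^sub>s\<close> is close to the composition of the free semigroup at a small time with \<open>p\<^sub>s\<^sub>-\<^sub>\<epsilon>\<close>, it maps
  bounded functions to functions that are equicontinuous at each point of \<open>D\<close>, so that bounded sequences
  have images with pointwise convergent subsequences. The boundedness of the density and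
  \<open>P\<^sub>x[\<tau>\<^sub>D > s] \<rightarrow> 0\<close> make the tails of \<open>p\<^sub>2\<^sub>s f\<close> uniformly small, and dominated convergence does the rest.

  Conversely, let \<open>f\<^sub>n\<close> be the indicator of a large ball around \<open>x\<^sub>n\<close> with \<open>|x\<^sub>n| \<rightarrow> \<infinity>\<close>. Then \<open>p\<^sub>s f\<^sub>n\<close>
  tends to \<open>0\<close> pointwise, hence along a subsequence in \<open>L\<^sup>2\<close> by compactness, and the boundedness of the
  density turns this into the pointwise statement \<open>p\<^sub>2\<^sub>s f\<^sub>n (x\<^sub>n) \<rightarrow> 0\<close>.

  The exit time is measurable for the completed measures because a path that comes arbitrarily close to
  the complement of \<open>D\<close> almost surely enters it: otherwise it would jump at an announced time.
\<close>

section \<open>Fourier inversion on Euclidean spaces\<close>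

text \<open>The locale gives measures \<open>P x\<close> without measurability in \<open>x\<close>,
  and independence only for increments over finitely many times. Everything is therefore transported
  to one measure, the law \<open>path_law\<close> of the path of increments: a start at
  \<open>x\<close> becomes a translation, measurability in \<open>x\<close> comes from Fubini, and
  the Markov property is the independence of \<open>past s\<close> and \<open>shift s\<close>. The
  L^p bounds and the tail estimates come from integrating over the starting point first and
  translating Lebesgue measure, for every finite exponent at once, at the price of factors
  \<open>2 powr r\<close>. Survival must be described by countably many times to be measurable.
  Rational times at which the path is in \<open>D\<close> do not exclude a visit to the complement
  in between; hence the exhaustion of \<open>D\<close> by the closed sets \<open>deep D n\<close>.
  That membership in a single \<open>deep D n\<close> loses nothing is a form of
  quasi-left-continuity. It is proved on finite time grids, where the simple Markov property
  suffices, followed by a passage to the limit.\<close>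

lemma integrable_inverse_one_plus_square: "integrable lborel (\<lambda>x::real. inverse (1 + x\<^sup>2))"
  using integrable_inverse_1_plus_square by (simp add: set_integrable_def einterval_def)

lemma lborel_coordinate_prod:
  fixes f :: "'a::euclidean_space \<Rightarrow> real \<Rightarrow> 'b::{real_normed_field,banach,second_countable_topology}"
  assumes f: "\<And>b. b \<in> Basis \<Longrightarrow> integrable lborel (f b)"
  shows integrable_lborel_coordinate_prod: "integrable lborel (\<lambda>x. \<Prod>b\<in>Basis. f b (x \<bullet> b))"
    and integral_lborel_coordinate_prod:
      "(\<integral>x. (\<Prod>b\<in>Basis. f b (x \<bullet> b)) \<partial>lborel) = (\<Prod>b\<in>Basis. \<integral>y. f b y \<partial>lborel)"
proof -
  interpret product_sigma_finite "\<lambda>_::'a. lborel :: real measure" ..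
  have [measurable]: "b \<in> Basis \<Longrightarrow> f b \<in> borel_measurable borel" for b
    using borel_measurable_integrable[OF f] by simp
  have m: "(\<lambda>x. \<Prod>b\<in>Basis. f b (x \<bullet> b)) \<in> borel_measurable borel"
    by measurable
  have coord: "(\<Prod>b\<in>Basis. f b ((\<Sum>i\<in>Basis. z i *\<^sub>R i) \<bullet> b)) = (\<Prod>b\<in>Basis. f b (z b))" for z
    by (intro prod.cong refl) (simp add: inner_sum_left inner_Basis if_distrib sum.delta cong: if_cong)
  have "integrable (\<Pi>\<^sub>M b\<in>Basis. lborel) (\<lambda>z. \<Prod>b\<in>Basis. f b (z b))"
    by (intro product_integrable_prod f) auto
  then show "integrable lborel (\<lambda>x. \<Prod>b\<in>Basis. f b (x \<bullet> b))"
    by (subst lborel_eq, subst integrable_distr_eq) (auto simp: coord m)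
  have "(\<integral>x. (\<Prod>b\<in>Basis. f b (x \<bullet> b)) \<partial>lborel) = (\<integral>z. (\<Prod>b\<in>Basis. f b (z b)) \<partial>(\<Pi>\<^sub>M b\<in>Basis. lborel))"
    by (subst lborel_eq, subst integral_distr) (auto simp: coord m)
  also have "\<dots> = (\<Prod>b\<in>Basis. \<integral>y. f b y \<partial>lborel)"
    by (intro product_integral_prod f) auto
  finally show "(\<integral>x. (\<Prod>b\<in>Basis. f b (x \<bullet> b)) \<partial>lborel) = (\<Prod>b\<in>Basis. \<integral>y. f b y \<partial>lborel)" .
qed

lemma nn_integral_lborel_translate:
  fixes f :: "'a::euclidean_space \<Rightarrow> ennreal"
  assumes [measurable]: "f \<in> borel_measurable borel"
  shows "(\<integral>\<^sup>+x. f (c + x) \<partial>lborel) = (\<integral>\<^sup>+x. f x \<partial>lborel)"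
  by (subst (2) lborel_distr_plus[symmetric, of c]) (simp add: nn_integral_distr)

lemma integrable_lborel_affine:
  fixes f :: "'a::euclidean_space \<Rightarrow> real"
  assumes f: "integrable lborel f" and c: "c \<noteq> 0"
  shows "integrable lborel (\<lambda>x. f (t + c *\<^sub>R x))"
proof -
  have [measurable]: "f \<in> borel_measurable borel" using f by auto
  show ?thesis
    using f by (subst (asm) lborel_affine[OF c, of t])
      (simp add: integrable_density integrable_distr_eq c)
qed

lemma integral_lborel_affine:
  fixes f :: "'a::euclidean_space \<Rightarrow> real"
  assumes [measurable]: "f \<in> borel_measurable borel" and c: "c \<noteq> 0"
  shows "(\<integral>x. f x \<partial>lborel) = \<bar>c\<bar> ^ DIM('a) * (\<integral>x. f (t + c *\<^sub>R x) \<partial>lborel)"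
  by (subst lborel_affine[OF c, of t]) (simp add: integral_density integral_distr)

text \<open>Comparison with a single term of the exponential series: \<open>k\<close> is chosen with
  \<open>2 * d <= k * \<alpha>\<close>, so that for \<open>r > 1\<close> the polynomial is at most a
  constant times \<open>(a * r powr \<alpha>) ^ k / fact k\<close>.\<close>

lemma exp_powr_polynomial_bound:
  fixes \<alpha> a :: real
  assumes "0 < \<alpha>" "0 < a"
  shows "\<exists>K. \<forall>r\<ge>0. exp (- a * r powr \<alpha>) * (1 + r\<^sup>2) ^ d \<le> K"
proof -
  obtain k :: nat where k: "2 * real d \<le> real k * \<alpha>"
    using assms by (metis ex_less_of_nat_mult less_imp_le)
  have d2: "(1 + r\<^sup>2) ^ d \<le> 2 ^ d + 2 ^ d / a ^ k * fact k * exp (a * r powr \<alpha>)" if r: "0 \<le> r" for r :: real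
  proof (cases "r \<le> 1")
    case True
    then have "(1 + r\<^sup>2) ^ d \<le> 2 ^ d" using r by (intro power_mono) (auto simp: power_le_one)
    then show ?thesis using assms by (smt (verit) divide_nonneg_nonneg exp_ge_zero fact_ge_zero mult_nonneg_nonneg zero_le_power)
  next
    case False
    then have "(1 + r\<^sup>2) ^ d \<le> (2 * r\<^sup>2) ^ d" by (intro power_mono) (auto simp: one_le_power)
    also have "\<dots> = 2 ^ d * r powr (2 * real d)"
      using False powr_realpow[of r "2 * d"] by (simp add: power_mult_distrib power_mult)
    also have "\<dots> \<le> 2 ^ d * r powr (real k * \<alpha>)" using False k by (intro mult_left_mono powr_mono) auto
    also have "r powr (real k * \<alpha>) = (r powr \<alpha>) ^ k"
      using False by (simp add: powr_power mult.commute)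
    also have "2 ^ d * (r powr \<alpha>) ^ k = 2 ^ d / a ^ k * fact k * ((a * r powr \<alpha>) ^ k / fact k)"
      using assms by (simp add: power_mult_distrib field_simps)
    also have "\<dots> \<le> 2 ^ d / a ^ k * fact k * exp (a * r powr \<alpha>)"
    proof (intro mult_left_mono)
      have "(\<lambda>n. (a * r powr \<alpha>) ^ n /\<^sub>R fact n) sums exp (a * r powr \<alpha>)" by (rule exp_converges)
      then have "(\<Sum>n\<in>{k}. (a * r powr \<alpha>) ^ n /\<^sub>R fact n) \<le> exp (a * r powr \<alpha>)"
        using assms by (intro sum_le_suminf[THEN order_trans]) (auto simp: sums_iff)
      then show "(a * r powr \<alpha>) ^ k / fact k \<le> exp (a * r powr \<alpha>)" by (simp add: field_simps)
    qed (use assms in auto)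
    finally show ?thesis by (smt (verit) zero_le_power)
  qed
  have "exp (- a * r powr \<alpha>) * (1 + r\<^sup>2) ^ d \<le> 2 ^ d + 2 ^ d / a ^ k * fact k" if r: "0 \<le> r" for r :: real
  proof -
    have "exp (- a * r powr \<alpha>) * (1 + r\<^sup>2) ^ d \<le> exp (- a * r powr \<alpha>) * (2 ^ d + 2 ^ d / a ^ k * fact k * exp (a * r powr \<alpha>))"
      by (intro mult_left_mono d2 r) auto
    also have "\<dots> = exp (- a * r powr \<alpha>) * 2 ^ d + 2 ^ d / a ^ k * fact k"
      by (simp add: algebra_simps exp_minus)
    also have "exp (- a * r powr \<alpha>) * 2 ^ d \<le> 1 * 2 ^ d"
      using assms by (intro mult_right_mono) auto
    finally show ?thesis by simp
  qed
  then show ?thesis by blast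
qed

text \<open>Domination by a product of the one-variable functions \<open>1 / (1 + y^2)\<close>
  reduces the claim to the coordinates; \<open>(1 + |\<xi>|^2) ^ DIM('a)\<close> bounds the product
  of the denominators.\<close>

lemma integrable_exp_norm_powr:
  fixes \<alpha> a :: real
  assumes "0 < \<alpha>" "0 < a"
  shows "integrable lborel (\<lambda>\<xi>::'a::euclidean_space. exp (- a * norm \<xi> powr \<alpha>))"
proof -
  obtain K where K: "\<And>r. 0 \<le> r \<Longrightarrow> exp (- a * r powr \<alpha>) * (1 + r\<^sup>2) ^ DIM('a) \<le> K"
    using exp_powr_polynomial_bound[OF assms] by blast
  have bound: "exp (- a * norm \<xi> powr \<alpha>) \<le> K * (\<Prod>b\<in>Basis. inverse (1 + (\<xi> \<bullet> b)\<^sup>2))" for \<xi> :: 'a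
  proof -
    have "(\<Prod>b\<in>Basis. 1 + (\<xi> \<bullet> b)\<^sup>2) \<le> (\<Prod>b\<in>(Basis::'a set). 1 + (norm \<xi>)\<^sup>2)"
      by (intro prod_mono) (auto intro!: abs_le_square_iff[THEN iffD1] simp: Basis_le_norm)
    then have "exp (- a * norm \<xi> powr \<alpha>) * (\<Prod>b\<in>Basis. 1 + (\<xi> \<bullet> b)\<^sup>2)
        \<le> exp (- a * norm \<xi> powr \<alpha>) * (1 + (norm \<xi>)\<^sup>2) ^ DIM('a)"
      by (intro mult_left_mono) auto
    then have "exp (- a * norm \<xi> powr \<alpha>) * (\<Prod>b\<in>Basis. 1 + (\<xi> \<bullet> b)\<^sup>2) \<le> K"
      by (rule order_trans) (rule K, simp)
    moreover have "0 < (\<Prod>b\<in>Basis. 1 + (\<xi> \<bullet> b)\<^sup>2)"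
      by (intro prod_pos) (auto intro!: add_pos_nonneg)
    moreover have "(\<Prod>b\<in>Basis. inverse (1 + (\<xi> \<bullet> b)\<^sup>2)) = inverse (\<Prod>b\<in>Basis. 1 + (\<xi> \<bullet> b)\<^sup>2)"
      by (rule prod_inversef[unfolded o_def])
    ultimately show ?thesis
      by (simp only:) (simp only: divide_inverse[symmetric] pos_le_divide_eq)
  qed
  show ?thesis
  proof (rule Bochner_Integration.integrable_bound)
    show "integrable lborel (\<lambda>\<xi>::'a. K * (\<Prod>b\<in>Basis. inverse (1 + (\<xi> \<bullet> b)\<^sup>2)))"
      by (intro integrable_mult_right integrable_lborel_coordinate_prod integrable_inverse_one_plus_square)
  qed (use bound in \<open>auto intro: order_trans[OF _ abs_ge_self]\<close>)
qed

section \<open>The Gaussian density and its Fourier transform\<close>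

definition gauss :: "'a::euclidean_space \<Rightarrow> real" where
  "gauss z = exp (- (norm z)\<^sup>2 / 2) / (2 * pi) powr (DIM('a) / 2)"

lemma gauss_eq_prod: "gauss z = (\<Prod>b\<in>Basis. std_normal_density (z \<bullet> b))"
proof -
  have "(\<Prod>b\<in>(Basis::'a set). std_normal_density (z \<bullet> b))
      = (\<Prod>b\<in>(Basis::'a set). 1 / sqrt (2 * pi)) * exp (\<Sum>b\<in>Basis. - (z \<bullet> b)\<^sup>2 / 2)"
    by (simp only: std_normal_density_def exp_sum[OF finite_Basis] prod.distrib)
  also have "(\<Sum>b\<in>Basis. - (z \<bullet> b)\<^sup>2 / 2) = - (norm z)\<^sup>2 / 2"
    by (simp add: norm_eq_sqrt_inner euclidean_inner[of z z] sum_nonneg power2_eq_square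
      sum_negf sum_divide_distrib)
  also have "(\<Prod>b\<in>(Basis::'a set). 1 / sqrt (2 * pi)) = 1 / (2 * pi) powr (DIM('a) / 2)"
    by (simp add: powr_half_sqrt[symmetric] powr_power power_divide)
  finally show ?thesis by (simp add: gauss_def)
qed

lemma borel_measurable_gauss[measurable]: "gauss \<in> borel_measurable borel"
  unfolding gauss_def[abs_def] by measurable

lemma gauss_nonneg: "0 \<le> gauss z"
  by (simp add: gauss_def)

lemma gauss_le: "gauss (z::'a::euclidean_space) \<le> 1 / (2 * pi) powr (DIM('a) / 2)"
  by (simp add: gauss_def divide_simps)

lemma integrable_gauss: "integrable lborel gauss"
  unfolding gauss_eq_prod[abs_def]
  by (intro integrable_lborel_coordinate_prod) (simp add: integrable_normal_density)

lemma integral_gauss: "(\<integral>z. gauss z \<partial>lborel) = 1"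
  unfolding gauss_eq_prod
  by (subst integral_lborel_coordinate_prod) (auto simp: integrable_normal_density)

text \<open>The complex exponential factorises over the coordinates, so
  \<open>char_std_normal_distribution\<close> applies to each factor; the cosine is the real
  part.\<close>

lemma integral_cos_gauss:
  fixes z :: "'a::euclidean_space"
  shows "(\<integral>\<xi>. cos (\<xi> \<bullet> z) * gauss \<xi> \<partial>lborel) = exp (- (norm z)\<^sup>2 / 2)"
proof -
  let ?f = "\<lambda>b y. iexp ((z \<bullet> b) * y) * complex_of_real (std_normal_density y)"
  have int: "integrable lborel (?f b)" for b
  proof (rule Bochner_Integration.integrable_bound)
    show "integrable lborel std_normal_density" by simp
  qed (auto simp: norm_mult)
  have eq: "iexp (\<xi> \<bullet> z) * complex_of_real (gauss \<xi>) = (\<Prod>b\<in>Basis. ?f b (\<xi> \<bullet> b))" for \<xi>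
    by (simp add: gauss_eq_prod prod.distrib exp_sum[symmetric] euclidean_inner[of \<xi> z] 
      sum_distrib_left mult_ac)
  have "(\<integral>\<xi>. iexp (\<xi> \<bullet> z) * complex_of_real (gauss \<xi>) \<partial>lborel) = (\<Prod>b\<in>Basis. \<integral>y. ?f b y \<partial>lborel)"
    unfolding eq by (rule integral_lborel_coordinate_prod) (rule int)
  also have "\<dots> = (\<Prod>b\<in>Basis. complex_of_real (exp (- (z \<bullet> b)\<^sup>2 / 2)))"
  proof (intro prod.cong refl)
    fix b
    have "(\<integral>y. ?f b y \<partial>lborel) = char std_normal_distribution (z \<bullet> b)"
      unfolding char_def
      by (subst integral_density) (auto simp: scaleR_conv_of_real mult.commute normal_density_nonneg)
    then show "(\<integral>y. ?f b y \<partial>lborel) = complex_of_real (exp (- (z \<bullet> b)\<^sup>2 / 2))"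
      by (simp add: char_std_normal_distribution)
  qed
  also have "\<dots> = complex_of_real (exp (- (norm z)\<^sup>2 / 2))"
    by (simp add: of_real_prod[symmetric] exp_sum[symmetric] norm_eq_sqrt_inner euclidean_inner[of z z]
      sum_nonneg power2_eq_square sum_negf sum_divide_distrib del: of_real_prod)
  finally have *: "(\<integral>\<xi>. iexp (\<xi> \<bullet> z) * complex_of_real (gauss \<xi>) \<partial>lborel) = complex_of_real (exp (- (norm z)\<^sup>2 / 2))" .
  have "integrable lborel (\<lambda>\<xi>. iexp (\<xi> \<bullet> z) * complex_of_real (gauss \<xi>))"
    unfolding eq by (rule integrable_lborel_coordinate_prod) (rule int)
  then have "(\<integral>\<xi>. Re (iexp (\<xi> \<bullet> z) * complex_of_real (gauss \<xi>)) \<partial>lborel) = exp (- (norm z)\<^sup>2 / 2)"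
    by (subst integral_Re) (auto simp: *)
  then show ?thesis by (simp add: Re_exp)
qed

text \<open>The inversion integral with the cosine in place of the complex exponential: a real
  characteristic function is even, so the sine part integrates to 0.\<close>

definition inv_fourier :: "('a::euclidean_space \<Rightarrow> real) \<Rightarrow> 'a \<Rightarrow> real" where
  "inv_fourier \<phi> z = (\<integral>\<xi>. cos (\<xi> \<bullet> z) * \<phi> \<xi> \<partial>lborel) / (2 * pi) ^ DIM('a)"

lemma integrable_cos_mult:
  fixes \<phi> :: "'a::euclidean_space \<Rightarrow> real"
  assumes "integrable lborel \<phi>"
  shows "integrable lborel (\<lambda>\<xi>. cos (\<xi> \<bullet> z) * \<phi> \<xi>)"
proof (rule Bochner_Integration.integrable_bound[OF assms])
  have [measurable]: "\<phi> \<in> borel_measurable borel" using assms by auto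
  show "(\<lambda>\<xi>. cos (\<xi> \<bullet> z) * \<phi> \<xi>) \<in> borel_measurable lborel" by measurable
qed (auto simp: abs_mult mult_left_le_one_le)

lemma abs_inv_fourier_le:
  fixes \<phi> :: "'a::euclidean_space \<Rightarrow> real"
  assumes "integrable lborel \<phi>"
  shows "\<bar>inv_fourier \<phi> z\<bar> \<le> (\<integral>\<xi>. \<bar>\<phi> \<xi>\<bar> \<partial>lborel) / (2 * pi) ^ DIM('a)"
proof -
  have "\<bar>\<integral>\<xi>. cos (\<xi> \<bullet> z) * \<phi> \<xi> \<partial>lborel\<bar> \<le> (\<integral>\<xi>. \<bar>cos (\<xi> \<bullet> z) * \<phi> \<xi>\<bar> \<partial>lborel)"
    by (rule integral_abs_bound)
  also have "\<dots> \<le> (\<integral>\<xi>. \<bar>\<phi> \<xi>\<bar> \<partial>lborel)"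
    using assms by (intro integral_mono integrable_abs integrable_cos_mult)
      (auto simp: abs_mult mult_left_le_one_le)
  finally show ?thesis by (simp add: inv_fourier_def abs_mult divide_right_mono)
qed

lemma continuous_on_inv_fourier:
  fixes \<phi> :: "'a::euclidean_space \<Rightarrow> real"
  assumes \<phi>: "integrable lborel \<phi>"
  shows "continuous_on UNIV (inv_fourier \<phi>)"
proof (rule continuous_on_sequentiallyI)
  fix u :: "nat \<Rightarrow> 'a" and a :: 'a assume u: "u \<longlonglongrightarrow> a"
  have [measurable]: "\<phi> \<in> borel_measurable borel" using \<phi> by auto
  have "(\<lambda>n. \<integral>\<xi>. cos (\<xi> \<bullet> u n) * \<phi> \<xi> \<partial>lborel) \<longlonglongrightarrow> (\<integral>\<xi>. cos (\<xi> \<bullet> a) * \<phi> \<xi> \<partial>lborel)"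
    by (rule integral_dominated_convergence[where w="\<lambda>\<xi>. \<bar>\<phi> \<xi>\<bar>"])
      (use \<phi> in \<open>auto intro!: tendsto_intros u AE_I2 simp: abs_mult mult_left_le_one_le\<close>)
  then show "(\<lambda>n. inv_fourier \<phi> (u n)) \<longlonglongrightarrow> inv_fourier \<phi> a"
    unfolding inv_fourier_def by (intro tendsto_intros) auto
qed

lemma gauss_minus_commute: "gauss (r *\<^sub>R (x - y)) = gauss (r *\<^sub>R (y - x))"
  by (simp add: gauss_def norm_minus_commute)

section \<open>Inversion for probability measures with a real integrable characteristic
  function\<close>

locale real_char_measure = prob_space \<mu> for \<mu> :: "'a::euclidean_space measure" +
  fixes \<phi> :: "'a \<Rightarrow> real"
  assumes sets_eq_borel[measurable_cong]: "sets \<mu> = sets borel"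
    and char_eq: "(\<integral>x. exp (\<i> * complex_of_real (\<xi> \<bullet> x)) \<partial>\<mu>) = complex_of_real (\<phi> \<xi>)"
    and integrable_char: "integrable lborel \<phi>"
begin

lemma measurable_char[measurable]: "\<phi> \<in> borel_measurable borel"
  using integrable_char by auto

text \<open>Since the characteristic function is real, the sine integral vanishes and the addition
  theorem leaves only the cosine term.\<close>

lemma integral_cos_shift: "(\<integral>x. cos (\<xi> \<bullet> (x - y)) \<partial>\<mu>) = cos (\<xi> \<bullet> y) * \<phi> \<xi>"
proof -
  have int: "integrable \<mu> (\<lambda>x. exp (\<i> * complex_of_real (\<xi> \<bullet> x)))"
    by (rule integrable_const_bound[where B=1]) auto
  have c: "(\<integral>x. cos (\<xi> \<bullet> x) \<partial>\<mu>) = \<phi> \<xi>" and s: "(\<integral>x. sin (\<xi> \<bullet> x) \<partial>\<mu>) = 0"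
    using integral_Re[OF int] integral_Im[OF int] by (simp_all add: char_eq Re_exp Im_exp)
  have ic: "integrable \<mu> (\<lambda>x. cos (\<xi> \<bullet> x))" and iS: "integrable \<mu> (\<lambda>x. sin (\<xi> \<bullet> x))"
    by (rule integrable_const_bound[where B=1]; simp)+
  have "(\<integral>x. cos (\<xi> \<bullet> (x - y)) \<partial>\<mu>) = (\<integral>x. cos (\<xi> \<bullet> x) * cos (\<xi> \<bullet> y) + sin (\<xi> \<bullet> x) * sin (\<xi> \<bullet> y) \<partial>\<mu>)"
    by (simp add: inner_diff_right cos_diff)
  also have "\<dots> = \<phi> \<xi> * cos (\<xi> \<bullet> y)"
    using ic iS by (simp add: c s)
  finally show ?thesis by simp
qed

lemma pair_sigma: "pair_sigma_finite \<mu> lborel"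
  by unfold_locales

text \<open>The Gaussian at scale \<open>\<sigma>\<close> is itself a Fourier integral of a Gaussian
  at the inverse scale; Fubini moves the integral over \<open>\<mu>\<close> inside and turns it into
  \<open>\<phi>\<close>.\<close>

lemma gauss_smoothing:
  assumes \<sigma>: "0 < \<sigma>"
  shows "(\<integral>x. gauss ((1 / \<sigma>) *\<^sub>R (x - y)) \<partial>\<mu>)
    = \<sigma> ^ DIM('a) * ((\<integral>\<xi>. gauss (\<sigma> *\<^sub>R \<xi>) * (cos (\<xi> \<bullet> y) * \<phi> \<xi>) \<partial>lborel) / (2 * pi) powr (DIM('a) / 2))"
proof -
  interpret pair_sigma_finite \<mu> lborel by (rule pair_sigma)
  let ?c = "\<sigma> ^ DIM('a) / (2 * pi) powr (DIM('a) / 2)"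
  have eq: "gauss ((1 / \<sigma>) *\<^sub>R (x - y)) = ?c * (\<integral>\<xi>. cos (\<xi> \<bullet> (x - y)) * gauss (\<sigma> *\<^sub>R \<xi>) \<partial>lborel)" for x
  proof -
    let ?z = "(1 / \<sigma>) *\<^sub>R (x - y)"
    have "gauss ?z = (\<integral>\<xi>. cos (\<xi> \<bullet> ?z) * gauss \<xi> \<partial>lborel) / (2 * pi) powr (DIM('a) / 2)"
      unfolding integral_cos_gauss by (simp add: gauss_def)
    also have "(\<integral>\<xi>. cos (\<xi> \<bullet> ?z) * gauss \<xi> \<partial>lborel)
        = \<sigma> ^ DIM('a) * (\<integral>\<xi>. cos ((0 + \<sigma> *\<^sub>R \<xi>) \<bullet> ?z) * gauss (0 + \<sigma> *\<^sub>R \<xi>) \<partial>lborel)"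
      using \<sigma> by (subst integral_lborel_affine[where c=\<sigma> and t=0]) auto
    finally show ?thesis using \<sigma> by simp
  qed
  have ig: "integrable lborel (\<lambda>\<xi>. gauss (\<sigma> *\<^sub>R \<xi> :: 'a))"
    using integrable_lborel_affine[OF integrable_gauss, of \<sigma> 0] \<sigma> by simp
  have "integrable (\<mu> \<Otimes>\<^sub>M lborel) (\<lambda>(x, \<xi>). gauss (\<sigma> *\<^sub>R \<xi> :: 'a))"
    by (rule Fubini_integrable) (auto simp: ig)
  then have int: "integrable (\<mu> \<Otimes>\<^sub>M lborel) (\<lambda>(x, \<xi>). cos (\<xi> \<bullet> (x - y)) * gauss (\<sigma> *\<^sub>R \<xi>))"
    by (rule Bochner_Integration.integrable_bound)
      (auto simp: abs_mult gauss_nonneg mult_left_le_one_le)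
  have "(\<integral>x. gauss ((1 / \<sigma>) *\<^sub>R (x - y)) \<partial>\<mu>) = ?c * (\<integral>x. \<integral>\<xi>. cos (\<xi> \<bullet> (x - y)) * gauss (\<sigma> *\<^sub>R \<xi>) \<partial>lborel \<partial>\<mu>)"
    by (simp add: eq)
  also have "(\<integral>x. \<integral>\<xi>. cos (\<xi> \<bullet> (x - y)) * gauss (\<sigma> *\<^sub>R \<xi>) \<partial>lborel \<partial>\<mu>)
      = (\<integral>\<xi>. \<integral>x. cos (\<xi> \<bullet> (x - y)) * gauss (\<sigma> *\<^sub>R \<xi>) \<partial>\<mu> \<partial>lborel)"
    using Fubini_integral[OF int] by simp
  also have "\<dots> = (\<integral>\<xi>. gauss (\<sigma> *\<^sub>R \<xi>) * (cos (\<xi> \<bullet> y) * \<phi> \<xi>) \<partial>lborel)"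
    by (simp add: integral_cos_shift mult.commute)
  finally show ?thesis by simp
qed

text \<open>The density of the convolution of \<open>\<mu>\<close> with a centred Gaussian of
  standard deviation \<open>\<sigma>\<close> in each coordinate, written on the Fourier side, where
  \<open>\<sigma>\<close> can tend to 0 under the integral.\<close>

definition smooth_density :: "real \<Rightarrow> 'a \<Rightarrow> real" where
  "smooth_density \<sigma> y =
     (\<integral>\<xi>. gauss (\<sigma> *\<^sub>R \<xi>) * (cos (\<xi> \<bullet> y) * \<phi> \<xi>) \<partial>lborel) / (2 * pi) powr (DIM('a) / 2)"

lemma integral_gauss_eq_smooth_density:
  "0 < \<sigma> \<Longrightarrow> (\<integral>x. gauss ((1 / \<sigma>) *\<^sub>R (y - x)) \<partial>\<mu>) = \<sigma> ^ DIM('a) * smooth_density \<sigma> y"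
  unfolding smooth_density_def by (subst gauss_minus_commute) (rule gauss_smoothing)

lemma smooth_density_nonneg:
  assumes "0 < \<sigma>"
  shows "0 \<le> smooth_density \<sigma> y"
proof -
  have "0 \<le> \<sigma> ^ DIM('a) * smooth_density \<sigma> y"
    unfolding integral_gauss_eq_smooth_density[OF assms, symmetric]
    by (intro integral_nonneg_AE AE_I2 gauss_nonneg)
  then show ?thesis using zero_less_power[OF assms, of "DIM('a)"] by (auto simp: zero_le_mult_iff)
qed

text \<open>Uniform in \<open>\<sigma>\<close>, hence usable for domination. One factor
  \<open>?k\<close> comes from the bound on \<open>gauss\<close>, the other from the division in
  \<open>smooth_density\<close>.\<close>

lemma smooth_density_le:
  "\<bar>smooth_density \<sigma> y\<bar> \<le> (\<integral>\<xi>. \<bar>\<phi> \<xi>\<bar> \<partial>lborel) / (2 * pi) ^ DIM('a)"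
proof -
  let ?k = "(2 * pi) powr (DIM('a) / 2)"
  have sq: "?k * ?k = (2 * pi) ^ DIM('a)"
    by (simp add: powr_add[symmetric] powr_realpow)
  have k: "0 < ?k" by simp
  have b: "\<bar>gauss (\<sigma> *\<^sub>R \<xi>) * (cos (\<xi> \<bullet> y) * \<phi> \<xi>)\<bar> \<le> 1 / ?k * \<bar>\<phi> \<xi>\<bar>" for \<xi>
    unfolding abs_mult by (intro mult_mono) (auto simp: gauss_nonneg gauss_le mult_left_le_one_le)
  have "\<bar>\<integral>\<xi>. gauss (\<sigma> *\<^sub>R \<xi>) * (cos (\<xi> \<bullet> y) * \<phi> \<xi>) \<partial>lborel\<bar> \<le> (\<integral>\<xi>. 1 / ?k * \<bar>\<phi> \<xi>\<bar> \<partial>lborel)"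
  proof (rule order_trans[OF integral_abs_bound], rule integral_mono)
    show "integrable lborel (\<lambda>\<xi>. 1 / ?k * \<bar>\<phi> \<xi>\<bar>)" using integrable_char by simp
    then show "integrable lborel (\<lambda>\<xi>. \<bar>gauss (\<sigma> *\<^sub>R \<xi>) * (cos (\<xi> \<bullet> y) * \<phi> \<xi>)\<bar>)"
      by (rule Bochner_Integration.integrable_bound) (use b in \<open>auto intro: order_trans[OF _ abs_ge_self]\<close>)
  qed (rule b)
  then have "\<bar>smooth_density \<sigma> y\<bar> \<le> (1 / ?k * (\<integral>\<xi>. \<bar>\<phi> \<xi>\<bar> \<partial>lborel)) / ?k"
    unfolding smooth_density_def abs_divide abs_of_pos[OF k] by (intro divide_right_mono) simp_all
  also have "\<dots> = (\<integral>\<xi>. \<bar>\<phi> \<xi>\<bar> \<partial>lborel) / (?k * ?k)" by simp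
  finally show ?thesis by (simp only: sq)
qed

lemma smooth_density_tendsto:
  "(\<lambda>n. smooth_density (1 / Suc n) y) \<longlonglongrightarrow> inv_fourier \<phi> y"
proof -
  let ?k = "(2 * pi) powr (DIM('a) / 2)"
  have sq: "?k * ?k = (2 * pi) ^ DIM('a)"
    by (simp add: powr_add[symmetric] powr_realpow)
  have lim: "(\<lambda>n. 1 / real (Suc n)) \<longlonglongrightarrow> 0" by (rule LIMSEQ_Suc[OF lim_1_over_n])
  have g0: "(\<lambda>n. gauss ((1 / real (Suc n)) *\<^sub>R \<xi> :: 'a)) \<longlonglongrightarrow> 1 / ?k" for \<xi>
  proof -
    have "(\<lambda>n. exp (- (norm ((1 / real (Suc n)) *\<^sub>R \<xi>))\<^sup>2 / 2) / ?k) \<longlonglongrightarrow> exp (- (norm (0 *\<^sub>R \<xi>))\<^sup>2 / 2) / ?k"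
      by (intro tendsto_intros lim) auto
    then show ?thesis by (simp add: gauss_def)
  qed
  have "(\<lambda>n. \<integral>\<xi>. gauss ((1 / Suc n) *\<^sub>R \<xi>) * (cos (\<xi> \<bullet> y) * \<phi> \<xi>) \<partial>lborel)
      \<longlonglongrightarrow> (\<integral>\<xi>. 1 / ?k * (cos (\<xi> \<bullet> y) * \<phi> \<xi>) \<partial>lborel)"
  proof (rule integral_dominated_convergence[where w="\<lambda>\<xi>. 1 / ?k * \<bar>\<phi> \<xi>\<bar>"])
    show "integrable lborel (\<lambda>\<xi>. 1 / ?k * \<bar>\<phi> \<xi>\<bar>)" using integrable_char by simp
    show "AE \<xi> in lborel. (\<lambda>n. gauss ((1 / Suc n) *\<^sub>R \<xi>) * (cos (\<xi> \<bullet> y) * \<phi> \<xi>)) \<longlonglongrightarrow> 1 / ?k * (cos (\<xi> \<bullet> y) * \<phi> \<xi>)"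
      by (intro AE_I2 tendsto_mult g0 tendsto_const)
    show "AE \<xi> in lborel. norm (gauss ((1 / Suc n) *\<^sub>R \<xi>) * (cos (\<xi> \<bullet> y) * \<phi> \<xi>)) \<le> 1 / ?k * \<bar>\<phi> \<xi>\<bar>" for n
      unfolding real_norm_def abs_mult
      by (intro AE_I2 mult_mono) (auto simp: gauss_nonneg gauss_le mult_left_le_one_le)
  qed measurable
  then have "(\<lambda>n. smooth_density (1 / Suc n) y) \<longlonglongrightarrow> (\<integral>\<xi>. 1 / ?k * (cos (\<xi> \<bullet> y) * \<phi> \<xi>) \<partial>lborel) / ?k"
    unfolding smooth_density_def by (intro tendsto_divide tendsto_const) auto
  also have "(\<integral>\<xi>. 1 / ?k * (cos (\<xi> \<bullet> y) * \<phi> \<xi>) \<partial>lborel) / ?k = (\<integral>\<xi>. cos (\<xi> \<bullet> y) * \<phi> \<xi> \<partial>lborel) / (?k * ?k)"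
    by simp
  finally show ?thesis unfolding sq inv_fourier_def .
qed

lemma inv_fourier_nonneg: "0 \<le> inv_fourier \<phi> y"
  by (rule LIMSEQ_le_const[OF smooth_density_tendsto]) (auto intro!: smooth_density_nonneg)

lemma measurable_inv_fourier[measurable]: "inv_fourier \<phi> \<in> borel_measurable borel"
  by (intro borel_measurable_continuous_onI continuous_on_inv_fourier integrable_char)

text \<open>Both sides integrate \<open>f\<close> against the law of a
  \<open>\<mu>\<close>-distributed point plus an independent Gaussian of scale
  \<open>\<sigma>\<close>.\<close>

lemma integral_gauss_convolution:
  fixes f :: "'a \<Rightarrow> real"
  assumes f: "integrable lborel f" and \<sigma>: "0 < \<sigma>"
  shows "(\<integral>x. \<integral>z. f (x + \<sigma> *\<^sub>R z) * gauss z \<partial>lborel \<partial>\<mu>) = (\<integral>y. f y * smooth_density \<sigma> y \<partial>lborel)"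
proof -
  interpret pair_sigma_finite \<mu> lborel by (rule pair_sigma)
  have [measurable]: "f \<in> borel_measurable borel" using f by auto
  let ?k = "(2 * pi) powr (DIM('a) / 2)"
  have eq: "(\<integral>z. f (x + \<sigma> *\<^sub>R z) * gauss z \<partial>lborel)
    = (\<integral>y. f y * gauss ((1 / \<sigma>) *\<^sub>R (y - x)) \<partial>lborel) / \<sigma> ^ DIM('a)" for x
    using \<sigma> by (subst integral_lborel_affine[where c=\<sigma> and t=x]) auto
  have "integrable (\<mu> \<Otimes>\<^sub>M lborel) (\<lambda>(x, y). 1 / ?k * f y)"
    by (rule Fubini_integrable) (auto simp: f)
  then have int: "integrable (\<mu> \<Otimes>\<^sub>M lborel) (\<lambda>(x, y). f y * gauss ((1 / \<sigma>) *\<^sub>R (y - x)))"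
  proof (rule Bochner_Integration.integrable_bound)
    have "\<bar>f y\<bar> * gauss z \<le> \<bar>f y\<bar> * (1 / ?k)" for y z :: 'a
      by (intro mult_left_mono gauss_le) auto
    then show "AE xy in \<mu> \<Otimes>\<^sub>M lborel. norm (case xy of (x, y) \<Rightarrow> f y * gauss ((1 / \<sigma>) *\<^sub>R (y - x)))
        \<le> norm (case xy of (x, y) \<Rightarrow> 1 / ?k * f y)"
      by (intro AE_I2) (auto simp: abs_mult gauss_nonneg split: prod.split)
  qed measurable
  have "(\<integral>x. \<integral>z. f (x + \<sigma> *\<^sub>R z) * gauss z \<partial>lborel \<partial>\<mu>)
      = (\<integral>x. \<integral>y. f y * gauss ((1 / \<sigma>) *\<^sub>R (y - x)) \<partial>lborel \<partial>\<mu>) / \<sigma> ^ DIM('a)"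
    by (simp add: eq)
  also have "(\<integral>x. \<integral>y. f y * gauss ((1 / \<sigma>) *\<^sub>R (y - x)) \<partial>lborel \<partial>\<mu>)
      = (\<integral>y. \<integral>x. f y * gauss ((1 / \<sigma>) *\<^sub>R (y - x)) \<partial>\<mu> \<partial>lborel)"
    using Fubini_integral[OF int] by simp
  also have "\<dots> = (\<integral>y. \<sigma> ^ DIM('a) * (f y * smooth_density \<sigma> y) \<partial>lborel)"
    using integral_gauss_eq_smooth_density[OF \<sigma>] by (simp add: mult_ac)
  also have "\<dots> / \<sigma> ^ DIM('a) = (\<integral>y. f y * smooth_density \<sigma> y \<partial>lborel)"
    using \<sigma> by simp
  finally show ?thesis .
qed

text \<open>Let \<open>\<sigma> = 1 / Suc n\<close> tend to 0 in
  \<open>integral_gauss_convolution\<close>: the left side converges because \<open>f\<close> is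
  bounded and continuous, the right side because \<open>f\<close> is integrable and
  \<open>smooth_density\<close> is bounded uniformly.\<close>

lemma integral_eq_inv_fourier:
  fixes f :: "'a \<Rightarrow> real"
  assumes f: "integrable lborel f" and cont: "continuous_on UNIV f" and B: "\<And>x. \<bar>f x\<bar> \<le> B"
  shows "(\<integral>x. f x \<partial>\<mu>) = (\<integral>y. f y * inv_fourier \<phi> y \<partial>lborel)"
proof (rule LIMSEQ_unique)
  have [measurable]: "f \<in> borel_measurable borel" using f by auto
  have lim: "(\<lambda>n. 1 / real (Suc n)) \<longlonglongrightarrow> 0" by (rule LIMSEQ_Suc[OF lim_1_over_n])
  have igb: "integrable lborel (\<lambda>z::'a. B * gauss z)" by (simp add: integrable_gauss)
  have fg: "\<bar>f u * gauss z\<bar> \<le> B * gauss z" for u z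
    using B[of u] by (simp add: abs_mult gauss_nonneg mult_right_mono)
  have Bf: "\<bar>\<integral>z. f (x + \<sigma> *\<^sub>R z) * gauss z \<partial>lborel\<bar> \<le> B" for x \<sigma>
  proof -
    have "\<bar>\<integral>z. f (x + \<sigma> *\<^sub>R z) * gauss z \<partial>lborel\<bar> \<le> (\<integral>z. B * gauss (z::'a) \<partial>lborel)"
    proof (rule order_trans[OF integral_abs_bound], rule integral_mono[OF _ igb fg])
      show "integrable lborel (\<lambda>z. \<bar>f (x + \<sigma> *\<^sub>R z) * gauss z\<bar>)"
        by (rule Bochner_Integration.integrable_bound[OF igb])
          (use fg in \<open>auto intro: order_trans[OF _ abs_ge_self]\<close>)
    qed
    then show ?thesis by (simp add: integral_gauss)
  qed
  have inner: "(\<lambda>n. \<integral>z. f (x + (1 / Suc n) *\<^sub>R z) * gauss z \<partial>lborel) \<longlonglongrightarrow> f x" for x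
  proof -
    have "(\<lambda>n. \<integral>z. f (x + (1 / Suc n) *\<^sub>R z) * gauss z \<partial>lborel) \<longlonglongrightarrow> (\<integral>z. f x * gauss (z::'a) \<partial>lborel)"
    proof (rule integral_dominated_convergence[OF _ _ igb])
      have "(\<lambda>n. f (x + (1 / Suc n) *\<^sub>R z)) \<longlonglongrightarrow> f (x + 0 *\<^sub>R z)" for z
        by (rule continuous_on_tendsto_compose[OF cont]) (intro tendsto_intros lim, auto)
      then show "AE z in lborel. (\<lambda>n. f (x + (1 / Suc n) *\<^sub>R z) * gauss z) \<longlonglongrightarrow> f x * gauss z"
        by (intro AE_I2 tendsto_mult tendsto_const) simp
    qed (use fg in auto)
    then show ?thesis by (simp add: integral_gauss)
  qed
  have "(\<lambda>n. \<integral>x. \<integral>z. f (x + (1 / Suc n) *\<^sub>R z) * gauss z \<partial>lborel \<partial>\<mu>) \<longlonglongrightarrow> (\<integral>x. f x \<partial>\<mu>)"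
    by (rule integral_dominated_convergence[where w="\<lambda>_. B"]) (use inner Bf in auto)
  then show "(\<lambda>n. \<integral>y. f y * smooth_density (1 / Suc n) y \<partial>lborel) \<longlonglongrightarrow> (\<integral>x. f x \<partial>\<mu>)"
    by (simp add: integral_gauss_convolution[OF f])
  let ?C = "(\<integral>\<xi>. \<bar>\<phi> \<xi>\<bar> \<partial>lborel) / (2 * pi) ^ DIM('a)"
  have [measurable]: "smooth_density \<sigma> \<in> borel_measurable borel" for \<sigma>
    unfolding smooth_density_def[abs_def] by measurable
  show "(\<lambda>n. \<integral>y. f y * smooth_density (1 / Suc n) y \<partial>lborel) \<longlonglongrightarrow> (\<integral>y. f y * inv_fourier \<phi> y \<partial>lborel)"
  proof (rule integral_dominated_convergence[where w="\<lambda>y. \<bar>f y\<bar> * ?C"])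
    show "AE y in lborel. norm (f y * smooth_density (1 / Suc n) y) \<le> \<bar>f y\<bar> * ?C" for n
      unfolding real_norm_def abs_mult by (intro AE_I2 mult_left_mono smooth_density_le) auto
    show "AE y in lborel. (\<lambda>n. f y * smooth_density (1 / Suc n) y) \<longlonglongrightarrow> f y * inv_fourier \<phi> y"
      by (intro AE_I2 tendsto_mult tendsto_const smooth_density_tendsto)
    show "integrable lborel (\<lambda>y. \<bar>f y\<bar> * ?C)" using f by simp
  qed measurable
qed

theorem density_inv_fourier: "\<mu> = density lborel (\<lambda>z. ennreal (inv_fourier \<phi> z))"
proof (rule measure_eqI_generator_eq)
  let ?E = "range (\<lambda>(a, b). box a b::'a set)"
  show "Int_stable ?E"
    by (auto simp: Int_stable_def box_Int_box)
  show "?E \<subseteq> Pow UNIV" "sets \<mu> = sigma_sets UNIV ?E"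
    "sets (density lborel (\<lambda>z. ennreal (inv_fourier \<phi> z))) = sigma_sets UNIV ?E"
    by (simp_all add: borel_eq_box sets_eq_borel)
  let ?A = "\<lambda>n::nat. box (- (real n *\<^sub>R One)) (real n *\<^sub>R One) :: 'a set"
  show "range ?A \<subseteq> ?E" "(\<Union>i. ?A i) = UNIV"
    unfolding UN_box_eq_UNIV by auto
  show "emeasure \<mu> (?A i) \<noteq> \<infinity>" for i by auto
  let ?C = "(\<integral>\<xi>. \<bar>\<phi> \<xi>\<bar> \<partial>lborel) / (2 * pi) ^ DIM('a)"
  fix S assume "S \<in> ?E"
  then obtain a b where S: "S = box a b" by auto
  have S_fin: "emeasure lborel S < \<infinity>" by (simp add: S emeasure_lborel_box_eq)
  have [measurable]: "S \<in> sets borel" by (simp add: S)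
  \<comment> \<open>Continuous functions increasing to the indicator of the box.
    \<open>infdist\<close> to the empty set is 0 by convention, which is why the complement is shown
    to be nonempty next.\<close>
  define f where "f n x = min 1 (real n * infdist x (- S))" for n x
  have ne: "- S \<noteq> {}" using not_bounded_UNIV bounded_box[of a b] unfolding S by (metis Compl_eq_Diff_UNIV Diff_eq_empty_iff bounded_subset)
  have f0: "x \<notin> S \<Longrightarrow> f n x = 0" for n x by (simp add: f_def)
  have f01: "0 \<le> f n x" "f n x \<le> 1" for n x by (auto simp: f_def infdist_nonneg)
  have f_cont: "continuous_on UNIV (f n)" for n
    unfolding f_def by (intro continuous_intros)
  then have [measurable]: "f n \<in> borel_measurable borel" for n
    by (rule borel_measurable_continuous_onI)
  have ind: "integrable lborel (\<lambda>x. indicator S x :: real)"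
    using S_fin by (intro integrable_real_indicator) auto
  have f_int: "integrable lborel (f n)" for n
    by (rule Bochner_Integration.integrable_bound[OF ind])
      (use f01 f0 in \<open>auto simp: indicator_def\<close>)
  have f_lim: "(\<lambda>n. f n x) \<longlonglongrightarrow> indicator S x" for x
  proof (cases "x \<in> S")
    case True
    have "closed (- S)" by (auto simp: S closed_Compl open_box)
    then have d: "0 < infdist x (- S)"
      using True ne by (metis ComplD in_closed_iff_infdist_zero infdist_nonneg order_less_le)
    obtain N :: nat where N: "1 \<le> real N * infdist x (- S)"
      using ex_less_of_nat_mult[OF d, of 1] by (auto intro: less_imp_le)
    have "\<forall>\<^sub>F n in sequentially. f n x = 1"
      unfolding eventually_sequentially f_def
      by (intro exI[of _ N] allI impI) (use d N in \<open>smt (verit) mult_right_mono of_nat_le_iff\<close>)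
    then show ?thesis using True by (simp add: tendsto_eventually)
  qed (simp add: f0)
  have "(\<lambda>n. \<integral>x. f n x \<partial>\<mu>) \<longlonglongrightarrow> (\<integral>x. indicator S x \<partial>\<mu>)"
    by (rule integral_dominated_convergence[where w="\<lambda>_. 1"]) (use f01 f_lim in auto)
  moreover have "(\<lambda>n. \<integral>y. f n y * inv_fourier \<phi> y \<partial>lborel) \<longlonglongrightarrow> (\<integral>y. indicator S y * inv_fourier \<phi> y \<partial>lborel)"
  proof (rule integral_dominated_convergence[where w="\<lambda>y. indicator S y * ?C"])
    show "AE y in lborel. norm (f n y * inv_fourier \<phi> y) \<le> indicator S y * ?C" for n
      unfolding real_norm_def abs_mult
      by (intro AE_I2 mult_mono abs_inv_fourier_le integrable_char) (use f01 f0 in \<open>auto simp: indicator_def\<close>)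
  qed (use f_lim ind in \<open>auto intro!: tendsto_intros\<close>)
  moreover have "(\<integral>x. f n x \<partial>\<mu>) = (\<integral>y. f n y * inv_fourier \<phi> y \<partial>lborel)" for n
    by (rule integral_eq_inv_fourier[OF f_int f_cont, where B=1]) (use f01 in auto)
  ultimately have eq: "measure \<mu> S = (\<integral>y. indicator S y * inv_fourier \<phi> y \<partial>lborel)"
    by (simp add: LIMSEQ_unique)
  have int: "integrable lborel (\<lambda>y. indicator S y * inv_fourier \<phi> y)"
    by (rule Bochner_Integration.integrable_bound[where f="\<lambda>y. indicator S y * ?C"])
      (use ind abs_inv_fourier_le[OF integrable_char] in \<open>auto simp: indicator_def intro: order_trans[OF _ abs_ge_self]\<close>)
  have "emeasure (density lborel (\<lambda>z. ennreal (inv_fourier \<phi> z))) S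
      = (\<integral>\<^sup>+y. ennreal (indicator S y * inv_fourier \<phi> y) \<partial>lborel)"
    by (simp add: emeasure_density) (auto intro!: nn_integral_cong simp: indicator_def)
  also have "\<dots> = emeasure \<mu> S"
    by (subst nn_integral_eq_integral[OF int]) (auto simp: inv_fourier_nonneg eq[symmetric] emeasure_eq_measure)
  finally show "emeasure \<mu> S = emeasure (density lborel (\<lambda>z. ennreal (inv_fourier \<phi> z))) S" ..
qed

end

text \<open>Continuity of translation in L1, by Scheffe: the translates converge pointwise and have
  the same mass as the limit.\<close>

lemma nn_integral_translate_diff_tendsto:
  fixes p :: "'a::euclidean_space \<Rightarrow> real"
  assumes p: "integrable lborel p" and cont: "continuous_on UNIV p" and h: "h \<longlonglongrightarrow> 0"
  shows "(\<lambda>n. \<integral>\<^sup>+z. ennreal \<bar>p (h n + z) - p z\<bar> \<partial>lborel) \<longlonglongrightarrow> 0"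
proof -
  have [measurable]: "p \<in> borel_measurable borel" using p by auto
  have "(\<lambda>n. \<integral>\<^sup>+z. ennreal (norm (p (h n + z) - p z)) \<partial>lborel) \<longlonglongrightarrow> 0"
  proof (rule Scheffe_lemma2[OF _ p])
    have "(\<lambda>n. p (h n + z)) \<longlonglongrightarrow> p (0 + z)" for z
      by (rule continuous_on_tendsto_compose[OF cont]) (intro tendsto_intros h, auto)
    then show "AE z in lborel. (\<lambda>n. p (h n + z)) \<longlonglongrightarrow> p z" by simp
    show "(\<integral>\<^sup>+z. ennreal (norm (p (h n + z))) \<partial>lborel) \<le> (\<integral>\<^sup>+z. ennreal (norm (p z)) \<partial>lborel)" for n
      using nn_integral_lborel_translate[of "\<lambda>z. ennreal (norm (p z))" "h n"] by simp
  qed measurable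
  then show ?thesis by simp
qed

section \<open>The path law and the Markov property\<close>

text \<open>\<open>indep_increments\<close> expects a monotone sequence indexed by all naturals. A
  finite set of times is sorted and continued constantly past its maximum; \<open>\<kappa>\<close>
  locates each time in the sequence.\<close>

lemma finite_real_grid:
  fixes S :: "real set"
  assumes fin: "finite S" and ne: "S \<noteq> {}"
  obtains n u \<kappa> where "mono (u :: nat \<Rightarrow> real)" "u 0 = Min S" "0 < (n::nat)"
    "\<And>j. j \<in> S \<Longrightarrow> \<kappa> j < n \<and> u (\<kappa> j) = j"
    "\<And>i j. i \<in> S \<Longrightarrow> j \<in> S \<Longrightarrow> i \<le> j \<Longrightarrow> \<kappa> i \<le> \<kappa> j"
proof -
  define l where "l = sorted_list_of_set S"
  have l: "set l = S" "sorted_wrt (<) l" "l \<noteq> []" using fin ne by (auto simp: l_def)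
  have sorted: "sorted l" by (simp add: l_def)
  define u where "u i = l ! min i (length l - 1)" for i
  have len: "0 < length l" using l by simp
  have "\<exists>\<kappa>. \<forall>j\<in>S. \<kappa> j < length l \<and> l ! \<kappa> j = j"
    using l(1) by (intro bchoice) (auto simp: in_set_conv_nth)
  then obtain \<kappa> where \<kappa>: "\<And>j. j \<in> S \<Longrightarrow> \<kappa> j < length l \<and> l ! \<kappa> j = j" by blast
  show ?thesis
  proof (rule that[of u "length l" \<kappa>])
    show "mono u" unfolding u_def
      by (intro monoI sorted_nth_mono[OF sorted]) (auto, use len in linarith)
    show "u 0 = Min S"
      using l sorted by (cases l) (auto simp: u_def intro!: Min_eqI[symmetric])
    show "\<kappa> j < length l \<and> u (\<kappa> j) = j" if "j \<in> S" for j
      using \<kappa>[OF that] by (auto simp: u_def min_def)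
    show "\<kappa> i \<le> \<kappa> j" if "i \<in> S" "j \<in> S" "i \<le> j" for i j
    proof (rule ccontr)
      assume "\<not> \<kappa> i \<le> \<kappa> j"
      then have "l ! \<kappa> j < l ! \<kappa> i" using \<kappa>[OF that(1)] sorted_wrt_nth_less[OF l(2), of "\<kappa> j" "\<kappa> i"] by simp
      then show False using \<kappa>[OF that(1)] \<kappa>[OF that(2)] that(3) by simp
    qed
  qed (rule len)
qed

section \<open>Densities and laws of the increments\<close>

locale stable_process = rotsym_stable_process \<alpha> c P X
  for \<alpha> c :: real and P :: "'a::euclidean_space \<Rightarrow> 'w measure" and X :: "real \<Rightarrow> 'w \<Rightarrow> 'a" +
  assumes \<alpha>_pos: "0 < \<alpha>" and c_pos: "0 < c"
begin

sublocale P: prob_space "P x" for x by (rule prob)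

lemmas X_meas[measurable] = measurable_X

lemma space_P: "space (P x) = space (P y)"
  by (rule sets_eq_imp_space_eq[OF sets_eq])

definition char_fun :: "real \<Rightarrow> 'a \<Rightarrow> real" where
  "char_fun t \<xi> = exp (- c * t * norm \<xi> powr \<alpha>)"

definition stable_density :: "real \<Rightarrow> 'a \<Rightarrow> real" where
  "stable_density t = inv_fourier (char_fun t)"

lemma integrable_char_fun: "0 < t \<Longrightarrow> integrable lborel (char_fun t)"
  using integrable_exp_norm_powr[of \<alpha> "c * t"] \<alpha>_pos c_pos by (simp add: char_fun_def[abs_def])

lemma real_char_measure_increment:
  assumes t: "0 < t"
  shows "real_char_measure (distr (P x) borel (\<lambda>\<omega>. X t \<omega> - X 0 \<omega>)) (char_fun t)"
proof -
  have [measurable]: "X t \<in> borel_measurable (P x)" "X 0 \<in> borel_measurable (P x)" using t by simp_all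
  interpret Q: prob_space "distr (P x) borel (\<lambda>\<omega>. X t \<omega> - X 0 \<omega>)"
    by (rule P.prob_space_distr) measurable
  show ?thesis
  proof
    fix \<xi>
    have "(\<integral>y. exp (\<i> * complex_of_real (\<xi> \<bullet> y)) \<partial>distr (P x) borel (\<lambda>\<omega>. X t \<omega> - X 0 \<omega>))
        = (\<integral>\<omega>. exp (\<i> * complex_of_real (\<xi> \<bullet> (X t \<omega> - X 0 \<omega>))) \<partial>P x)"
      by (rule integral_distr) measurable
    also have "\<dots> = (\<integral>\<omega>. exp (\<i> * complex_of_real (\<xi> \<bullet> (X t \<omega> - x))) \<partial>P x)"
    proof (rule integral_cong_AE)
      show "AE \<omega> in P x. exp (\<i> * complex_of_real (\<xi> \<bullet> (X t \<omega> - X 0 \<omega>)))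
          = exp (\<i> * complex_of_real (\<xi> \<bullet> (X t \<omega> - x)))"
        using start[of x] by eventually_elim simp
    qed (use t in measurable)
    finally show "(\<integral>y. exp (\<i> * complex_of_real (\<xi> \<bullet> y)) \<partial>distr (P x) borel (\<lambda>\<omega>. X t \<omega> - X 0 \<omega>))
        = complex_of_real (char_fun t \<xi>)"
      using characteristic_function[where t=t and \<xi>=\<xi> and x=x] t by (simp add: char_fun_def)
  qed (simp_all add: integrable_char_fun t)
qed

lemma distr_increment_density:
  "0 < t \<Longrightarrow> distr (P x) borel (\<lambda>\<omega>. X t \<omega> - X 0 \<omega>) = density lborel (\<lambda>z. ennreal (stable_density t z))"
  using real_char_measure.density_inv_fourier[OF real_char_measure_increment]
  by (simp add: stable_density_def)

lemma stable_density_nonneg: "0 < t \<Longrightarrow> 0 \<le> stable_density t z"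
  unfolding stable_density_def
  by (rule real_char_measure.inv_fourier_nonneg[OF real_char_measure_increment])

lemma continuous_on_stable_density: "0 < t \<Longrightarrow> continuous_on UNIV (stable_density t)"
  unfolding stable_density_def by (rule continuous_on_inv_fourier[OF integrable_char_fun])

lemma measurable_stable_density: "0 < t \<Longrightarrow> stable_density t \<in> borel_measurable borel"
  by (rule borel_measurable_continuous_onI[OF continuous_on_stable_density])

definition incr_law :: "real \<Rightarrow> 'a measure" where
  "incr_law t = distr (P 0) borel (\<lambda>\<omega>. X t \<omega> - X 0 \<omega>)"

text \<open>\<open>stationary_increments\<close> compares increments under one and the same
  \<open>P x\<close>. That the law is also the same for different starting points is read off from
  the common density, that is, from the characteristic function.\<close>

lemma distr_increment:
  assumes "0 \<le> s" "s \<le> t"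
  shows "distr (P x) borel (\<lambda>\<omega>. X t \<omega> - X s \<omega>) = incr_law (t - s)"
proof (cases "s = t")
  case True
  then show ?thesis by (simp add: incr_law_def)
next
  case False
  then have "0 < t - s" using assms by simp
  then show ?thesis
    using stationary_increments[OF assms, of x] distr_increment_density[of "t - s" x]
      distr_increment_density[of "t - s" 0] by (simp add: incr_law_def)
qed

lemma prob_space_incr_law: "0 \<le> t \<Longrightarrow> prob_space (incr_law t)"
  unfolding incr_law_def by (intro P.prob_space_distr) simp

lemma distr_increments:
  assumes u: "mono u" "0 \<le> u 0" and n: "0 < n"
  shows "distr (P x) (PiM {..<n} (\<lambda>_. borel)) (\<lambda>\<omega>. \<lambda>i\<in>{..<n}. X (u (Suc i)) \<omega> - X (u i) \<omega>)
    = PiM {..<n} (\<lambda>i. incr_law (u (Suc i) - u i))"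
proof -
  have u0: "0 \<le> u i" for i using u by (meson monoD order_trans zero_le)
  have "distr (P x) (PiM {..<n} (\<lambda>_. borel)) (\<lambda>\<omega>. \<lambda>i\<in>{..<n}. X (u (Suc i)) \<omega> - X (u i) \<omega>)
    = PiM {..<n} (\<lambda>i. distr (P x) borel (\<lambda>\<omega>. X (u (Suc i)) \<omega> - X (u i) \<omega>))"
    by (subst P.indep_vars_iff_distr_eq_PiM'[symmetric])
      (use n u0 in \<open>auto intro!: indep_increments u borel_measurable_diff measurable_X\<close>)
  also have "\<dots> = PiM {..<n} (\<lambda>i. incr_law (u (Suc i) - u i))"
    by (intro PiM_cong refl distr_increment) (use u0 u(1) in \<open>auto simp: monoD\<close>)
  finally show ?thesis .
qed

section \<open>Shifted paths, their common law and the Markov property\<close>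

abbreviation paths :: "(real \<Rightarrow> 'a) measure" where
  "paths \<equiv> PiM {0..} (\<lambda>_. borel)"

definition shift :: "real \<Rightarrow> 'w \<Rightarrow> real \<Rightarrow> 'a" where
  "shift s \<omega> = (\<lambda>t\<in>{0..}. X (s + t) \<omega> - X s \<omega>)"

definition past :: "real \<Rightarrow> 'w \<Rightarrow> real \<Rightarrow> 'a" where
  "past s \<omega> = (\<lambda>t\<in>{0..s}. X t \<omega>)"

definition path_law :: "(real \<Rightarrow> 'a) measure" where
  "path_law = distr (P 0) paths (shift 0)"

lemma measurable_shift[measurable]: "0 \<le> s \<Longrightarrow> shift s \<in> measurable (P x) paths"
  unfolding shift_def[abs_def] by (rule measurable_restrict) (auto intro!: borel_measurable_diff measurable_X)

lemma measurable_past[measurable]: "past s \<in> measurable (P x) (PiM {0..s} (\<lambda>_. borel))"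
  unfolding past_def[abs_def] by (rule measurable_restrict) (auto intro!: measurable_X)

text \<open>Stated with \<open>obtains\<close> so that \<open>n\<close>, \<open>E\<close> and
  \<open>u\<close> depend on the cylinder only: one right-hand side for all \<open>x\<close> and
  \<open>s\<close> is what makes the law of \<open>shift s\<close> independent of both.\<close>

lemma emeasure_shift_cylinder:
  assumes J: "finite J" "J \<subseteq> {0..}" and A: "\<And>j. j \<in> J \<Longrightarrow> A j \<in> sets borel"
  obtains n E u where "\<And>x s. 0 \<le> s \<Longrightarrow>
    emeasure (distr (P x) paths (shift s)) (prod_emb {0..} (\<lambda>_. borel) J (Pi\<^sub>E J A))
      = emeasure (PiM {..<n} (\<lambda>i. incr_law (u (Suc i) - u i))) E"
proof -
  obtain n u \<kappa> where u: "mono (u :: nat \<Rightarrow> real)" "u 0 = Min (insert 0 J)" "0 < (n::nat)"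
    and \<kappa>: "\<And>j. j \<in> insert 0 J \<Longrightarrow> \<kappa> j < n \<and> u (\<kappa> j) = j"
    by (rule finite_real_grid[of "insert 0 J"]) (use J in auto)
  have u0: "u 0 = 0" using J by (subst u(2)) (auto intro!: Min_eqI)
  define E where "E = {z \<in> space (PiM {..<n} (\<lambda>_. borel :: 'a measure)). \<forall>j\<in>J. (\<Sum>i<\<kappa> j. z i) \<in> A j}"
  have E[measurable]: "E \<in> sets (PiM {..<n} (\<lambda>_. borel :: 'a measure))"
    unfolding E_def
  proof (rule sets.sets_Collect_finite_All[OF _ J(1)])
    fix j assume j: "j \<in> J"
    have [measurable]: "A j \<in> sets borel" by (rule A[OF j])
    have "(\<lambda>z. \<Sum>i<\<kappa> j. z i) \<in> borel_measurable (PiM {..<n} (\<lambda>_. borel :: 'a measure))"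
      by (rule borel_measurable_sum) (use \<kappa>[of j] j in \<open>auto intro!: measurable_component_singleton\<close>)
    then show "{z \<in> space (PiM {..<n} (\<lambda>_. borel :: 'a measure)). (\<Sum>i<\<kappa> j. z i) \<in> A j} \<in> sets (PiM {..<n} (\<lambda>_. borel))"
      by measurable
  qed
  have "emeasure (distr (P x) paths (shift s)) (prod_emb {0..} (\<lambda>_. borel) J (Pi\<^sub>E J A))
      = emeasure (PiM {..<n} (\<lambda>i. incr_law (u (Suc i) - u i))) E" if s: "0 \<le> s" for x s
  proof -
    define v where "v i = s + u i" for i
    have v: "mono v" "0 \<le> v 0" using u s by (auto simp: v_def u0 mono_def)
    have v0: "0 \<le> v i" for i using v by (meson monoD order_trans zero_le)
    let ?\<Delta> = "\<lambda>\<omega>. \<lambda>i\<in>{..<n}. X (v (Suc i)) \<omega> - X (v i) \<omega>"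
    have \<Delta>[measurable]: "?\<Delta> \<in> measurable (P x) (PiM {..<n} (\<lambda>_. borel))"
      by (rule measurable_restrict) (auto intro!: borel_measurable_diff measurable_X v0)
    have eq: "shift s \<omega> j = (\<Sum>i<\<kappa> j. ?\<Delta> \<omega> i)" if j: "j \<in> J" for \<omega> j
    proof -
      have "(\<Sum>i<\<kappa> j. ?\<Delta> \<omega> i) = (\<Sum>i<\<kappa> j. X (v (Suc i)) \<omega> - X (v i) \<omega>)"
        using \<kappa>[of j] j by (intro sum.cong) auto
      also have "\<dots> = X (v (\<kappa> j)) \<omega> - X (v 0) \<omega>" by (rule sum_lessThan_telescope)
      finally show ?thesis using \<kappa>[of j] j J by (auto simp: shift_def v_def u0)
    qed
    have P: "prod_emb {0..} (\<lambda>_. borel) J (Pi\<^sub>E J A) \<in> sets paths"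
      by (intro sets_PiM_I J ballI A)
    have "emeasure (distr (P x) paths (shift s)) (prod_emb {0..} (\<lambda>_. borel) J (Pi\<^sub>E J A))
        = emeasure (P x) (shift s -` prod_emb {0..} (\<lambda>_. borel) J (Pi\<^sub>E J A) \<inter> space (P x))"
      by (rule emeasure_distr[OF _ P]) (simp add: s)
    also have "shift s -` prod_emb {0..} (\<lambda>_. borel) J (Pi\<^sub>E J A) \<inter> space (P x) = ?\<Delta> -` E \<inter> space (P x)"
      by (auto simp: prod_emb_def E_def space_PiM eq Pi_iff shift_def[abs_def, symmetric] PiE_iff)
        (auto simp: shift_def extensional_def)
    also have "emeasure (P x) \<dots> = emeasure (distr (P x) (PiM {..<n} (\<lambda>_. borel)) ?\<Delta>) E"
      by (rule emeasure_distr[symmetric, OF \<Delta> E])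
    also have "\<dots> = emeasure (PiM {..<n} (\<lambda>i. incr_law (v (Suc i) - v i))) E"
      using distr_increments[OF v u(3)] by simp
    finally show ?thesis by (simp add: v_def)
  qed
  then show ?thesis by (rule that)
qed

lemma distr_shift:
  assumes s: "0 \<le> s"
  shows "distr (P x) paths (shift s) = path_law"
  unfolding path_law_def
proof (rule measure_eqI_PiM_infinite)
  fix A :: "real \<Rightarrow> 'a set" and J :: "real set"
  assume J: "finite J" "J \<subseteq> {0..}" and A: "\<And>j. j \<in> J \<Longrightarrow> A j \<in> sets borel"
  show "emeasure (distr (P x) paths (shift s)) (prod_emb {0..} (\<lambda>_. borel) J (Pi\<^sub>E J A))
      = emeasure (distr (P 0) paths (shift 0)) (prod_emb {0..} (\<lambda>_. borel) J (Pi\<^sub>E J A))"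
    by (rule emeasure_shift_cylinder[OF J A]) (use s in auto)
next
  show "finite_measure (distr (P x) paths (shift s))"
    using s by (intro prob_space.finite_measure P.prob_space_distr) simp
qed auto

text \<open>A common grid contains 0, \<open>s\<close>, the past times and the shifted future times.
  Cutting it at the index of \<open>s\<close> assigns the two events to disjoint blocks of
  increments. The past event becomes a function of its block because \<open>X 0\<close> equals
  \<open>x\<close> almost surely.\<close>

lemma indep_cylinders:
  assumes s: "0 \<le> s" and J: "finite J" "J \<subseteq> {0..s}" and A: "\<And>j. j \<in> J \<Longrightarrow> A j \<in> sets borel"
    and K: "finite K" "K \<subseteq> {0..}" and B: "\<And>j. j \<in> K \<Longrightarrow> B j \<in> sets borel"
  shows "P.prob x ({\<omega>\<in>space (P x). \<forall>j\<in>J. X j \<omega> \<in> A j} \<inter> {\<omega>\<in>space (P x). \<forall>j\<in>K. shift s \<omega> j \<in> B j})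
    = P.prob x {\<omega>\<in>space (P x). \<forall>j\<in>J. X j \<omega> \<in> A j} * P.prob x {\<omega>\<in>space (P x). \<forall>j\<in>K. shift s \<omega> j \<in> B j}"
proof -
  let ?S = "{0, s} \<union> J \<union> (+) s ` K"
  obtain n u \<kappa> where u: "mono (u :: nat \<Rightarrow> real)" "u 0 = Min ?S" "0 < (n::nat)"
    and \<kappa>: "\<And>j. j \<in> ?S \<Longrightarrow> \<kappa> j < n \<and> u (\<kappa> j) = j"
    and \<kappa>_mono: "\<And>i j. i \<in> ?S \<Longrightarrow> j \<in> ?S \<Longrightarrow> i \<le> j \<Longrightarrow> \<kappa> i \<le> \<kappa> j"
    by (rule finite_real_grid[of ?S]) (use J K in auto)
  have "Min ?S = 0" by (rule Min_eqI) (use J K s in auto)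
  then have u0: "u 0 = 0" by (simp only: u(2))
  have unn: "0 \<le> u i" for i using u u0 by (metis monoD zero_le)
  define m where "m = \<kappa> s"
  have m: "m < n" "u m = s" using \<kappa>[of s] by (auto simp: m_def)
  let ?\<Delta> = "\<lambda>i \<omega>. X (u (Suc i)) \<omega> - X (u i) \<omega>"
  have "P.indep_vars x (\<lambda>_. borel) ?\<Delta> {..<n}"
    by (rule indep_increments) (auto simp: u0 u)
  then have ind: "P.indep_var x (PiM {..<m} (\<lambda>_. borel)) (\<lambda>\<omega>. \<lambda>i\<in>{..<m}. ?\<Delta> i \<omega>)
      (PiM {m..<n} (\<lambda>_. borel)) (\<lambda>\<omega>. \<lambda>i\<in>{m..<n}. ?\<Delta> i \<omega>)"
    by (rule P.indep_var_restrict) (use m in auto)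
  define E where "E = {z \<in> space (PiM {..<m} (\<lambda>_. borel :: 'a measure)). \<forall>j\<in>J. x + (\<Sum>i<\<kappa> j. z i) \<in> A j}"
  define F where "F = {z \<in> space (PiM {m..<n} (\<lambda>_. borel :: 'a measure)). \<forall>j\<in>K. (\<Sum>i=m..<\<kappa> (s + j). z i) \<in> B j}"
  have \<kappa>J: "\<kappa> j \<le> m" "u (\<kappa> j) = j" if "j \<in> J" for j
    using that \<kappa>[of j] \<kappa>_mono[of j s] J by (auto simp: m_def)
  have \<kappa>K: "m \<le> \<kappa> (s + j)" "\<kappa> (s + j) < n" "u (\<kappa> (s + j)) = s + j" if "j \<in> K" for j
    using that \<kappa>[of "s + j"] \<kappa>_mono[of s "s + j"] K by (auto simp: m_def)
  have E: "E \<in> sets (PiM {..<m} (\<lambda>_. borel :: 'a measure))"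
    unfolding E_def
  proof (rule sets.sets_Collect_finite_All[OF _ J(1)])
    fix j assume j: "j \<in> J"
    have [measurable]: "A j \<in> sets borel" by (rule A[OF j])
    have "(\<lambda>z. x + (\<Sum>i<\<kappa> j. z i)) \<in> borel_measurable (PiM {..<m} (\<lambda>_. borel :: 'a measure))"
      by (intro borel_measurable_add borel_measurable_sum) (use \<kappa>J[OF j] in \<open>auto intro!: measurable_component_singleton\<close>)
    then show "{z \<in> space (PiM {..<m} (\<lambda>_. borel :: 'a measure)). x + (\<Sum>i<\<kappa> j. z i) \<in> A j} \<in> sets (PiM {..<m} (\<lambda>_. borel))"
      by measurable
  qed
  have F: "F \<in> sets (PiM {m..<n} (\<lambda>_. borel :: 'a measure))"
    unfolding F_def
  proof (rule sets.sets_Collect_finite_All[OF _ K(1)])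
    fix j assume j: "j \<in> K"
    have [measurable]: "B j \<in> sets borel" by (rule B[OF j])
    have "(\<lambda>z. \<Sum>i=m..<\<kappa> (s + j). z i) \<in> borel_measurable (PiM {m..<n} (\<lambda>_. borel :: 'a measure))"
      by (intro borel_measurable_sum) (use \<kappa>K[OF j] in \<open>auto intro!: measurable_component_singleton\<close>)
    then show "{z \<in> space (PiM {m..<n} (\<lambda>_. borel :: 'a measure)). (\<Sum>i=m..<\<kappa> (s + j). z i) \<in> B j} \<in> sets (PiM {m..<n} (\<lambda>_. borel))"
      by measurable
  qed
  let ?Z = "\<lambda>\<omega>. \<lambda>i\<in>{..<m}. ?\<Delta> i \<omega>" and ?W = "\<lambda>\<omega>. \<lambda>i\<in>{m..<n}. ?\<Delta> i \<omega>"
  have Zm[measurable]: "?Z \<in> measurable (P x) (PiM {..<m} (\<lambda>_. borel))"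
    by (rule measurable_restrict) (auto intro!: borel_measurable_diff measurable_X unn)
  have Wm[measurable]: "?W \<in> measurable (P x) (PiM {m..<n} (\<lambda>_. borel))"
    by (rule measurable_restrict) (auto intro!: borel_measurable_diff measurable_X unn)
  have Z: "X j \<omega> = X 0 \<omega> + (\<Sum>i<\<kappa> j. ?Z \<omega> i)" if j: "j \<in> J" for j \<omega>
  proof -
    have "(\<Sum>i<\<kappa> j. ?Z \<omega> i) = (\<Sum>i<\<kappa> j. ?\<Delta> i \<omega>)"
      using \<kappa>J[OF j] by (intro sum.cong) auto
    also have "\<dots> = X j \<omega> - X 0 \<omega>" using \<kappa>J[OF j] sum_lessThan_telescope[of "\<lambda>i. X (u i) \<omega>" "\<kappa> j"] by (simp add: u0)
    finally show ?thesis by simp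
  qed
  have W: "shift s \<omega> j = (\<Sum>i=m..<\<kappa> (s + j). ?W \<omega> i)" if j: "j \<in> K" for j \<omega>
  proof -
    have "(\<Sum>i=m..<\<kappa> (s + j). ?W \<omega> i) = (\<Sum>i=m..<\<kappa> (s + j). ?\<Delta> i \<omega>)"
      using \<kappa>K[OF j] by (intro sum.cong) auto
    also have "\<dots> = X (s + j) \<omega> - X s \<omega>"
      using sum_Suc_diff'[of m "\<kappa> (s + j)" "\<lambda>i. X (u i) \<omega>"] \<kappa>K[OF j] m by simp
    finally show ?thesis using j K by (auto simp: shift_def)
  qed
  have W_eq: "{\<omega>\<in>space (P x). \<forall>j\<in>K. shift s \<omega> j \<in> B j} = ?W -` F \<inter> space (P x)"
    using W by (auto simp: F_def space_PiM)
  have Jm: "{\<omega>\<in>space (P x). \<forall>j\<in>J. X j \<omega> \<in> A j} \<in> P.events x"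
  proof (rule sets.sets_Collect_finite_All[OF _ J(1)])
    fix j assume j: "j \<in> J"
    then have [measurable]: "A j \<in> sets borel" "X j \<in> borel_measurable (P x)" using A J by auto
    show "{\<omega> \<in> space (P x). X j \<omega> \<in> A j} \<in> P.events x" by measurable
  qed
  have Z_eq: "AE \<omega> in P x. \<omega> \<in> {\<omega>\<in>space (P x). \<forall>j\<in>J. X j \<omega> \<in> A j} \<longleftrightarrow> \<omega> \<in> ?Z -` E \<inter> space (P x)"
    using start[of x] AE_space by eventually_elim (auto simp: E_def space_PiM Z)
  have "P.prob x ({\<omega>\<in>space (P x). \<forall>j\<in>J. X j \<omega> \<in> A j} \<inter> {\<omega>\<in>space (P x). \<forall>j\<in>K. shift s \<omega> j \<in> B j})
    = P.prob x ((?Z -` E \<inter> space (P x)) \<inter> (?W -` F \<inter> space (P x)))"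
    unfolding W_eq using Z_eq Jm E F by (intro P.finite_measure_eq_AE) (auto intro!: sets.Int measurable_sets[OF Zm] measurable_sets[OF Wm])
  also have "(?Z -` E \<inter> space (P x)) \<inter> (?W -` F \<inter> space (P x)) = (\<lambda>\<omega>. (?Z \<omega>, ?W \<omega>)) -` (E \<times> F) \<inter> space (P x)"
    by auto
  also have "P.prob x \<dots> = P.prob x (?Z -` E \<inter> space (P x)) * P.prob x (?W -` F \<inter> space (P x))"
    by (rule P.indep_varD[OF ind E F])
  also have "P.prob x (?Z -` E \<inter> space (P x)) = P.prob x {\<omega>\<in>space (P x). \<forall>j\<in>J. X j \<omega> \<in> A j}"
    using Z_eq Jm E by (intro P.finite_measure_eq_AE) (auto intro!: measurable_sets[OF Zm])
  finally show ?thesis by (simp only: W_eq)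
qed

text \<open>Cylinders form an intersection-stable generator on both sides, so independence passes
  from them to the generated sigma-algebras.\<close>

lemma indep_past_shift:
  assumes s: "0 \<le> s"
  shows "P.indep_var x (PiM {0..s} (\<lambda>_. borel)) (past s) paths (shift s)"
proof -
  let ?M = "PiM {0..s} (\<lambda>_. borel) :: (real \<Rightarrow> 'a) measure"
  let ?\<A> = "{past s -` A \<inter> space (P x) | A. A \<in> prod_algebra {0..s} (\<lambda>_. borel)}"
  let ?\<B> = "{shift s -` A \<inter> space (P x) | A. A \<in> prod_algebra {0..} (\<lambda>_. borel)}"
  have \<A>: "sigma_sets (space (P x)) {past s -` A \<inter> space (P x) | A. A \<in> sets ?M} = sigma_sets (space (P x)) ?\<A>"
  proof -
    have "{past s -` A \<inter> space (P x) | A. A \<in> sets ?M} = sigma_sets (space (P x)) ?\<A>"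
      unfolding sets_PiM
      by (rule sigma_sets_vimage_commute) (auto simp: past_def)
    then show ?thesis by (simp only:) (rule sigma_sets_sigma_sets_eq, auto)
  qed
  have \<B>: "sigma_sets (space (P x)) {shift s -` A \<inter> space (P x) | A. A \<in> sets paths} = sigma_sets (space (P x)) ?\<B>"
  proof -
    have "{shift s -` A \<inter> space (P x) | A. A \<in> sets paths} = sigma_sets (space (P x)) ?\<B>"
      unfolding sets_PiM
      by (rule sigma_sets_vimage_commute) (auto simp: shift_def)
    then show ?thesis by (simp only:) (rule sigma_sets_sigma_sets_eq, auto)
  qed
  have int_stable: "Int_stable {f -` A \<inter> space (P x) | A. A \<in> prod_algebra I (\<lambda>_. borel)}"
    for f :: "'w \<Rightarrow> real \<Rightarrow> 'a" and I
    unfolding Int_stable_def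
  proof safe
    fix A B :: "(real \<Rightarrow> 'a) set" assume AB: "A \<in> prod_algebra I (\<lambda>_. borel)" "B \<in> prod_algebra I (\<lambda>_. borel)"
    have "A \<inter> B \<in> prod_algebra I (\<lambda>_. borel)"
      by (rule Int_stableD[OF Int_stable_prod_algebra AB])
    then show "\<exists>C. (f -` A \<inter> space (P x)) \<inter> (f -` B \<inter> space (P x)) = f -` C \<inter> space (P x)
        \<and> C \<in> prod_algebra I (\<lambda>_. borel)"
      by (intro exI[of _ "A \<inter> B"]) auto
  qed
  have past_cyl: "past s -` prod_emb {0..s} (\<lambda>_. borel) J (Pi\<^sub>E J E) \<inter> space (P x)
      = {\<omega>\<in>space (P x). \<forall>j\<in>J. X j \<omega> \<in> E j}" if "J \<subseteq> {0..s}" for J E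
    using that by (auto simp: prod_emb_def past_def PiE_iff subset_iff)
  have shift_cyl: "shift s -` prod_emb {0..} (\<lambda>_. borel) J (Pi\<^sub>E J E) \<inter> space (P x)
      = {\<omega>\<in>space (P x). \<forall>j\<in>J. shift s \<omega> j \<in> E j}" if "J \<subseteq> {0..}" for J E
    using that by (auto simp: prod_emb_def PiE_iff subset_iff shift_def)
  have indep: "P.indep_set x ?\<A> ?\<B>"
    unfolding P.indep_sets2_eq
  proof (intro conjI ballI)
    show "?\<A> \<subseteq> P.events x"
      by (auto intro!: measurable_sets[OF measurable_past] simp: sets_PiM)
    show "?\<B> \<subseteq> P.events x"
      using s by (auto intro!: measurable_sets[OF measurable_shift] simp: sets_PiM)
    fix a b assume "a \<in> ?\<A>" "b \<in> ?\<B>"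
    then obtain A B where a: "a = past s -` A \<inter> space (P x)" "A \<in> prod_algebra {0..s} (\<lambda>_. borel)"
      and b: "b = shift s -` B \<inter> space (P x)" "B \<in> prod_algebra {0..} (\<lambda>_. borel)" by blast
    from a(2) obtain J E where A: "A = prod_emb {0..s} (\<lambda>_. borel) J (Pi\<^sub>E J E)" "finite J" "J \<subseteq> {0..s}"
      "\<And>i. i \<in> J \<Longrightarrow> E i \<in> sets borel" by (elim prod_algebraE) blast
    from b(2) obtain K F where B: "B = prod_emb {0..} (\<lambda>_. borel) K (Pi\<^sub>E K F)" "finite K" "K \<subseteq> {0..}"
      "\<And>i. i \<in> K \<Longrightarrow> F i \<in> sets borel" by (elim prod_algebraE) blast
    show "P.prob x (a \<inter> b) = P.prob x a * P.prob x b"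
      unfolding a(1) b(1) A(1) B(1) past_cyl[OF A(3)] shift_cyl[OF B(3)]
      by (rule indep_cylinders[OF s A(2,3,4) B(2,3,4)])
  qed
  show ?thesis
    unfolding P.indep_var_eq \<A> \<B>
    by (intro conjI measurable_past measurable_shift s P.indep_set_sigma_sets[OF indep] int_stable)
qed

lemma distr_past_shift:
  "0 \<le> s \<Longrightarrow> distr (P x) (PiM {0..s} (\<lambda>_. borel) \<Otimes>\<^sub>M paths) (\<lambda>\<omega>. (past s \<omega>, shift s \<omega>))
    = distr (P x) (PiM {0..s} (\<lambda>_. borel)) (past s) \<Otimes>\<^sub>M path_law"
  using indep_past_shift[of s x] unfolding P.indep_var_distribution_eq by (simp add: distr_shift)

sublocale L: prob_space path_law
  unfolding path_law_def by (rule P.prob_space_distr) simp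

lemma sets_path_law[measurable_cong]: "sets path_law = sets paths"
  by (simp add: path_law_def)

lemma space_path_law: "space path_law = space paths"
  by (rule sets_eq_imp_space_eq[OF sets_path_law])

text \<open>The Markov property in Fubini form: the joint law of past and shifted path is a product
  measure with second factor \<open>path_law\<close>.\<close>

lemma nn_integral_markov:
  assumes s: "0 \<le> s" and [measurable]: "F \<in> borel_measurable (PiM {0..s} (\<lambda>_. borel) \<Otimes>\<^sub>M paths)"
  shows "(\<integral>\<^sup>+\<omega>. F (past s \<omega>, shift s \<omega>) \<partial>P x) = (\<integral>\<^sup>+\<omega>. \<integral>\<^sup>+w. F (past s \<omega>, w) \<partial>path_law \<partial>P x)"
proof -
  note measurable_shift[OF s, measurable]
  have "(\<integral>\<^sup>+\<omega>. F (past s \<omega>, shift s \<omega>) \<partial>P x)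
      = (\<integral>\<^sup>+z. F z \<partial>distr (P x) (PiM {0..s} (\<lambda>_. borel) \<Otimes>\<^sub>M paths) (\<lambda>\<omega>. (past s \<omega>, shift s \<omega>)))"
    by (rule nn_integral_distr[symmetric]) measurable
  also have "\<dots> = (\<integral>\<^sup>+z. \<integral>\<^sup>+w. F (z, w) \<partial>path_law \<partial>distr (P x) (PiM {0..s} (\<lambda>_. borel)) (past s))"
    unfolding distr_past_shift[OF s] by (rule L.nn_integral_fst[symmetric]) measurable
  also have "\<dots> = (\<integral>\<^sup>+\<omega>. \<integral>\<^sup>+w. F (past s \<omega>, w) \<partial>path_law \<partial>P x)"
    by (rule nn_integral_distr) measurable
  finally show ?thesis .
qed

lemma integral_markov:
  fixes F :: "(real \<Rightarrow> 'a) \<times> (real \<Rightarrow> 'a) \<Rightarrow> real"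
  assumes s: "0 \<le> s" and [measurable]: "F \<in> borel_measurable (PiM {0..s} (\<lambda>_. borel) \<Otimes>\<^sub>M paths)"
    and int: "integrable (P x) (\<lambda>\<omega>. F (past s \<omega>, shift s \<omega>))"
  shows "(\<integral>\<omega>. F (past s \<omega>, shift s \<omega>) \<partial>P x) = (\<integral>\<omega>. \<integral>w. F (past s \<omega>, w) \<partial>path_law \<partial>P x)"
proof -
  note measurable_shift[OF s, measurable]
  interpret Z: prob_space "distr (P x) (PiM {0..s} (\<lambda>_. borel)) (past s)"
    by (rule P.prob_space_distr) measurable
  interpret pair_sigma_finite "distr (P x) (PiM {0..s} (\<lambda>_. borel)) (past s)" path_law ..
  have int': "integrable (distr (P x) (PiM {0..s} (\<lambda>_. borel)) (past s) \<Otimes>\<^sub>M path_law) F"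
    unfolding distr_past_shift[OF s, symmetric] using int by (subst integrable_distr_eq) measurable
  have "(\<integral>\<omega>. F (past s \<omega>, shift s \<omega>) \<partial>P x)
      = (\<integral>z. F z \<partial>distr (P x) (PiM {0..s} (\<lambda>_. borel) \<Otimes>\<^sub>M paths) (\<lambda>\<omega>. (past s \<omega>, shift s \<omega>)))"
    by (rule integral_distr[symmetric]) measurable
  also have "\<dots> = (\<integral>z. \<integral>w. F (z, w) \<partial>path_law \<partial>distr (P x) (PiM {0..s} (\<lambda>_. borel)) (past s))"
    unfolding distr_past_shift[OF s] by (rule integral_fst'[symmetric, OF int'])
  also have "\<dots> = (\<integral>\<omega>. \<integral>w. F (past s \<omega>, w) \<partial>path_law \<partial>P x)"
    by (rule integral_distr) measurable
  finally show ?thesis .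
qed

end

section \<open>Approaching the boundary\<close>

text \<open>An affine image of the rationals of the unit interval contains both endpoints even when
  they are irrational, and translating the interval translates the grid.\<close>

definition rgrid :: "real \<Rightarrow> real \<Rightarrow> real set" where
  "rgrid a b = (\<lambda>q. a + (b - a) * q) ` (\<rat> \<inter> {0..1})"

lemma countable_rgrid: "countable (rgrid a b)"
  unfolding rgrid_def by (intro countable_image countable_Int1 countable_rat)

lemma rgrid_subset:
  assumes "a \<le> b"
  shows "rgrid a b \<subseteq> {a..b}"
proof -
  have "(b - a) * q \<le> b - a" if "q \<le> 1" for q
    using mult_left_mono[OF that, of "b - a"] assms by simp
  then show ?thesis using assms by (force simp: rgrid_def)
qed

lemma rgrid_endpoints: "a \<in> rgrid a b" "b \<in> rgrid a b"
  by (auto simp: rgrid_def image_iff intro: bexI[of _ 0] bexI[of _ 1])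

lemma rgrid_shift: "rgrid s (s + t) = (+) s ` rgrid 0 t"
  by (auto simp: rgrid_def image_iff)

lemma rgrid_dense:
  assumes "a \<le> u" "u < b" "u < v"
  obtains r where "r \<in> rgrid a b" "u < r" "r < v"
proof -
  have ab: "a < b" using assms by simp
  obtain q where q: "q \<in> \<rat>" "(u - a) / (b - a) < q" "q < (min v b - a) / (b - a)"
    using Rats_dense_in_real[of "(u - a) / (b - a)" "(min v b - a) / (b - a)"] assms ab
    by (auto simp: divide_strict_right_mono)
  have "0 \<le> (u - a) / (b - a)" "(min v b - a) / (b - a) \<le> 1" using assms ab by (auto simp: divide_simps)
  then have "0 \<le> q" "q \<le> 1" using q by auto
  then have "a + (b - a) * q \<in> rgrid a b" using q by (auto simp: rgrid_def)
  moreover have "u < a + (b - a) * q" "a + (b - a) * q < v"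
    using q ab by (auto simp: field_simps)
  ultimately show ?thesis by (rule that)
qed

text \<open>Closed sets that exhaust an open \<open>D\<close>. Expressing the distance to the
  complement through balls also covers \<open>D = UNIV\<close>.\<close>

definition deep :: "'a::metric_space set \<Rightarrow> nat \<Rightarrow> 'a set" where
  "deep D n = {x. ball x (1 / Suc n) \<subseteq> D}"

lemma deep_subset: "deep D n \<subseteq> D"
  by (auto simp: deep_def intro: subsetD[OF _ centre_in_ball[THEN iffD2]])

lemma deep_mono: "m \<le> n \<Longrightarrow> deep D m \<subseteq> deep D n"
  unfolding deep_def
  by (intro Collect_mono impI, erule order_trans[rotated]) (simp add: frac_le subset_ball)

lemma closed_deep: "closed (deep D n)"
proof -
  have "- deep D n = (\<Union>y\<in>- D. ball y (1 / Suc n))"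
    by (auto simp: deep_def dist_commute)
  then show ?thesis by (metis open_UN open_ball closed_def)
qed

lemma mem_deep_near:
  assumes "ball y r \<subseteq> D" "dist x y < r / 2" "1 / Suc n \<le> r / 2"
  shows "x \<in> deep D n"
proof -
  have "ball x (1 / Suc n) \<subseteq> ball y r"
  proof
    fix z assume "z \<in> ball x (1 / Suc n)"
    then show "z \<in> ball y r" using assms(2,3) dist_triangle[of y z x] by (simp add: dist_commute)
  qed
  then show ?thesis using assms(1) by (auto simp: deep_def)
qed

lemma cadlag_rightD:
  fixes w :: "real \<Rightarrow> 'a::metric_space"
  assumes "cadlag w" "0 \<le> t" "0 < e"
  obtains d where "0 < d" "\<And>u. t \<le> u \<Longrightarrow> u < t + d \<Longrightarrow> dist (w u) (w t) < e"
proof -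
  have "\<forall>\<^sub>F u in at_right t. dist (w u) (w t) < e"
    using assms by (auto simp: cadlag_def tendsto_iff)
  then obtain b where b: "t < b" "\<And>u. t < u \<Longrightarrow> u < b \<Longrightarrow> dist (w u) (w t) < e"
    by (auto simp: eventually_at_right_field)
  show ?thesis
    by (rule that[of "b - t"]) (use b assms(3) in \<open>auto simp: order_le_less\<close>)
qed

lemma cadlag_leftD:
  fixes w :: "real \<Rightarrow> 'a::metric_space"
  assumes "cadlag w" "0 < t"
  obtains l where "\<And>e. 0 < e \<Longrightarrow> \<exists>d>0. \<forall>u. t - d < u \<and> u < t \<longrightarrow> dist (w u) l < e"
proof -
  obtain l where l: "(w \<longlongrightarrow> l) (at_left t)" using assms by (auto simp: cadlag_def)
  show ?thesis
  proof (rule that[of l])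
    fix e :: real assume "0 < e"
    then have "\<forall>\<^sub>F u in at_left t. dist (w u) l < e" using l by (auto simp: tendsto_iff)
    then obtain b where b: "b < t" "\<And>u. b < u \<Longrightarrow> u < t \<Longrightarrow> dist (w u) l < e"
      by (auto simp: eventually_at_left_field)
    then show "\<exists>d>0. \<forall>u. t - d < u \<and> u < t \<longrightarrow> dist (w u) l < e"
      by (intro exI[of _ "t - b"]) auto
  qed
qed

text \<open>\<open>u\<close> is the first grid time outside \<open>deep D n\<close>. For finite
  \<open>G\<close> the event splits into disjoint pieces according to \<open>u\<close>, each the
  intersection of an event up to time \<open>u\<close> with one about the increments after
  \<open>u\<close>; rational delays \<open>v\<close> keep the latter measurable.\<close>

definition approach_jump :: "'a::real_normed_vector set \<Rightarrow> real set \<Rightarrow> real \<Rightarrow> nat \<Rightarrow> nat \<Rightarrow> (real \<Rightarrow> 'a) \<Rightarrow> bool" where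
  "approach_jump D G \<delta> m n w \<longleftrightarrow>
     (\<exists>u\<in>G. w u \<notin> deep D n \<and> (\<forall>u'\<in>G. u' < u \<longrightarrow> w u' \<in> deep D n) \<and>
       (\<exists>v\<in>\<rat> \<inter> {0<..<\<delta>}. 1 / Suc m < norm (w (u + v) - w u)))"

text \<open>A path that stays in \<open>D\<close> but comes arbitrarily close to the complement jumps at the first time
  \<open>\<tau>\<close> at which this happens, and \<open>\<tau>\<close> is announced by the entrance times into the complements of
  \<open>deep D n\<close>.\<close>

lemma approach_jump_of_cadlag:
  fixes w :: "real \<Rightarrow> 'a::real_normed_vector" and e :: "nat \<Rightarrow> real"
  assumes w: "cadlag w" and ab: "0 \<le> a" "a \<le> b" and D: "open D"
    and stay: "\<And>u. u \<in> {a..b} \<Longrightarrow> w u \<in> D"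
    and esc: "\<And>n. \<exists>u\<in>rgrid a b. w u \<notin> deep D n"
    and e: "range e = rgrid a b"
  shows "\<exists>m. \<forall>\<delta>>0. \<exists>n0. \<forall>n\<ge>n0. \<exists>k0. \<forall>k\<ge>k0. approach_jump D (e ` {..k}) \<delta> m n w"
proof -
  define U where "U n = {u\<in>rgrid a b. w u \<notin> deep D n}" for n
  define T where "T n = Inf (U n)" for n
  have U_ne: "U n \<noteq> {}" for n using esc by (auto simp: U_def)
  have U_sub: "U n \<subseteq> {a..b}" for n using rgrid_subset[OF ab(2)] by (auto simp: U_def)
  then have U_bdd: "bdd_below (U n)" for n by (rule bdd_below_mono[rotated]) simp
  have T_lower: "u \<in> U n \<Longrightarrow> T n \<le> u" for u n
    unfolding T_def by (rule cInf_lower[OF _ U_bdd])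
  have T_ge: "a \<le> T n" for n
    unfolding T_def by (rule cInf_greatest[OF U_ne]) (metis U_sub atLeastAtMost_iff subsetD)
  have T_le: "T n \<le> b" for n
    using U_ne[of n] U_sub[of n] T_lower[of _ n] by force
  have T_mono: "T m \<le> T n" if "m \<le> n" for m n
    unfolding T_def using deep_mono[OF that, of D]
    by (intro cInf_superset_mono U_ne U_bdd) (auto simp: U_def)
  have T_near: "\<exists>u\<in>U n. u < s" if "T n < s" for n s
    using that unfolding T_def by (rule cInf_lessD[OF U_ne])
  define \<tau> where "\<tau> = (SUP n. T n)"
  have bdd: "bdd_above (range T)" using T_le by (intro bdd_aboveI[of _ b]) auto
  have T_le_\<tau>: "T n \<le> \<tau>" for n unfolding \<tau>_def by (rule cSUP_upper[OF _ bdd]) simp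
  have \<tau>_near: "\<exists>n. s < T n" if "s < \<tau>" for s
    using that unfolding \<tau>_def by (subst (asm) less_cSUP_iff[OF _ bdd]) auto
  have \<tau>_ab: "a \<le> \<tau>" "\<tau> \<le> b"
    using T_ge[of 0] T_le_\<tau>[of 0] T_le by (auto simp: \<tau>_def intro!: cSUP_least)
  then have "w \<tau> \<in> D" using stay by simp
  then obtain r where r: "0 < r" "ball (w \<tau>) r \<subseteq> D" using D open_contains_ball by blast
  obtain N :: nat where N: "1 / Suc N \<le> r / 2"
    using nat_approx_posE[of "r / 2"] r by (metis half_gt_zero less_imp_le)
  have N': "1 / Suc n \<le> r / 2" if "N \<le> n" for n
    by (rule order_trans[OF _ N]) (use that in \<open>simp add: frac_le\<close>)
  have far: "r / 2 \<le> dist (w u) (w \<tau>)" if "u \<in> U n" "N \<le> n" for u n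
    using mem_deep_near[OF r(2), of "w u" n] N'[OF that(2)] that(1) by (auto simp: U_def not_less[symmetric])
  \<comment> \<open>If an announcing time equalled \<open>\<tau>\<close>, there would be grid times
    outside \<open>deep D (max n N)\<close> at or arbitrarily soon after \<open>\<tau>\<close>,
    where right continuity keeps the path near \<open>w \<tau>\<close> and thus deep in
    \<open>D\<close>.\<close>
  have T_less: "T n < \<tau>" for n
  proof (rule ccontr)
    assume "\<not> T n < \<tau>"
    then have eq: "T (max n N) = \<tau>" using T_le_\<tau>[of n] T_mono[of n "max n N"] T_le_\<tau>[of "max n N"] by simp
    obtain d where d: "0 < d" "\<And>u. \<tau> \<le> u \<Longrightarrow> u < \<tau> + d \<Longrightarrow> dist (w u) (w \<tau>) < r / 2"
      using cadlag_rightD[OF w, of \<tau> "r / 2"] \<tau>_ab ab r by auto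
    obtain u where u: "u \<in> U (max n N)" "u < \<tau> + d" using T_near[of "max n N" "\<tau> + d"] d(1) eq by auto
    then show False using far[OF u(1)] d(2)[of u] T_lower[OF u(1)] eq by auto
  qed
  have \<tau>_pos: "0 < \<tau>" using T_less[of 0] T_ge[of 0] ab by simp
  obtain l where l: "\<And>e. 0 < e \<Longrightarrow> \<exists>d>0. \<forall>u. \<tau> - d < u \<and> u < \<tau> \<longrightarrow> dist (w u) l < e"
    using cadlag_leftD[OF w \<tau>_pos] by metis
  \<comment> \<open>Arbitrarily close before \<open>\<tau>\<close> there are times whose values keep
    distance at least \<open>r / 2\<close> from \<open>w \<tau>\<close>.\<close>
  have l_ne: "l \<noteq> w \<tau>"
  proof
    assume "l = w \<tau>"
    then obtain d where d: "0 < d" "\<And>u. \<tau> - d < u \<Longrightarrow> u < \<tau> \<Longrightarrow> dist (w u) (w \<tau>) < r / 2"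
      using l[of "r / 2"] r by auto
    obtain n where n: "\<tau> - d < T n" using \<tau>_near[of "\<tau> - d"] d(1) by auto
    obtain u where u: "u \<in> U (max n N)" "u < \<tau>" using T_near[OF T_less] by blast
    have "\<tau> - d < u" using n T_mono[of n "max n N"] T_lower[OF u(1)] by simp
    then show False using far[OF u(1)] d(2)[of u] u(2) by auto
  qed
  \<comment> \<open>A quarter of the jump: \<open>w u\<close> is either more than
    \<open>2 * \<epsilon>\<close> away from the left limit or at least \<open>2 * \<epsilon>\<close>
    away from \<open>w \<tau>\<close>. Comparison with a time just before, respectively just after,
    \<open>\<tau>\<close> costs less than one \<open>\<epsilon>\<close> and leaves a displacement
    above \<open>\<epsilon>\<close>.\<close>
  define \<epsilon> where "\<epsilon> = dist l (w \<tau>) / 4"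
  have \<epsilon>: "0 < \<epsilon>" using l_ne by (simp add: \<epsilon>_def)
  obtain m :: nat where m: "1 / Suc m < \<epsilon>" using nat_approx_posE[OF \<epsilon>] by blast
  show ?thesis
  proof (rule exI[of _ m], intro allI impI)
    fix \<delta> :: real assume \<delta>: "0 < \<delta>"
    obtain d1 where d1: "0 < d1" "\<And>u. \<tau> - d1 < u \<Longrightarrow> u < \<tau> \<Longrightarrow> dist (w u) l < \<epsilon>"
      using l[OF \<epsilon>] by auto
    obtain d2 where d2: "0 < d2" "\<And>u. \<tau> \<le> u \<Longrightarrow> u < \<tau> + d2 \<Longrightarrow> dist (w u) (w \<tau>) < \<epsilon>"
      using cadlag_rightD[OF w _ \<epsilon>, of \<tau>] \<tau>_pos by auto
    obtain n0 where n0: "\<tau> - \<delta> / 2 < T n0" using \<tau>_near[of "\<tau> - \<delta> / 2"] \<delta> by auto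
    have "\<exists>k0. \<forall>k\<ge>k0. approach_jump D (e ` {..k}) \<delta> m n w" if n: "n0 \<le> n" for n
    proof -
      obtain u1 where u1: "u1 \<in> U n" "u1 < \<tau>" using T_near[OF T_less] by blast
      then obtain k0 where k0: "u1 = e k0" using e by (auto simp: U_def)
      have "approach_jump D (e ` {..k}) \<delta> m n w" if k: "k0 \<le> k" for k
      proof -
        define S where "S = {u\<in>e ` {..k}. w u \<notin> deep D n}"
        have S: "finite S" unfolding S_def by (rule finite_subset[of _ "e ` {..k}"]) auto
        have u1_S: "u1 \<in> S" using u1 k k0 by (auto simp: S_def U_def)
        define u where "u = Min S"
        have u: "u \<in> S" "u \<le> u1" using S u1_S by (auto simp: u_def intro: Min_in Min_le)
        have first: "\<forall>u'\<in>e ` {..k}. u' < u \<longrightarrow> w u' \<in> deep D n"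
        proof (intro ballI impI)
          fix u' assume u': "u' \<in> e ` {..k}" "u' < u"
          then have "u' \<notin> S" using Min_le[OF S, of u'] by (auto simp: u_def)
          then show "w u' \<in> deep D n" using u'(1) by (simp add: S_def)
        qed
        have "u \<in> U n" using u(1) e by (auto simp: S_def U_def)
        then have u_gt: "\<tau> - \<delta> / 2 < u" using T_lower[of u n] T_mono[OF n] n0 by linarith
        have u_lt: "u < \<tau>" using u u1 by simp
        have "\<exists>v\<in>\<rat> \<inter> {0<..<\<delta>}. 1 / Suc m < dist (w (u + v)) (w u)"
        proof (cases "2 * \<epsilon> < dist (w u) l")
          case True
          obtain v where v: "v \<in> \<rat>" "max 0 (\<tau> - d1 - u) < v" "v < \<tau> - u"
            using Rats_dense_in_real[of "max 0 (\<tau> - d1 - u)" "\<tau> - u"] u_lt d1(1) by auto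
          have "dist (w (u + v)) l < \<epsilon>" using v by (intro d1(2)) auto
          then have "\<epsilon> < dist (w (u + v)) (w u)"
            using True dist_triangle[of "w u" l "w (u + v)"] by (simp add: dist_commute)
          then show ?thesis using v m u_gt \<delta> by (intro bexI[of _ v]) auto
        next
          case False
          then have *: "2 * \<epsilon> \<le> dist (w u) (w \<tau>)"
            using dist_triangle[of l "w \<tau>" "w u"] by (simp add: \<epsilon>_def dist_commute)
          obtain v where v: "v \<in> \<rat>" "\<tau> - u < v" "v < min (\<tau> - u + d2) \<delta>"
            using Rats_dense_in_real[of "\<tau> - u" "min (\<tau> - u + d2) \<delta>"] u_gt d2(1) \<delta> by auto
          have "dist (w (u + v)) (w \<tau>) < \<epsilon>" using v by (intro d2(2)) auto
          then have "\<epsilon> < dist (w (u + v)) (w u)"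
            using * dist_triangle[of "w u" "w \<tau>" "w (u + v)"] by (simp add: dist_commute)
          then show ?thesis using v m u_lt by (intro bexI[of _ v]) auto
        qed
        then show ?thesis
          unfolding approach_jump_def using u(1) first by (intro bexI[of _ u]) (auto simp: S_def dist_norm)
      qed
      then show ?thesis by blast
    qed
    then show "\<exists>n0. \<forall>n\<ge>n0. \<exists>k0. \<forall>k\<ge>k0. approach_jump D (e ` {..k}) \<delta> m n w" by blast
  qed
qed

lemma (in prob_space) prob_eventually_le:
  assumes A: "\<And>n::nat. A n \<in> events" and le: "\<And>n. prob (A n) \<le> c"
  shows "prob (\<Union>n0. \<Inter>n\<in>{n0..}. A n) \<le> c"
proof (rule LIMSEQ_le_const2)
  have ev: "(\<Inter>n\<in>{n0..}. A n) \<in> events" for n0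
    by (intro sets.countable_INT) (auto intro: A)
  show "(\<lambda>n0. prob (\<Inter>n\<in>{n0..}. A n)) \<longlonglongrightarrow> prob (\<Union>n0. \<Inter>n\<in>{n0..}. A n)"
    by (rule finite_Lim_measure_incseq) (auto simp: incseq_def intro: ev)
  have "prob (\<Inter>n\<in>{n0..}. A n) \<le> prob (A n0)" for n0
    by (intro finite_measure_mono A) auto
  then have "prob (\<Inter>n\<in>{n0..}. A n) \<le> c" for n0
    using le[of n0] by (rule order_trans)
  then show "\<exists>N. \<forall>n\<ge>N. prob (\<Inter>n\<in>{n..}. A n) \<le> c" by simp
qed

section \<open>Almost every path that approaches the complement of \<open>D\<close> enters
  it\<close>

locale killed_stable_process = stable_process \<alpha> c P X
  for \<alpha> c :: real and P :: "'a::euclidean_space \<Rightarrow> 'w measure" and X :: "real \<Rightarrow> 'w \<Rightarrow> 'a" +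
  fixes D :: "'a set"
  assumes open_D: "open D"
begin

lemma deep_borel[measurable]: "deep D n \<in> sets borel"
  by (rule borel_closed[OF closed_deep])

definition jump_set :: "nat \<Rightarrow> real \<Rightarrow> (real \<Rightarrow> 'a) set" where
  "jump_set m \<delta> = {w\<in>space paths. \<exists>v\<in>\<rat> \<inter> {0<..<\<delta>}. 1 / Suc m < norm (w v)}"

lemma paths_component: "0 \<le> v \<Longrightarrow> (\<lambda>w. w v) \<in> borel_measurable paths"
  by (rule measurable_component_singleton) simp

lemma jump_set_measurable[measurable]: "jump_set m \<delta> \<in> sets paths"
  unfolding jump_set_def
proof (rule sets.sets_Collect_countable_Ex')
  show "countable (\<rat> \<inter> {0<..<\<delta>})" by (intro countable_Int1 countable_rat)
  fix v assume v: "v \<in> \<rat> \<inter> {0<..<\<delta>}"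
  have [measurable]: "(\<lambda>w. w v) \<in> borel_measurable paths" using v by (intro paths_component) auto
  show "{w \<in> space paths. 1 / real (Suc m) < norm (w v)} \<in> sets paths" by measurable
qed

text \<open>Right continuity at time 0: almost no path moves by more than \<open>1 / Suc m\<close>
  within every short time span, so the decreasing events have a null intersection.\<close>

lemma path_law_jump_set_tendsto: "(\<lambda>j. L.prob (jump_set m (1 / Suc j))) \<longlonglongrightarrow> 0"
proof -
  have dec: "decseq (\<lambda>j. jump_set m (1 / Suc j))"
  proof (rule decseq_SucI)
    fix j show "jump_set m (1 / Suc (Suc j)) \<subseteq> jump_set m (1 / Suc j)"
    proof -
      have "1 / real (Suc (Suc j)) \<le> 1 / Suc j" by (rule frac_le) auto
      then show ?thesis unfolding jump_set_def by force
    qed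
  qed
  have lim: "(\<lambda>j. L.prob (jump_set m (1 / Suc j))) \<longlonglongrightarrow> L.prob (\<Inter>j. jump_set m (1 / Suc j))"
    by (rule L.finite_Lim_measure_decseq) (use dec in \<open>auto simp: sets_path_law\<close>)
  have "L.prob (\<Inter>j. jump_set m (1 / Suc j)) = P.prob 0 (shift 0 -` (\<Inter>j. jump_set m (1 / Suc j)) \<inter> space (P 0))"
    unfolding path_law_def by (rule measure_distr) (auto intro!: sets.countable_INT image_subsetI)
  also have "\<dots> = 0"
  proof -
    have "AE \<omega> in P 0. \<omega> \<notin> shift 0 -` (\<Inter>j. jump_set m (1 / Suc j)) \<inter> space (P 0)"
      using cadlag_paths[of 0]
    proof eventually_elim
      case (elim \<omega>)
      obtain d where d: "0 < d" "\<And>u. 0 \<le> u \<Longrightarrow> u < 0 + d \<Longrightarrow> dist (X u \<omega>) (X 0 \<omega>) < 1 / Suc m"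
        using cadlag_rightD[OF elim, of 0 "1 / Suc m"] by auto
      obtain j :: nat where j: "1 / Suc j < d" using nat_approx_posE[OF d(1)] by blast
      have "norm (shift 0 \<omega> v) \<le> 1 / Suc m" if "v \<in> {0<..<1 / Suc j}" for v
        using d(2)[of v] j that by (simp add: shift_def dist_norm)
      then have "shift 0 \<omega> \<notin> jump_set m (1 / Suc j)"
        by (force simp: jump_set_def not_less[symmetric])
      then show ?case by auto
    qed
    then show ?thesis
      by (subst P.prob_eq_0) (auto intro!: measurable_sets[OF measurable_shift] sets.countable_INT image_subsetI)
  qed
  finally show ?thesis using lim by simp
qed

text \<open>A strong Markov argument on a finite grid: the increments after \<open>u\<close> are
  independent of the event that \<open>u\<close> is the first time outside \<open>deep D n\<close>,
  so each piece contributes the probability of its past event times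
  \<open>L.prob (jump_set m \<delta>)\<close>. The past events are disjoint, which makes the bound
  uniform in \<open>G\<close> and \<open>n\<close>.\<close>

lemma prob_approach_jump:
  assumes G: "finite G" "G \<subseteq> {0..}"
  shows "{\<omega>\<in>space (P x). approach_jump D G \<delta> m n (\<lambda>t. X t \<omega>)} \<in> P.events x"
    and "P.prob x {\<omega>\<in>space (P x). approach_jump D G \<delta> m n (\<lambda>t. X t \<omega>)} \<le> L.prob (jump_set m \<delta>)"
proof -
  define Q where "Q u = {z\<in>space (PiM {0..u} (\<lambda>_. borel :: 'a measure)).
    z u \<notin> deep D n \<and> (\<forall>u'\<in>{u'\<in>G. u' < u}. z u' \<in> deep D n)}" for u
  let ?A = "\<lambda>u. past u -` Q u \<inter> space (P x)" and ?B = "\<lambda>u. shift u -` jump_set m \<delta> \<inter> space (P x)"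
  have Q: "Q u \<in> sets (PiM {0..u} (\<lambda>_. borel))" if u: "u \<in> G" for u
    unfolding Q_def
  proof (intro sets.sets_Collect_conj sets.sets_Collect_finite_All)
    have comp: "(\<lambda>z. z v) \<in> borel_measurable (PiM {0..u} (\<lambda>_. borel :: 'a measure))" if "v \<in> {0..u}" for v
      using that by (rule measurable_component_singleton)
    have [measurable]: "(\<lambda>z. z u) \<in> borel_measurable (PiM {0..u} (\<lambda>_. borel :: 'a measure))"
      using u G by (intro comp) auto
    show "{z \<in> space (PiM {0..u} (\<lambda>_. borel)). z u \<notin> deep D n} \<in> sets (PiM {0..u} (\<lambda>_. borel))"
      by measurable
    fix u' assume u': "u' \<in> {u' \<in> G. u' < u}"
    have [measurable]: "(\<lambda>z. z u') \<in> borel_measurable (PiM {0..u} (\<lambda>_. borel :: 'a measure))"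
      using u' G by (intro comp) auto
    show "{z \<in> space (PiM {0..u} (\<lambda>_. borel)). z u' \<in> deep D n} \<in> sets (PiM {0..u} (\<lambda>_. borel))"
      by measurable
  qed (use G in auto)
  have A: "?A u \<in> P.events x" if "u \<in> G" for u
    by (intro measurable_sets[OF measurable_past] Q that)
  have B: "?B u \<in> P.events x" if "u \<in> G" for u
    using that G by (intro measurable_sets[OF measurable_shift]) auto
  have A_eq: "\<omega> \<in> ?A u \<longleftrightarrow> \<omega> \<in> space (P x) \<and> X u \<omega> \<notin> deep D n \<and> (\<forall>u'\<in>G. u' < u \<longrightarrow> X u' \<omega> \<in> deep D n)"
    if "u \<in> G" for u \<omega>
    using that G by (auto simp: Q_def past_def space_PiM subset_iff)
  have B_eq: "\<omega> \<in> ?B u \<longleftrightarrow> \<omega> \<in> space (P x) \<and> (\<exists>v\<in>\<rat> \<inter> {0<..<\<delta>}. 1 / Suc m < norm (X (u + v) \<omega> - X u \<omega>))"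
    for u \<omega> by (auto simp: jump_set_def shift_def space_PiM)
  have eq: "{\<omega>\<in>space (P x). approach_jump D G \<delta> m n (\<lambda>t. X t \<omega>)} = (\<Union>u\<in>G. ?A u \<inter> ?B u)"
  proof (rule set_eqI)
    fix \<omega>
    have "\<omega> \<in> (\<Union>u\<in>G. ?A u \<inter> ?B u) \<longleftrightarrow> (\<exists>u\<in>G. \<omega> \<in> ?A u \<and> \<omega> \<in> ?B u)" by blast
    also have "\<dots> \<longleftrightarrow> \<omega> \<in> {\<omega>\<in>space (P x). approach_jump D G \<delta> m n (\<lambda>t. X t \<omega>)}"
      unfolding B_eq using A_eq by (auto simp: approach_jump_def simp del: vimage_eq Int_iff)
    finally show "\<omega> \<in> {\<omega>\<in>space (P x). approach_jump D G \<delta> m n (\<lambda>t. X t \<omega>)} \<longleftrightarrow> \<omega> \<in> (\<Union>u\<in>G. ?A u \<inter> ?B u)" ..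
  qed
  show "{\<omega>\<in>space (P x). approach_jump D G \<delta> m n (\<lambda>t. X t \<omega>)} \<in> P.events x"
    unfolding eq by (intro sets.finite_UN G sets.Int A B)
  have disj: "disjoint_family_on ?A G"
    unfolding disjoint_family_on_def
  proof (intro ballI impI)
    fix u u' assume u: "u \<in> G" "u' \<in> G" "u \<noteq> u'"
    then show "?A u \<inter> ?A u' = {}"
      using A_eq[OF u(1)] A_eq[OF u(2)] by (metis (no_types, lifting) Int_iff equals0I linorder_neqE)
  qed
  have prod: "P.prob x (?A u \<inter> ?B u) = P.prob x (?A u) * L.prob (jump_set m \<delta>)" if u: "u \<in> G" for u
  proof -
    have u0: "0 \<le> u" using u G by auto
    have "P.prob x (?A u \<inter> ?B u) = P.prob x ((\<lambda>\<omega>. (past u \<omega>, shift u \<omega>)) -` (Q u \<times> jump_set m \<delta>) \<inter> space (P x))"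
      by (intro arg_cong[where f="P.prob x"]) auto
    also have "\<dots> = P.prob x (?A u) * P.prob x (?B u)"
      by (rule P.indep_varD[OF indep_past_shift[OF u0]]) (auto intro: Q u)
    also have "P.prob x (?B u) = L.prob (jump_set m \<delta>)"
      unfolding distr_shift[OF u0, of x, symmetric] by (rule measure_distr[symmetric]) (auto simp: u0)
    finally show ?thesis .
  qed
  have "P.prob x (\<Union>u\<in>G. ?A u \<inter> ?B u) \<le> (\<Sum>u\<in>G. P.prob x (?A u \<inter> ?B u))"
    using A B G by (intro P.finite_measure_subadditive_finite) auto
  also have "\<dots> = (\<Sum>u\<in>G. P.prob x (?A u)) * L.prob (jump_set m \<delta>)"
    by (simp add: prod sum_distrib_right)
  also have "(\<Sum>u\<in>G. P.prob x (?A u)) = P.prob x (\<Union>u\<in>G. ?A u)"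
    using A by (intro P.finite_measure_finite_Union[symmetric] G disj) auto
  also have "\<dots> * L.prob (jump_set m \<delta>) \<le> L.prob (jump_set m \<delta>)"
    by (intro mult_left_le_one_le) auto
  finally show "P.prob x {\<omega>\<in>space (P x). approach_jump D G \<delta> m n (\<lambda>t. X t \<omega>)} \<le> L.prob (jump_set m \<delta>)"
    unfolding eq .
qed

text \<open>The right-hand side involves only countably many times. A path in \<open>D\<close> that
  violates it lies, for some \<open>m\<close>, in all the events \<open>N m (1 / Suc j)\<close>,
  whose probabilities tend to 0 with \<open>j\<close>. Conversely, values on a dense grid in a
  closed set determine all values by right continuity.\<close>

lemma AE_stays_iff_deep:
  assumes ab: "0 \<le> a" "a \<le> b"
  shows "AE \<omega> in P x. (\<forall>u\<in>{a..b}. X u \<omega> \<in> D) \<longleftrightarrow> (\<exists>n. \<forall>u\<in>rgrid a b. X u \<omega> \<in> deep D n)"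
proof -
  define e where "e = from_nat_into (rgrid a b)"
  have e: "range e = rgrid a b"
    unfolding e_def using rgrid_endpoints(1)[of a b] by (intro range_from_nat_into countable_rgrid) auto
  have e0: "e ` {..k} \<subseteq> {0..}" for k
  proof -
    have "e ` {..k} \<subseteq> rgrid a b" unfolding e[symmetric] by (rule image_mono) simp
    also have "\<dots> \<subseteq> {a..b}" by (rule rgrid_subset[OF ab(2)])
    also have "\<dots> \<subseteq> {0..}" using ab(1) by auto
    finally show ?thesis .
  qed
  let ?E = "\<lambda>m \<delta> n k. {\<omega>\<in>space (P x). approach_jump D (e ` {..k}) \<delta> m n (\<lambda>t. X t \<omega>)}"
  have E: "?E m \<delta> n k \<in> P.events x" "P.prob x (?E m \<delta> n k) \<le> L.prob (jump_set m \<delta>)" for m \<delta> n k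
    by (rule prob_approach_jump[OF _ e0], simp)+
  \<comment> \<open>The nested liminf over \<open>n\<close> and \<open>k\<close> mirrors the
    quantifiers of \<open>approach_jump_of_cadlag\<close>; \<open>prob_eventually_le\<close> applies
    once to each level.\<close>
  define N where "N m \<delta> = (\<Union>n0. \<Inter>n\<in>{n0..}. \<Union>k0. \<Inter>k\<in>{k0..}. ?E m \<delta> n k)" for m \<delta>
  have inner: "(\<Union>k0. \<Inter>k\<in>{k0..}. ?E m \<delta> n k) \<in> P.events x" for m \<delta> n
    by (intro sets.countable_UN sets.countable_INT image_subsetI E) auto
  have N: "N m \<delta> \<in> P.events x" for m \<delta>
    unfolding N_def by (intro sets.countable_UN sets.countable_INT image_subsetI inner) auto
  have N_le: "P.prob x (N m \<delta>) \<le> L.prob (jump_set m \<delta>)" for m \<delta>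
    unfolding N_def by (intro P.prob_eventually_le inner E)
  have "AE \<omega> in P x. \<omega> \<notin> (\<Inter>j. N m (1 / Suc j))" for m
  proof -
    have "P.prob x (\<Inter>j. N m (1 / Suc j)) \<le> P.prob x (N m (1 / Suc j))" for j
      by (intro P.finite_measure_mono N) auto
    then have "P.prob x (\<Inter>j. N m (1 / Suc j)) \<le> L.prob (jump_set m (1 / Suc j))" for j
      by (rule order_trans[OF _ N_le])
    then have "P.prob x (\<Inter>j. N m (1 / Suc j)) \<le> 0"
      by (intro LIMSEQ_le_const[OF path_law_jump_set_tendsto[of m]]) auto
    then have "P.prob x (\<Inter>j. N m (1 / Suc j)) = 0"
      by (simp add: measure_le_0_iff)
    then show ?thesis
      by (subst (asm) P.prob_eq_0) (auto intro!: sets.countable_INT image_subsetI N)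
  qed
  then have "AE \<omega> in P x. \<forall>m. \<omega> \<notin> (\<Inter>j. N m (1 / Suc j))" unfolding AE_all_countable by (rule allI)
  then show ?thesis
    using cadlag_paths[of x] AE_space
  proof eventually_elim
    case (elim \<omega>)
    show ?case
    proof
      assume stay: "\<forall>u\<in>{a..b}. X u \<omega> \<in> D"
      show "\<exists>n. \<forall>u\<in>rgrid a b. X u \<omega> \<in> deep D n"
      proof (rule ccontr)
        assume neg: "\<nexists>n. \<forall>u\<in>rgrid a b. X u \<omega> \<in> deep D n"
        from neg have esc: "\<And>n. \<exists>u\<in>rgrid a b. X u \<omega> \<notin> deep D n" by blast
        have stay': "\<And>u. u \<in> {a..b} \<Longrightarrow> X u \<omega> \<in> D" using stay by blast
        have "\<exists>m. \<forall>\<delta>>0. \<exists>n0. \<forall>n\<ge>n0. \<exists>k0. \<forall>k\<ge>k0. approach_jump D (e ` {..k}) \<delta> m n (\<lambda>t. X t \<omega>)"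
          by (rule approach_jump_of_cadlag[OF elim(2) ab open_D _ _ e]) (fact stay' esc)+
        then obtain m where m: "\<forall>\<delta>>0. \<exists>n0. \<forall>n\<ge>n0. \<exists>k0. \<forall>k\<ge>k0.
            approach_jump D (e ` {..k}) \<delta> m n (\<lambda>t. X t \<omega>)" ..
        have "\<omega> \<in> N m (1 / Suc j)" for j
        proof -
          have "\<exists>n0. \<forall>n\<ge>n0. \<exists>k0. \<forall>k\<ge>k0. approach_jump D (e ` {..k}) (1 / Suc j) m n (\<lambda>t. X t \<omega>)"
            using m by simp
          then obtain n0 where n0: "\<forall>n\<ge>n0. \<exists>k0. \<forall>k\<ge>k0. approach_jump D (e ` {..k}) (1 / Suc j) m n (\<lambda>t. X t \<omega>)" ..
          have K: "\<omega> \<in> (\<Union>k0. \<Inter>k\<in>{k0..}. ?E m (1 / Suc j) n k)" if "n0 \<le> n" for n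
          proof -
            from n0[THEN spec, THEN mp, OF that]
            obtain k0 where "\<forall>k\<ge>k0. approach_jump D (e ` {..k}) (1 / Suc j) m n (\<lambda>t. X t \<omega>)" ..
            then show ?thesis using elim(3) by (intro UN_I[of k0, OF UNIV_I] INT_I CollectI conjI) auto
          qed
          show ?thesis unfolding N_def by (rule UN_I[of n0, OF UNIV_I]) (rule INT_I, rule K, simp)
        qed
        then have "\<omega> \<in> (\<Inter>j. N m (1 / Suc j))" by (intro INT_I)
        then show False using elim(1)[rule_format, of m] by (rule notE[rotated])
      qed
    next
      assume "\<exists>n. \<forall>u\<in>rgrid a b. X u \<omega> \<in> deep D n"
      then obtain n where n: "\<And>u. u \<in> rgrid a b \<Longrightarrow> X u \<omega> \<in> deep D n" by blast
      show "\<forall>u\<in>{a..b}. X u \<omega> \<in> D"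
      proof
        fix u assume u: "u \<in> {a..b}"
        have "X u \<omega> \<in> deep D n"
        proof (cases "u = b")
          case True
          then show ?thesis using n rgrid_endpoints by blast
        next
          case False
          then have ub: "a \<le> u" "u < b" using u by auto
          have "X u \<omega> \<in> closure (deep D n)"
            unfolding closure_approachable
          proof (intro allI impI)
            fix \<epsilon> :: real assume "0 < \<epsilon>"
            then obtain d where d: "0 < d" "\<And>v. u \<le> v \<Longrightarrow> v < u + d \<Longrightarrow> dist (X v \<omega>) (X u \<omega>) < \<epsilon>"
              using cadlag_rightD[OF elim(2), of u \<epsilon>] ub ab by auto
            obtain r where "r \<in> rgrid a b" "u < r" "r < u + d" using rgrid_dense[OF ub, of "u + d"] d(1) by auto
            then show "\<exists>y\<in>deep D n. dist y (X u \<omega>) < \<epsilon>" using n d(2)[of r] by auto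
          qed
          then show ?thesis using closed_deep[of D n] by (simp add: closure_closed)
        qed
        then show "X u \<omega> \<in> D" using deep_subset by blast
      qed
    qed
  qed
qed

end

section \<open>The killed process\<close>

lemma sets_Collect_Ball_countable:
  assumes "countable I" "\<And>i. i \<in> I \<Longrightarrow> {x\<in>space M. P i x} \<in> sets M"
  shows "{x\<in>space M. \<forall>i\<in>I. P i x} \<in> sets M"
proof -
  have "{x\<in>space M. \<exists>i\<in>I. \<not> P i x} \<in> sets M"
    by (intro sets.sets_Collect_countable_Ex' sets.sets_Collect_neg assms)
  then have "{x\<in>space M. \<not> (\<exists>i\<in>I. \<not> P i x)} \<in> sets M"
    by (rule sets.sets_Collect_neg)
  then show ?thesis by simp
qed

lemma sets_completion_AE_eq:
  assumes A: "A \<subseteq> space M" and B: "B \<in> sets M" and eq: "AE x in M. x \<in> A \<longleftrightarrow> x \<in> B"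
  shows "A \<in> sets (completion M)" "measure (completion M) A = measure M B"
proof -
  obtain N where N: "{x\<in>space M. \<not> (x \<in> A \<longleftrightarrow> x \<in> B)} \<subseteq> N" "emeasure M N = 0" "N \<in> sets M"
    using eq by (rule AE_E)
  show A': "A \<in> sets (completion M)"
  proof (rule sets_completionI)
    show "A = (B - N) \<union> (A \<inter> N)" using N(1) A sets.sets_into_space[OF B] by auto
  qed (use N B in \<open>auto simp: null_sets_def\<close>)
  have "measure (completion M) A = measure (completion M) B"
    by (rule measure_eq_AE) (use A' B AE_completion[OF eq] in auto)
  then show "measure (completion M) A = measure M B" using B by simp
qed

context killed_stable_process
begin

text \<open>The strict inequality matches the closed end at \<open>t\<close>: as \<open>D\<close> is
  open, right continuity keeps the path in \<open>D\<close> a little beyond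
  \<open>t\<close>.\<close>

lemma less_exit_time_iff:
  assumes w: "cadlag (\<lambda>t. X t \<omega>)" and t: "0 < t"
  shows "ennreal t < exit_time X D \<omega> \<longleftrightarrow> (\<forall>u\<in>{0<..t}. X u \<omega> \<in> D)"
proof
  assume *: "ennreal t < exit_time X D \<omega>"
  show "\<forall>u\<in>{0<..t}. X u \<omega> \<in> D"
  proof (intro ballI, rule ccontr)
    fix u assume u: "u \<in> {0<..t}" "X u \<omega> \<notin> D"
    then have "exit_time X D \<omega> \<le> ennreal u" unfolding exit_time_def by (intro INF_lower) auto
    also have "\<dots> \<le> ennreal t" using u by (auto intro: ennreal_leI)
    finally show False using * by simp
  qed
next
  assume *: "\<forall>u\<in>{0<..t}. X u \<omega> \<in> D"
  then have "X t \<omega> \<in> D" using t by simp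
  then obtain r where r: "0 < r" "ball (X t \<omega>) r \<subseteq> D" using open_D open_contains_ball by blast
  obtain d where d: "0 < d" "\<And>u. t \<le> u \<Longrightarrow> u < t + d \<Longrightarrow> dist (X u \<omega>) (X t \<omega>) < r"
    using cadlag_rightD[OF w _ r(1), of t] t by auto
  have "X u \<omega> \<in> D" if "0 < u" "u < t + d" for u
    using * d(2)[of u] r(2) that by (cases "u \<le> t") (auto simp: dist_commute)
  then have "ennreal (t + d) \<le> exit_time X D \<omega>"
    unfolding exit_time_def by (intro INF_greatest ennreal_leI) (auto simp: not_less[symmetric])
  moreover have "ennreal t < ennreal (t + d)" using t d by (intro ennreal_lessI) auto
  ultimately show "ennreal t < exit_time X D \<omega>" by (rule order_less_le_trans[rotated])
qed

lemma mem_D_of_less_exit_time: "0 < t \<Longrightarrow> ennreal t < exit_time X D \<omega> \<Longrightarrow> X t \<omega> \<in> D"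
  unfolding exit_time_def by (rule ccontr) (metis (mono_tags, lifting) INF_lower mem_Collect_eq not_le)

text \<open>\<open>exit_time\<close> ignores time 0, so the condition concerns an interval open at
  0. It is exhausted by the compact intervals starting at \<open>1 / Suc k\<close>, each with its
  own \<open>n\<close>, since the path may start on the boundary.\<close>

definition past_alive :: "real \<Rightarrow> (real \<Rightarrow> 'a) set" where
  "past_alive t = {z\<in>space (PiM {0..t} (\<lambda>_. borel)).
     \<forall>k\<in>{k. 1 / Suc k \<le> t}. \<exists>n. \<forall>u\<in>rgrid (1 / Suc k) t. z u \<in> deep D n}"

text \<open>Here the interval is closed at 0. The starting point is a separate coordinate, which
  gives joint measurability and allows a restart from the current position.\<close>

definition alive_set :: "real \<Rightarrow> ('a \<times> (real \<Rightarrow> 'a)) set" where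
  "alive_set t = {yw\<in>space (borel \<Otimes>\<^sub>M paths). \<exists>n. \<forall>u\<in>rgrid 0 t. fst yw + snd yw u \<in> deep D n}"

lemma past_alive_measurable[measurable]: "past_alive t \<in> sets (PiM {0..t} (\<lambda>_. borel))"
  unfolding past_alive_def
proof (intro sets_Collect_Ball_countable sets.sets_Collect_countable_Ex countable_rgrid)
  fix k n u assume k: "k \<in> {k. 1 / Suc k \<le> t}" and "u \<in> rgrid (1 / Suc k) t"
  then have "u \<in> {1 / Suc k..t}" using rgrid_subset by blast
  then have "u \<in> {0..t}" by (auto intro: order_trans[rotated])
  then have [measurable]: "(\<lambda>z. z u) \<in> borel_measurable (PiM {0..t} (\<lambda>_. borel :: 'a measure))"
    by (rule measurable_component_singleton)
  show "{z \<in> space (PiM {0..t} (\<lambda>_. borel)). z u \<in> deep D n} \<in> sets (PiM {0..t} (\<lambda>_. borel))"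
    by measurable
qed simp

lemma alive_set_measurable[measurable]: "0 \<le> t \<Longrightarrow> alive_set t \<in> sets (borel \<Otimes>\<^sub>M paths)"
  unfolding alive_set_def
proof (intro sets_Collect_Ball_countable sets.sets_Collect_countable_Ex countable_rgrid)
  fix n u assume "0 \<le> t" and "u \<in> rgrid 0 t"
  then have "0 \<le> u" using rgrid_subset[of 0 t] by auto
  note paths_component[OF this, measurable]
  show "{yw \<in> space (borel \<Otimes>\<^sub>M paths). fst yw + snd yw u \<in> deep D n} \<in> sets (borel \<Otimes>\<^sub>M paths)"
    by measurable
qed

lemma stays_iff_Suc:
  assumes "0 < t"
  shows "(\<forall>u\<in>{0<..t}. Q u) \<longleftrightarrow> (\<forall>k\<in>{k. 1 / Suc k \<le> t}. \<forall>u\<in>{1 / Suc k..t}. Q u)"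
proof (intro iffI ballI)
  fix k u assume "\<forall>u\<in>{0<..t}. Q u" "k \<in> {k. 1 / Suc k \<le> t}" "u \<in> {1 / Suc k..t}"
  moreover from this(3) have "0 < u" by (auto intro: less_le_trans[rotated])
  ultimately show "Q u" by auto
next
  fix u assume *: "\<forall>k\<in>{k. 1 / Suc k \<le> t}. \<forall>u\<in>{1 / Suc k..t}. Q u" and u: "u \<in> {0<..t}"
  then obtain k where "1 / Suc k < u" using nat_approx_posE[of u] by auto
  moreover from this have "k \<in> {k. 1 / Suc k \<le> t}" using u by simp
  ultimately show "Q u" using *[rule_format, of k u] u by simp
qed

lemma AE_less_exit_time_iff:
  assumes t: "0 < t"
  shows "AE \<omega> in P x. ennreal t < exit_time X D \<omega> \<longleftrightarrow> past t \<omega> \<in> past_alive t"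
proof -
  have "AE \<omega> in P x. \<forall>k\<in>{k. 1 / Suc k \<le> t}. (\<forall>u\<in>{1 / Suc k..t}. X u \<omega> \<in> D) \<longleftrightarrow>
      (\<exists>n. \<forall>u\<in>rgrid (1 / Suc k) t. X u \<omega> \<in> deep D n)"
    by (subst AE_ball_countable) (auto intro!: AE_stays_iff_deep)
  then show ?thesis
    using cadlag_paths[of x] AE_space
  proof eventually_elim
    case (elim \<omega>)
    have sub: "rgrid (1 / Suc k) t \<subseteq> {0..t}" if "k \<in> {k. 1 / Suc k \<le> t}" for k
    proof -
      have "rgrid (1 / Suc k) t \<subseteq> {1 / Suc k..t}" using that by (intro rgrid_subset) simp
      also have "\<dots> \<subseteq> {0..t}" by simp
      finally show ?thesis .
    qed
    have "past t \<omega> \<in> past_alive t \<longleftrightarrow> (\<forall>k\<in>{k. 1 / Suc k \<le> t}. \<exists>n. \<forall>u\<in>rgrid (1 / Suc k) t. past t \<omega> u \<in> deep D n)"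
      by (simp add: past_alive_def past_def space_PiM)
    also have "\<dots> \<longleftrightarrow> (\<forall>k\<in>{k. 1 / Suc k \<le> t}. \<exists>n. \<forall>u\<in>rgrid (1 / Suc k) t. X u \<omega> \<in> deep D n)"
    proof -
      have "(\<forall>u\<in>rgrid (1 / Suc k) t. past t \<omega> u \<in> deep D n) \<longleftrightarrow> (\<forall>u\<in>rgrid (1 / Suc k) t. X u \<omega> \<in> deep D n)"
        if "k \<in> {k. 1 / Suc k \<le> t}" for k n
        by (rule ball_cong[OF refl]) (use sub[OF that] in \<open>simp add: past_def subset_iff\<close>)
      then show ?thesis by (intro ball_cong[OF refl]) (simp only:)
    qed
    also have "\<dots> \<longleftrightarrow> (\<forall>k\<in>{k. 1 / Suc k \<le> t}. \<forall>u\<in>{1 / Suc k..t}. X u \<omega> \<in> D)"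
      by (rule ball_cong[OF refl]) (simp only: elim(1)[rule_format])
    also have "\<dots> \<longleftrightarrow> ennreal t < exit_time X D \<omega>"
      by (simp only: less_exit_time_iff[OF elim(2) t] stays_iff_Suc[OF t])
    finally show ?case ..
  qed
qed

lemma AE_stays_iff_alive:
  assumes "0 \<le> s" "0 \<le> t"
  shows "AE \<omega> in P x. (\<forall>u\<in>{s..s + t}. X u \<omega> \<in> D) \<longleftrightarrow> (X s \<omega>, shift s \<omega>) \<in> alive_set t"
proof -
  have "AE \<omega> in P x. (\<forall>u\<in>{s..s + t}. X u \<omega> \<in> D) \<longleftrightarrow> (\<exists>n. \<forall>u\<in>rgrid s (s + t). X u \<omega> \<in> deep D n)"
    using assms by (intro AE_stays_iff_deep) auto
  then show ?thesis
  proof eventually_elim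
    case (elim \<omega>)
    have "X s \<omega> + shift s \<omega> u = X (s + u) \<omega>" if "u \<in> rgrid 0 t" for u
      using that rgrid_subset[OF assms(2)] by (auto simp: shift_def)
    then show ?case
      unfolding elim rgrid_shift by (simp add: alive_set_def space_pair_measure space_PiM shift_def)
  qed
qed

lemma AE_alive_split:
  assumes s: "0 < s" and t: "0 < t"
  shows "AE \<omega> in P x. past (s + t) \<omega> \<in> past_alive (s + t) \<longleftrightarrow>
    past s \<omega> \<in> past_alive s \<and> (X s \<omega>, shift s \<omega>) \<in> alive_set t"
proof -
  have st: "0 < s + t" using s t by simp
  show ?thesis
    using AE_less_exit_time_iff[OF st] AE_less_exit_time_iff[OF s] AE_stays_iff_alive[of s t x, OF less_imp_le[OF s] less_imp_le[OF t]] cadlag_paths[of x]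
  proof eventually_elim
    case (elim \<omega>)
    have "(\<forall>u\<in>{0<..s + t}. X u \<omega> \<in> D) \<longleftrightarrow> (\<forall>u\<in>{0<..s}. X u \<omega> \<in> D) \<and> (\<forall>u\<in>{s..s + t}. X u \<omega> \<in> D)"
    proof -
      have "{0<..s + t} = {0<..s} \<union> {s..s + t}" using s t by auto
      then show ?thesis by (simp only: ball_Un)
    qed
    then show ?case
      using elim s t st less_exit_time_iff[OF elim(4) st] less_exit_time_iff[OF elim(4) s] by simp
  qed
qed

text \<open>Starting in \<open>D\<close> settles time 0, which \<open>alive_set\<close> includes and
  \<open>past_alive\<close> leaves out.\<close>

lemma AE_alive_start:
  assumes t: "0 < t" and x: "x \<in> D"
  shows "AE \<omega> in P x. past t \<omega> \<in> past_alive t \<longleftrightarrow> (x, shift 0 \<omega>) \<in> alive_set t"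
  using AE_less_exit_time_iff[OF t] AE_stays_iff_alive[of 0 t x, OF order_refl less_imp_le[OF t]] start[of x] cadlag_paths[of x]
proof eventually_elim
  case (elim \<omega>)
  have "(\<forall>u\<in>{0..0 + t}. X u \<omega> \<in> D) \<longleftrightarrow> (\<forall>u\<in>{0<..t}. X u \<omega> \<in> D)"
  proof -
    have "{0..0 + t} = insert 0 {0<..t}" using t by auto
    then show ?thesis using elim(3) x by simp
  qed
  then show ?case
    using elim t less_exit_time_iff[OF elim(4) t] by simp
qed

section \<open>Transition kernels of the killed process\<close>

definition kernel_nn :: "real \<Rightarrow> ('a \<Rightarrow> ennreal) \<Rightarrow> 'a \<Rightarrow> ennreal" where
  "kernel_nn t h x = (\<integral>\<^sup>+w. h (x + w t) * indicator (alive_set t) (x, w) \<partial>path_law)"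

definition kernel :: "real \<Rightarrow> ('a \<Rightarrow> real) \<Rightarrow> 'a \<Rightarrow> real" where
  "kernel t f x = (\<integral>w. f (x + w t) * indicator (alive_set t) (x, w) \<partial>path_law)"

text \<open>Formed with \<open>past_alive\<close> under \<open>P x\<close>, so as to agree with
  \<open>survival_prob\<close> at every starting point. Outside \<open>D\<close> it may be positive,
  because time 0 does not count, whereas both kernels vanish there; hence the recurring case
  distinction on \<open>x \<in> D\<close>.\<close>

definition survival :: "real \<Rightarrow> 'a \<Rightarrow> real" where
  "survival t x = P.prob x {\<omega>\<in>space (P x). past t \<omega> \<in> past_alive t}"

lemma measurable_path_component[measurable (raw)]:
  "0 \<le> t \<Longrightarrow> f \<in> measurable M paths \<Longrightarrow> (\<lambda>x. f x t) \<in> borel_measurable M"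
  by (rule measurable_compose[OF _ paths_component])

lemma measurable_kernel_integrand_nn:
  assumes [measurable]: "h \<in> borel_measurable borel" and t: "0 \<le> t"
  shows "(\<lambda>(x, w). h (x + w t) * indicator (alive_set t) (x, w) :: ennreal) \<in> borel_measurable (borel \<Otimes>\<^sub>M paths)"
  using t by measurable

lemma measurable_kernel_integrand:
  assumes [measurable]: "f \<in> borel_measurable borel" and t: "0 \<le> t"
  shows "(\<lambda>(x, w). f (x + w t) * indicator (alive_set t) (x, w) :: real) \<in> borel_measurable (borel \<Otimes>\<^sub>M paths)"
  using t by measurable

lemma measurable_kernel_nn:
  assumes "h \<in> borel_measurable borel" and t: "0 \<le> t"
  shows "kernel_nn t h \<in> borel_measurable borel"
proof -
  have "(\<lambda>(x, w). h (x + w t) * indicator (alive_set t) (x, w)) \<in> borel_measurable (borel \<Otimes>\<^sub>M path_law)"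
    using measurable_kernel_integrand_nn[OF assms] by (simp cong: measurable_cong_sets add: sets_path_law)
  from L.borel_measurable_nn_integral_fst[OF this] show ?thesis
    by (simp add: kernel_nn_def[abs_def])
qed

lemma measurable_kernel:
  assumes "f \<in> borel_measurable borel" and t: "0 \<le> t"
  shows "kernel t f \<in> borel_measurable borel"
proof -
  have "(\<lambda>(x, w). f (x + w t) * indicator (alive_set t) (x, w)) \<in> borel_measurable (borel \<Otimes>\<^sub>M path_law)"
    using measurable_kernel_integrand[OF assms] by (simp cong: measurable_cong_sets add: sets_path_law)
  then show ?thesis
    unfolding kernel_def[abs_def] by (rule L.borel_measurable_lebesgue_integral)
qed

text \<open>By \<open>AE_alive_split\<close>, survival up to \<open>s + t\<close> is survival up to
  \<open>s\<close> together with survival for a further time \<open>t\<close> of the path restarted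
  at \<open>X s\<close>. Averaging over the restarted path produces the kernel.\<close>

lemma nn_integral_markov_killed:
  assumes s: "0 < s" and t: "0 < t" and [measurable]: "h \<in> borel_measurable borel"
  shows "(\<integral>\<^sup>+\<omega>. h (X (s + t) \<omega>) * indicator (past_alive (s + t)) (past (s + t) \<omega>) \<partial>P x)
    = (\<integral>\<^sup>+\<omega>. kernel_nn t h (X s \<omega>) * indicator (past_alive s) (past s \<omega>) \<partial>P x)"
proof -
  let ?F = "\<lambda>(z, w). indicator (past_alive s) z * (h (z s + w t) * indicator (alive_set t) (z s, w)) :: ennreal"
  note [simp] = less_imp_le[OF s] less_imp_le[OF t]
  have F: "?F \<in> borel_measurable (PiM {0..s} (\<lambda>_. borel) \<Otimes>\<^sub>M paths)"
    using t by measurable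
  have "(\<integral>\<^sup>+\<omega>. h (X (s + t) \<omega>) * indicator (past_alive (s + t)) (past (s + t) \<omega>) \<partial>P x)
      = (\<integral>\<^sup>+\<omega>. ?F (past s \<omega>, shift s \<omega>) \<partial>P x)"
  proof (rule nn_integral_cong_AE)
    show "AE \<omega> in P x. h (X (s + t) \<omega>) * indicator (past_alive (s + t)) (past (s + t) \<omega>) = ?F (past s \<omega>, shift s \<omega>)"
      using AE_alive_split[OF s t, of x]
      by eventually_elim (use s t in \<open>simp add: past_def shift_def indicator_def\<close>)
  qed
  also have "\<dots> = (\<integral>\<^sup>+\<omega>. \<integral>\<^sup>+w. ?F (past s \<omega>, w) \<partial>path_law \<partial>P x)"
    by (rule nn_integral_markov[OF _ F]) (use s in simp)
  also have "\<dots> = (\<integral>\<^sup>+\<omega>. kernel_nn t h (X s \<omega>) * indicator (past_alive s) (past s \<omega>) \<partial>P x)"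
  proof (intro nn_integral_cong)
    fix \<omega>
    show "(\<integral>\<^sup>+w. ?F (past s \<omega>, w) \<partial>path_law) = kernel_nn t h (X s \<omega>) * indicator (past_alive s) (past s \<omega>)"
      using s by (cases "past s \<omega> \<in> past_alive s") (auto simp: kernel_nn_def past_def[abs_def])
  qed
  finally show ?thesis .
qed

lemma integral_markov_killed:
  assumes s: "0 < s" and t: "0 < t" and [measurable]: "f \<in> borel_measurable borel"
    and int: "integrable (P x) (\<lambda>\<omega>. f (X (s + t) \<omega>))"
  shows "(\<integral>\<omega>. f (X (s + t) \<omega>) * indicator (past_alive (s + t)) (past (s + t) \<omega>) \<partial>P x)
    = (\<integral>\<omega>. kernel t f (X s \<omega>) * indicator (past_alive s) (past s \<omega>) \<partial>P x)"
proof -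
  let ?F = "\<lambda>(z, w). indicator (past_alive s) z * (f (z s + w t) * indicator (alive_set t) (z s, w)) :: real"
  note [simp] = less_imp_le[OF s] less_imp_le[OF t]
  have F: "?F \<in> borel_measurable (PiM {0..s} (\<lambda>_. borel) \<Otimes>\<^sub>M paths)"
    using t by measurable
  have [measurable]: "shift s \<in> measurable (P x) paths" "X (s + t) \<in> borel_measurable (P x)" using s t by simp_all
  have F': "(\<lambda>\<omega>. ?F (past s \<omega>, shift s \<omega>)) \<in> borel_measurable (P x)"
    by (rule measurable_compose[OF _ F]) measurable
  have ae: "AE \<omega> in P x. f (X (s + t) \<omega>) * indicator (past_alive (s + t)) (past (s + t) \<omega>) = ?F (past s \<omega>, shift s \<omega>)"
    using AE_alive_split[OF s t, of x]
    by eventually_elim (use s t in \<open>simp add: past_def shift_def indicator_def\<close>)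
  have "integrable (P x) (\<lambda>\<omega>. ?F (past s \<omega>, shift s \<omega>))"
  proof (rule Bochner_Integration.integrable_bound[OF int F'])
    show "AE \<omega> in P x. norm (?F (past s \<omega>, shift s \<omega>)) \<le> norm (f (X (s + t) \<omega>))"
      by (intro AE_I2) (use s t in \<open>auto simp: past_def shift_def indicator_def\<close>)
  qed
  from integral_markov[OF _ F this] s
  have "(\<integral>\<omega>. ?F (past s \<omega>, shift s \<omega>) \<partial>P x) = (\<integral>\<omega>. \<integral>w. ?F (past s \<omega>, w) \<partial>path_law \<partial>P x)" by simp
  moreover have "(\<integral>w. ?F (past s \<omega>, w) \<partial>path_law) = kernel t f (X s \<omega>) * indicator (past_alive s) (past s \<omega>)" for \<omega>
    using s by (cases "past s \<omega> \<in> past_alive s") (auto simp: kernel_def past_def[abs_def])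
  moreover have "(\<integral>\<omega>. f (X (s + t) \<omega>) * indicator (past_alive (s + t)) (past (s + t) \<omega>) \<partial>P x)
      = (\<integral>\<omega>. ?F (past s \<omega>, shift s \<omega>) \<partial>P x)"
    by (rule integral_cong_AE[OF _ F' ae]) measurable
  ultimately show ?thesis by (simp only:)
qed

lemma kernel_nn_eq:
  assumes t: "0 < t" and x: "x \<in> D" and [measurable]: "h \<in> borel_measurable borel"
  shows "kernel_nn t h x = (\<integral>\<^sup>+\<omega>. h (X t \<omega>) * indicator (past_alive t) (past t \<omega>) \<partial>P x)"
proof -
  note [simp] = less_imp_le[OF t]
  have [measurable]: "(\<lambda>w. h (x + w t) * indicator (alive_set t) (x, w)) \<in> borel_measurable paths"
    using t by measurable
  have "kernel_nn t h x = (\<integral>\<^sup>+\<omega>. h (x + shift 0 \<omega> t) * indicator (alive_set t) (x, shift 0 \<omega>) \<partial>P x)"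
    unfolding kernel_nn_def by (subst distr_shift[of 0 x, symmetric]) (auto simp: nn_integral_distr)
  also have "\<dots> = (\<integral>\<^sup>+\<omega>. h (X t \<omega>) * indicator (past_alive t) (past t \<omega>) \<partial>P x)"
    by (rule nn_integral_cong_AE) (use AE_alive_start[OF t x] start[of x] in
      \<open>eventually_elim, use t in \<open>simp add: shift_def indicator_def\<close>\<close>)
  finally show ?thesis .
qed

lemma kernel_eq:
  assumes t: "0 < t" and x: "x \<in> D" and [measurable]: "f \<in> borel_measurable borel"
  shows "kernel t f x = (\<integral>\<omega>. f (X t \<omega>) * indicator (past_alive t) (past t \<omega>) \<partial>P x)"
proof -
  note [simp] = less_imp_le[OF t]
  have [measurable]: "(\<lambda>w. f (x + w t) * indicator (alive_set t) (x, w)) \<in> borel_measurable paths"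
    using t by measurable
  have [measurable]: "X t \<in> borel_measurable (P x)" using t by simp
  have "kernel t f x = (\<integral>\<omega>. f (x + shift 0 \<omega> t) * indicator (alive_set t) (x, shift 0 \<omega>) \<partial>P x)"
    unfolding kernel_def by (subst distr_shift[of 0 x, symmetric]) (auto simp: integral_distr)
  also have "\<dots> = (\<integral>\<omega>. f (X t \<omega>) * indicator (past_alive t) (past t \<omega>) \<partial>P x)"
  proof (rule integral_cong_AE)
    show "AE \<omega> in P x. f (x + shift 0 \<omega> t) * indicator (alive_set t) (x, shift 0 \<omega>) = f (X t \<omega>) * indicator (past_alive t) (past t \<omega>)"
      using AE_alive_start[OF t x] start[of x] by eventually_elim (use t in \<open>simp add: shift_def indicator_def\<close>)
    show "(\<lambda>\<omega>. f (x + shift 0 \<omega> t) * indicator (alive_set t) (x, shift 0 \<omega>)) \<in> borel_measurable (P x)"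
      by (rule measurable_compose[of "shift 0" _ paths "\<lambda>w. f (x + w t) * indicator (alive_set t) (x, w)"]) auto
  qed measurable
  finally show ?thesis .
qed

lemma AE_path_start: "AE w in path_law. w 0 = 0"
  unfolding path_law_def by (subst AE_distr_iff) (auto simp: shift_def)

lemma AE_not_alive_outside: "x \<notin> D \<Longrightarrow> AE w in path_law. (x, w) \<notin> alive_set t"
  using AE_path_start by eventually_elim (use rgrid_endpoints(1)[of 0 t] deep_subset in \<open>fastforce simp: alive_set_def\<close>)

lemma kernel_outside: "x \<notin> D \<Longrightarrow> kernel t f x = 0"
  unfolding kernel_def by (rule integral_eq_zero_AE) (use AE_not_alive_outside[of x t] in auto)

lemma kernel_nn_outside: "x \<notin> D \<Longrightarrow> kernel_nn t f x = 0"
  unfolding kernel_nn_def using AE_not_alive_outside[of x t]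
  by (subst nn_integral_cong_AE[where v="\<lambda>_. 0"]) auto

lemma measurable_past_alive[measurable]: "{\<omega>\<in>space (P x). past t \<omega> \<in> past_alive t} \<in> P.events x"
  by measurable

lemma nn_integral_past_alive:
  "(\<integral>\<^sup>+\<omega>. indicator (past_alive t) (past t \<omega>) \<partial>P x) = ennreal (survival t x)"
proof -
  have "(\<integral>\<^sup>+\<omega>. indicator (past_alive t) (past t \<omega>) \<partial>P x)
      = (\<integral>\<^sup>+\<omega>. indicator {\<omega>\<in>space (P x). past t \<omega> \<in> past_alive t} \<omega> \<partial>P x)"
    by (intro nn_integral_cong) (auto simp: indicator_def)
  then show ?thesis by (simp add: survival_def P.emeasure_eq_measure)
qed

lemma survival_eq_kernel_nn: "0 < t \<Longrightarrow> x \<in> D \<Longrightarrow> kernel_nn t (\<lambda>_. 1) x = ennreal (survival t x)"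
  using kernel_nn_eq[of t x "\<lambda>_. 1"] by (simp add: nn_integral_past_alive)

lemma less_exit_time_event:
  assumes "0 < t"
  shows "{\<omega> \<in> space (P x). ennreal t < exit_time X D \<omega>} \<in> sets (completion (P x))"
    and "survival_prob P X D t x = survival t x"
proof -
  have "AE \<omega> in P x. \<omega> \<in> {\<omega> \<in> space (P x). ennreal t < exit_time X D \<omega>}
      \<longleftrightarrow> \<omega> \<in> {\<omega>\<in>space (P x). past t \<omega> \<in> past_alive t}"
    using AE_less_exit_time_iff[OF assms, of x] by eventually_elim simp
  note * = sets_completion_AE_eq[OF _ measurable_past_alive this]
  show "{\<omega> \<in> space (P x). ennreal t < exit_time X D \<omega>} \<in> sets (completion (P x))"
    by (rule *) auto
  show "survival_prob P X D t x = survival t x"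
    unfolding survival_prob_def survival_def by (rule *) auto
qed

text \<open>Monotonicity is evident for the events in terms of \<open>exit_time\<close>; the sets
  \<open>past_alive\<close> at two times use different grids, so the proof goes through the
  completed measure.\<close>

lemma survival_mono: "0 < s \<Longrightarrow> s \<le> t \<Longrightarrow> survival t x \<le> survival s x"
proof -
  assume s: "0 < s" "s \<le> t"
  interpret C: prob_space "completion (P x)" by (rule P.prob_space_completion)
  show ?thesis
    unfolding less_exit_time_event(2)[OF s(1), symmetric]
    using s less_exit_time_event(2)[of t x] 
    by (simp flip: less_exit_time_event(2)[of t x] add: survival_prob_def)
      (intro C.finite_measure_mono less_exit_time_event, auto intro: le_less_trans[rotated] ennreal_leI)
qed

text \<open>On survival \<open>X t\<close> lies in \<open>D\<close>, so the values of
  \<open>f\<close> elsewhere can be replaced by 0. The completion disappears because the survival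
  event agrees almost surely with a measurable one.\<close>

lemma part_semigroup_eq_kernel:
  assumes t: "0 < t" and x: "x \<in> D" and f[measurable]: "(\<lambda>y. indicator D y * f y) \<in> borel_measurable borel"
  shows "part_semigroup P X D t f x = kernel t (\<lambda>y. indicator D y * f y) x"
proof -
  note [simp] = less_imp_le[OF t]
  let ?A = "{\<omega> \<in> space (P x). ennreal t < exit_time X D \<omega>}" and ?f = "\<lambda>y. indicator D y * f y"
  have [measurable]: "X t \<in> borel_measurable (P x)" using t by simp
  have "part_semigroup P X D t f x = (\<integral>\<omega>. indicator ?A \<omega> * ?f (X t \<omega>) \<partial>completion (P x))"
    unfolding part_semigroup_def set_lebesgue_integral_def
    by (intro Bochner_Integration.integral_cong) (use mem_D_of_less_exit_time[OF t] in \<open>auto simp: indicator_def\<close>)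
  also have "\<dots> = (\<integral>\<omega>. ?f (X t \<omega>) * indicator (past_alive t) (past t \<omega>) \<partial>completion (P x))"
  proof (rule integral_cong_AE)
    have [measurable]: "?A \<in> sets (completion (P x))" by (rule less_exit_time_event[OF t])
    have [measurable]: "X t \<in> borel_measurable (completion (P x))"
      by (rule measurable_completion) simp
    show "(\<lambda>\<omega>. indicator ?A \<omega> * ?f (X t \<omega>)) \<in> borel_measurable (completion (P x))"
      by (intro borel_measurable_times borel_measurable_indicator measurable_compose[OF _ f]) measurable
    show "(\<lambda>\<omega>. ?f (X t \<omega>) * indicator (past_alive t) (past t \<omega>)) \<in> borel_measurable (completion (P x))"
      by (rule measurable_completion) measurable
    have "AE \<omega> in P x. indicator ?A \<omega> * ?f (X t \<omega>) = ?f (X t \<omega>) * indicator (past_alive t) (past t \<omega>)"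
      using AE_less_exit_time_iff[OF t, of x] AE_space by eventually_elim (simp add: indicator_def)
    then show "AE \<omega> in completion (P x). indicator ?A \<omega> * ?f (X t \<omega>) = ?f (X t \<omega>) * indicator (past_alive t) (past t \<omega>)"
      by (rule AE_completion)
  qed
  also have "\<dots> = (\<integral>\<omega>. ?f (X t \<omega>) * indicator (past_alive t) (past t \<omega>) \<partial>P x)"
    by (rule integral_completion) measurable
  also have "\<dots> = kernel t ?f x" by (rule kernel_eq[OF t x f, symmetric])
  finally show ?thesis .
qed

end

text \<open>A substitute for Jensen's inequality with a worse constant, obtained from
  \<open>a \<le> \<lambda> + a\<^sup>r \<lambda>\<^sup>1\<^sup>-\<^sup>r\<close>.\<close>

lemma (in prob_space) abs_integral_powr_le:
  assumes [measurable]: "g \<in> borel_measurable M" and r: "1 \<le> (r::real)"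
  shows "ennreal (\<bar>\<integral>x. g x \<partial>M\<bar> powr r) \<le> ennreal (2 powr r) * (\<integral>\<^sup>+x. ennreal (\<bar>g x\<bar> powr r) \<partial>M)"
proof (cases "(\<integral>\<^sup>+x. ennreal (\<bar>g x\<bar> powr r) \<partial>M) = \<infinity>")
  case True
  then show ?thesis by (simp add: ennreal_mult_top)
next
  case False
  have int: "integrable M (\<lambda>x. \<bar>g x\<bar> powr r)"
    using False by (intro integrableI_nonneg) (auto simp: less_top)
  define J where "J = (\<integral>x. \<bar>g x\<bar> powr r \<partial>M)"
  have J0: "0 \<le> J" unfolding J_def by (intro integral_nonneg_AE) auto
  have J: "(\<integral>\<^sup>+x. ennreal (\<bar>g x\<bar> powr r) \<partial>M) = ennreal J"
    unfolding J_def by (rule nn_integral_eq_integral[OF int]) auto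
  have young: "a \<le> l + a powr r * l powr (1 - r)" if "0 \<le> a" "0 < l" for a l :: real
  proof (cases "a \<le> l")
    case False
    then have "a = a powr r * a powr (1 - r)" using that by (simp add: powr_add[symmetric])
    also have "\<dots> \<le> a powr r * l powr (1 - r)"
      using False that r by (intro mult_left_mono powr_mono2') auto
    finally show ?thesis using that by simp
  qed (simp add: add_increasing2)
  have g_le: "\<bar>\<integral>x. g x \<partial>M\<bar> \<le> l + J * l powr (1 - r)" if l: "0 < l" for l
  proof -
    have "(\<integral>x. \<bar>g x\<bar> \<partial>M) \<le> (\<integral>x. l + \<bar>g x\<bar> powr r * l powr (1 - r) \<partial>M)"
    proof (rule integral_mono_AE')
      show "integrable M (\<lambda>x. l + \<bar>g x\<bar> powr r * l powr (1 - r))" using int by simp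
      show "AE x in M. \<bar>g x\<bar> \<le> l + \<bar>g x\<bar> powr r * l powr (1 - r)"
        by (intro AE_I2 young l) auto
    qed (use l in \<open>auto intro!: AE_I2 add_nonneg_nonneg\<close>)
    also have "\<dots> = l + J * l powr (1 - r)" using int by (simp add: J_def prob_space)
    finally show ?thesis using integral_abs_bound[of M g] by linarith
  qed
  have "\<bar>\<integral>x. g x \<partial>M\<bar> \<le> 2 * J powr (1 / r)"
  proof (cases "J = 0")
    case True
    have "\<bar>\<integral>x. g x \<partial>M\<bar> \<le> 0"
      by (rule field_le_epsilon) (use g_le True in auto)
    then show ?thesis using True by simp
  next
    case False
    then have "0 < J" using J0 by simp
    \<comment> \<open>With \<open>l = J powr (1 / r)\<close> the two summands are equal, which gives
      the factor 2.\<close>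
    then have "\<bar>\<integral>x. g x \<partial>M\<bar> \<le> J powr (1 / r) + J * (J powr (1 / r)) powr (1 - r)" by (intro g_le) simp
    also have "J * (J powr (1 / r)) powr (1 - r) = J powr (1 + (1 / r) * (1 - r))"
      using \<open>0 < J\<close> by (simp add: powr_powr powr_add)
    also have "1 + (1 / r) * (1 - r) = 1 / r" using r by (simp add: field_simps)
    finally show ?thesis by simp
  qed
  then have "\<bar>\<integral>x. g x \<partial>M\<bar> powr r \<le> (2 * J powr (1 / r)) powr r"
    using r by (intro powr_mono2) auto
  also have "\<dots> = 2 powr r * J" using r J0 by (simp add: powr_mult powr_powr)
  finally have "ennreal (\<bar>\<integral>x. g x \<partial>M\<bar> powr r) \<le> ennreal (2 powr r * J)" by (rule ennreal_leI)
  then show ?thesis unfolding J by (simp add: ennreal_mult J0)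
qed

lemma convergent_subsequence_on_countable:
  fixes f :: "nat \<Rightarrow> 'b \<Rightarrow> real"
  assumes S: "countable S" and bd: "\<And>n x. \<bar>f n x\<bar> \<le> M"
  obtains r where "strict_mono r" "\<And>x. x \<in> S \<Longrightarrow> convergent (\<lambda>n. f (r n) x)"
proof (cases "S = {}")
  case True
  then show ?thesis using that[of id] by (simp add: strict_mono_id)
next
  case False
  let ?q = "from_nat_into S"
  let ?P = "\<lambda>n s. convergent (\<lambda>k. f (s k) (?q n))"
  interpret nat: subseqs ?P
  proof
    fix n :: nat and s :: "nat \<Rightarrow> nat"
    have "f (s k) (?q n) \<in> {-M..M}" for k using bd[of "s k" "?q n"] by (auto simp: abs_le_iff)
    then obtain l r where "strict_mono r" "((\<lambda>k. f (s k) (?q n)) \<circ> r) \<longlonglongrightarrow> l"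
      using compact_Icc compact_imp_seq_compact seq_compactE by metis
    then show "\<exists>r. strict_mono r \<and> convergent (\<lambda>k. f ((s \<circ> r) k) (?q n))"
      by (auto simp: comp_def convergent_def)
  qed
  have "convergent (\<lambda>k. f (nat.diagseq k) (?q n))" for n
  proof -
    have "convergent (\<lambda>k. f ((nat.diagseq \<circ> (+) (Suc n)) k) (?q n))"
    proof (rule nat.diagseq_holds)
      fix r s :: "nat \<Rightarrow> nat" and n assume "strict_mono r" "convergent (\<lambda>k. f (s k) (?q n))"
      then show "convergent (\<lambda>k. f ((s \<circ> r) k) (?q n))"
        using convergent_subseq_convergent[of "\<lambda>k. f (s k) (?q n)" r] by (simp add: comp_def)
    qed
    then have "convergent (\<lambda>k. f (nat.diagseq (k + Suc n)) (?q n))"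
      by (simp add: comp_def add.commute)
    then show ?thesis
      using convergent_ignore_initial_segment[of "\<lambda>k. f (nat.diagseq k) (?q n)" "Suc n"] by simp
  qed
  moreover have "\<exists>n. x = ?q n" if "x \<in> S" for x
    using from_nat_into_surj[OF S that] by metis
  ultimately show ?thesis using that[OF nat.subseq_diagseq] by metis
qed

lemma small_translate_diff:
  fixes p :: "'a::euclidean_space \<Rightarrow> real"
  assumes p: "integrable lborel p" and cont: "continuous_on UNIV p" and \<eta>: "0 < \<eta>"
  shows "\<exists>d>0. \<forall>h. norm h < d \<longrightarrow> (\<integral>\<^sup>+z. ennreal \<bar>p (h + z) - p z\<bar> \<partial>lborel) < ennreal \<eta>"
proof (rule ccontr)
  assume "\<not> ?thesis"
  then have "\<exists>h. norm h < 1 / Suc n \<and> \<not> (\<integral>\<^sup>+z. ennreal \<bar>p (h + z) - p z\<bar> \<partial>lborel) < ennreal \<eta>" for n :: nat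
    by (auto dest!: spec[of _ "1 / Suc n"])
  then obtain h where h: "\<And>n. norm (h n) < 1 / Suc n"
    and big: "\<And>n. \<not> (\<integral>\<^sup>+z. ennreal \<bar>p (h n + z) - p z\<bar> \<partial>lborel) < ennreal \<eta>" by metis
  have "h \<longlonglongrightarrow> 0"
  proof (rule Lim_null_comparison)
    show "\<forall>\<^sub>F n in sequentially. norm (h n) \<le> 1 / Suc n" by (intro always_eventually allI less_imp_le h)
    show "(\<lambda>n. 1 / real (Suc n)) \<longlonglongrightarrow> 0" by (rule LIMSEQ_Suc[OF lim_1_over_n])
  qed
  from nn_integral_translate_diff_tendsto[OF p cont this]
  have "\<forall>\<^sub>F n in sequentially. (\<integral>\<^sup>+z. ennreal \<bar>p (h n + z) - p z\<bar> \<partial>lborel) < ennreal \<eta>"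
    using \<eta> by (auto simp: order_tendsto_iff)
  then show False using big by (auto simp: eventually_sequentially)
qed

context killed_stable_process
begin

section \<open>Bounds from the transition density\<close>

definition dens_bound :: "real \<Rightarrow> real" where
  "dens_bound t = (\<integral>\<xi>. \<bar>char_fun t \<xi>\<bar> \<partial>lborel) / (2 * pi) ^ DIM('a)"

lemma dens_bound_nonneg: "0 \<le> dens_bound t"
  unfolding dens_bound_def by (intro divide_nonneg_pos integral_nonneg_AE) auto

lemma stable_density_le: "0 < t \<Longrightarrow> stable_density t z \<le> dens_bound t"
  using abs_inv_fourier_le[OF integrable_char_fun, of t z]
  by (simp add: stable_density_def dens_bound_def)

text \<open>For nonzero \<open>\<xi>\<close> the characteristic functions at the times
  \<open>Suc n\<close> are powers of a fixed number below 1, and \<open>char_fun 1\<close> dominates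
  them all.\<close>

lemma dens_bound_tendsto: "(\<lambda>n. dens_bound (real (Suc n))) \<longlonglongrightarrow> 0"
proof -
  have "(\<lambda>n. \<integral>\<xi>. \<bar>char_fun (real (Suc n)) \<xi>\<bar> \<partial>lborel) \<longlonglongrightarrow> (\<integral>\<xi>. 0 \<partial>(lborel :: 'a measure))"
  proof (rule integral_dominated_convergence[where w="char_fun 1"])
    show "integrable lborel (char_fun 1)" by (rule integrable_char_fun) simp
    show "AE \<xi> in lborel. (\<lambda>n. \<bar>char_fun (real (Suc n)) \<xi>\<bar>) \<longlonglongrightarrow> 0"
    proof -
      have "AE \<xi> in lborel. \<xi> \<noteq> (0::'a)" by (rule AE_lborel_singleton)
      then show ?thesis
      proof eventually_elim
        case (elim \<xi>)
        define q where "q = exp (- c * norm \<xi> powr \<alpha>)"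
        have "0 < c * norm \<xi> powr \<alpha>" using elim c_pos by simp
        then have q: "0 \<le> q" "q < 1" by (auto simp: q_def)
        have "char_fun (real (Suc n)) \<xi> = q ^ Suc n" for n
          by (simp add: char_fun_def q_def exp_of_nat_mult[symmetric] mult_ac del: of_nat_Suc power_Suc)
        moreover have "(\<lambda>n. q ^ Suc n) \<longlonglongrightarrow> 0" using LIMSEQ_Suc[OF LIMSEQ_realpow_zero[OF q]] .
        ultimately show ?case using q by (simp add: abs_mult del: power_Suc of_nat_Suc)
      qed
    qed
    show "AE \<xi> in lborel. norm \<bar>char_fun (real (Suc n)) \<xi>\<bar> \<le> char_fun 1 \<xi>" for n
      using c_pos by (intro AE_I2) (auto simp: char_fun_def mult_right_mono)
  qed (auto simp: char_fun_def[abs_def])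
  then have "(\<lambda>n. dens_bound (real (Suc n))) \<longlonglongrightarrow> (\<integral>\<xi>. 0 \<partial>(lborel :: 'a measure)) / (2 * pi) ^ DIM('a)"
    unfolding dens_bound_def by (intro tendsto_divide tendsto_const) auto
  then show ?thesis by simp
qed

lemma distr_path_component:
  assumes t: "0 < t"
  shows "distr path_law borel (\<lambda>w. w t) = density lborel (\<lambda>z. ennreal (stable_density t z))"
proof -
  have "distr path_law borel (\<lambda>w. w t) = distr (P 0) borel ((\<lambda>w. w t) \<circ> shift 0)"
    unfolding path_law_def using t by (intro distr_distr paths_component measurable_shift) auto
  also have "(\<lambda>w. w t) \<circ> shift 0 = (\<lambda>\<omega>. X t \<omega> - X 0 \<omega>)" using t by (auto simp: shift_def)
  finally show ?thesis using distr_increment_density[OF t] by simp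
qed

lemma integrable_stable_density: "0 < t \<Longrightarrow> integrable lborel (stable_density t)"
proof -
  assume t: "0 < t"
  interpret Q: prob_space "density lborel (\<lambda>z. ennreal (stable_density t z))"
    unfolding distr_path_component[OF t, symmetric]
    using t by (intro L.prob_space_distr) (simp add: sets_path_law cong: measurable_cong_sets)
  have "emeasure (density lborel (\<lambda>z. ennreal (stable_density t z))) UNIV = 1"
    using Q.emeasure_space_1 by simp
  then show ?thesis
    using measurable_stable_density[OF t] stable_density_nonneg[OF t]
    by (intro integrableI_nonneg) (auto simp: emeasure_density)
qed

lemma nn_integral_path_component:
  assumes t: "0 < t" and [measurable]: "h \<in> borel_measurable borel"
  shows "(\<integral>\<^sup>+w. h (x + w t) \<partial>path_law) = (\<integral>\<^sup>+z. ennreal (stable_density t z) * h (x + z) \<partial>lborel)"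
proof -
  note [measurable] = measurable_stable_density[OF t]
  note [simp] = less_imp_le[OF t]
  have "(\<integral>\<^sup>+w. h (x + w t) \<partial>path_law) = (\<integral>\<^sup>+z. h (x + z) \<partial>distr path_law borel (\<lambda>w. w t))"
    by (subst nn_integral_distr) auto
  also have "\<dots> = (\<integral>\<^sup>+z. ennreal (stable_density t z) * h (x + z) \<partial>lborel)"
    unfolding distr_path_component[OF t] by (subst nn_integral_density) auto
  finally show ?thesis .
qed

text \<open>The smoothing from L1 to a bound at every point. It is what later turns convergence of
  integrals into pointwise and uniform statements.\<close>

lemma nn_integral_path_component_le:
  assumes t: "0 < t" and [measurable]: "h \<in> borel_measurable borel"
  shows "(\<integral>\<^sup>+w. h (x + w t) \<partial>path_law) \<le> ennreal (dens_bound t) * (\<integral>\<^sup>+z. h z \<partial>lborel)"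
proof -
  have "(\<integral>\<^sup>+w. h (x + w t) \<partial>path_law) \<le> (\<integral>\<^sup>+z. ennreal (dens_bound t) * h (x + z) \<partial>lborel)"
    unfolding nn_integral_path_component[OF assms]
    by (intro nn_integral_mono mult_right_mono ennreal_leI stable_density_le t) auto
  also have "\<dots> = ennreal (dens_bound t) * (\<integral>\<^sup>+z. h (x + z) \<partial>lborel)"
    by (rule nn_integral_cmult) simp
  finally show ?thesis by (simp add: nn_integral_lborel_translate)
qed

lemma AE_path_component:
  assumes t: "0 < t" and ae: "AE z in lborel. Q z" and [measurable]: "Measurable.pred borel Q"
  shows "AE w in path_law. Q (x + w t)"
proof -
  let ?h = "\<lambda>z. if Q z then 0 else 1 :: ennreal"
  note [simp] = less_imp_le[OF t]
  have "(\<integral>\<^sup>+z. ?h z \<partial>lborel) = (\<integral>\<^sup>+z. 0 \<partial>(lborel :: 'a measure))"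
    using ae by (intro nn_integral_cong_AE) auto
  then have "(\<integral>\<^sup>+w. ?h (x + w t) \<partial>path_law) \<le> 0"
    using nn_integral_path_component_le[OF t, of ?h x] by simp
  then have "(\<integral>\<^sup>+w. ?h (x + w t) \<partial>path_law) = 0" by simp
  then have "AE w in path_law. ?h (x + w t) = 0"
    by (subst (asm) nn_integral_0_iff_AE) auto
  then show ?thesis by eventually_elim (simp split: if_splits)
qed

text \<open>Integrating over the starting point first removes the displacement \<open>w t\<close> by
  translation invariance. With \<open>g = 1\<close> this yields the L1 contraction; an indicator for
  \<open>g\<close> isolates large displacements.\<close>

lemma nn_integral_path_translate:
  assumes t: "0 \<le> t" and [measurable]: "h \<in> borel_measurable borel" "g \<in> borel_measurable paths"
  shows "(\<integral>\<^sup>+x. \<integral>\<^sup>+w. h (x + w t) * g w \<partial>path_law \<partial>lborel) = (\<integral>\<^sup>+x. h x \<partial>lborel) * (\<integral>\<^sup>+w. g w \<partial>path_law)"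
proof -
  interpret pair_sigma_finite lborel path_law ..
  note [simp] = t
  have "(\<integral>\<^sup>+x. \<integral>\<^sup>+w. h (x + w t) * g w \<partial>path_law \<partial>lborel) = (\<integral>\<^sup>+w. \<integral>\<^sup>+x. h (x + w t) * g w \<partial>lborel \<partial>path_law)"
    by (rule Fubini'[symmetric]) measurable
  also have "\<dots> = (\<integral>\<^sup>+w. (\<integral>\<^sup>+x. h x \<partial>lborel) * g w \<partial>path_law)"
  proof (intro nn_integral_cong)
    fix w
    have "(\<integral>\<^sup>+x. h (x + w t) * g w \<partial>lborel) = (\<integral>\<^sup>+x. h (w t + x) \<partial>lborel) * g w"
      by (simp add: nn_integral_multc add.commute)
    then show "(\<integral>\<^sup>+x. h (x + w t) * g w \<partial>lborel) = (\<integral>\<^sup>+x. h x \<partial>lborel) * g w"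
      by (simp add: nn_integral_lborel_translate)
  qed
  also have "\<dots> = (\<integral>\<^sup>+x. h x \<partial>lborel) * (\<integral>\<^sup>+w. g w \<partial>path_law)"
    by (rule nn_integral_cmult) simp
  finally show ?thesis .
qed

lemma nn_integral_X:
  assumes t: "0 \<le> t" and [measurable]: "h \<in> borel_measurable borel"
  shows "(\<integral>\<^sup>+\<omega>. h (X t \<omega>) \<partial>P x) = (\<integral>\<^sup>+w. h (x + w t) \<partial>path_law)"
proof -
  note [simp] = t
  have "(\<integral>\<^sup>+w. h (x + w t) \<partial>path_law) = (\<integral>\<^sup>+\<omega>. h (x + shift 0 \<omega> t) \<partial>P x)"
    by (subst distr_shift[of 0 x, symmetric]) (auto simp: nn_integral_distr)
  also have "\<dots> = (\<integral>\<^sup>+\<omega>. h (X t \<omega>) \<partial>P x)"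
    using start[of x] by (intro nn_integral_cong_AE) (auto simp: shift_def)
  finally show ?thesis ..
qed

lemma measurable_alive_section[measurable]:
  "0 \<le> t \<Longrightarrow> (\<lambda>w. indicator (alive_set t) (x, w) :: ennreal) \<in> borel_measurable paths"
  by measurable

lemma kernel_nn_mono: "(\<And>y. h y \<le> g y) \<Longrightarrow> kernel_nn t h x \<le> kernel_nn t g x"
  unfolding kernel_nn_def by (intro nn_integral_mono mult_right_mono) auto

lemma kernel_nn_le_free: "kernel_nn t h x \<le> (\<integral>\<^sup>+w. h (x + w t) \<partial>path_law)"
  unfolding kernel_nn_def by (intro nn_integral_mono) (auto simp: indicator_def)

lemma kernel_nn_cmult:
  assumes "0 \<le> t" and [measurable]: "h \<in> borel_measurable borel"
  shows "kernel_nn t (\<lambda>y. a * h y) x = a * kernel_nn t h x"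
  unfolding kernel_nn_def using assms(1) by (subst nn_integral_cmult[symmetric]) (auto simp: mult.assoc)

lemma kernel_nn_le:
  "0 < t \<Longrightarrow> h \<in> borel_measurable borel \<Longrightarrow> kernel_nn t h x \<le> ennreal (dens_bound t) * (\<integral>\<^sup>+z. h z \<partial>lborel)"
  using kernel_nn_le_free nn_integral_path_component_le by (rule order_trans)

lemma nn_integral_kernel_nn_le:
  assumes t: "0 \<le> t" and h: "h \<in> borel_measurable borel"
  shows "(\<integral>\<^sup>+x. kernel_nn t h x \<partial>lborel) \<le> (\<integral>\<^sup>+x. h x \<partial>lborel)"
proof -
  have "(\<integral>\<^sup>+x. kernel_nn t h x \<partial>lborel) \<le> (\<integral>\<^sup>+x. \<integral>\<^sup>+w. h (x + w t) * 1 \<partial>path_law \<partial>lborel)"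
    by (intro nn_integral_mono) (simp add: kernel_nn_le_free)
  also have "\<dots> = (\<integral>\<^sup>+x. h x \<partial>lborel) * (\<integral>\<^sup>+w. 1 \<partial>path_law)"
    by (rule nn_integral_path_translate[OF t h]) simp
  finally show ?thesis by (simp add: L.emeasure_space_1)
qed

lemma abs_kernel_le_nn:
  assumes t: "0 \<le> t" and [measurable]: "f \<in> borel_measurable borel"
  shows "ennreal \<bar>kernel t f x\<bar> \<le> kernel_nn t (\<lambda>y. ennreal \<bar>f y\<bar>) x"
\<comment> \<open>Without integrability the Bochner integral is 0 by convention, so the bound is
  trivial there.\<close>
proof (cases "integrable path_law (\<lambda>w. f (x + w t) * indicator (alive_set t) (x, w))")
  case True
  have "ennreal \<bar>kernel t f x\<bar> \<le> (\<integral>\<^sup>+w. ennreal (norm (f (x + w t) * indicator (alive_set t) (x, w))) \<partial>path_law)"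
    using integral_norm_bound_ennreal[OF True] by (simp add: kernel_def)
  also have "\<dots> = kernel_nn t (\<lambda>y. ennreal \<bar>f y\<bar>) x"
    unfolding kernel_nn_def by (intro nn_integral_cong) (auto simp: indicator_def)
  finally show ?thesis .
qed (simp add: kernel_def not_integrable_integral_eq)

lemma kernel_powr_le:
  assumes t: "0 \<le> t" and [measurable]: "f \<in> borel_measurable borel" and r: "1 \<le> r"
  shows "ennreal (\<bar>kernel t f x\<bar> powr r) \<le> ennreal (2 powr r) * kernel_nn t (\<lambda>y. ennreal (\<bar>f y\<bar> powr r)) x"
proof -
  note [simp] = t
  have "ennreal (\<bar>kernel t f x\<bar> powr r) \<le> ennreal (2 powr r) *
      (\<integral>\<^sup>+w. ennreal (\<bar>f (x + w t) * indicator (alive_set t) (x, w)\<bar> powr r) \<partial>path_law)"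
    unfolding kernel_def by (rule L.abs_integral_powr_le[OF _ r]) measurable
  also have "(\<integral>\<^sup>+w. ennreal (\<bar>f (x + w t) * indicator (alive_set t) (x, w)\<bar> powr r) \<partial>path_law)
      = kernel_nn t (\<lambda>y. ennreal (\<bar>f y\<bar> powr r)) x"
    unfolding kernel_nn_def using r by (intro nn_integral_cong) (auto simp: indicator_def)
  finally show ?thesis .
qed

lemma kernel_nn_one_le: "kernel_nn t (\<lambda>_. 1) x \<le> 1"
  using kernel_nn_le_free[of t "\<lambda>_. 1" x] by (simp add: L.emeasure_space_1)

lemma abs_kernel_le_survival:
  assumes t: "0 < t" and f: "f \<in> borel_measurable borel" and M: "\<And>y. \<bar>f y\<bar> \<le> M" and x: "x \<in> D"
  shows "\<bar>kernel t f x\<bar> \<le> M * survival t x"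
proof -
  have M0: "0 \<le> M" using M[of x] by simp
  have "ennreal \<bar>kernel t f x\<bar> \<le> kernel_nn t (\<lambda>y. ennreal \<bar>f y\<bar>) x"
    using t f by (intro abs_kernel_le_nn) auto
  also have "\<dots> \<le> kernel_nn t (\<lambda>y. ennreal M * 1) x"
    using M by (intro kernel_nn_mono) (auto intro: ennreal_leI)
  also have "\<dots> = ennreal (M * survival t x)"
    using t x M0 by (subst kernel_nn_cmult) (auto simp: survival_eq_kernel_nn ennreal_mult survival_def)
  finally show ?thesis using M0 by (simp add: survival_def)
qed

lemma abs_kernel_le:
  assumes t: "0 < t" and f: "f \<in> borel_measurable borel" and M: "\<And>y. \<bar>f y\<bar> \<le> M"
  shows "\<bar>kernel t f x\<bar> \<le> M"
proof (cases "x \<in> D")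
  case True
  have "M * survival t x \<le> M * 1" using M[of x] by (intro mult_left_mono) (auto simp: survival_def)
  then show ?thesis using abs_kernel_le_survival[OF t f M True] by simp
next
  case False
  then show ?thesis using M[of x] by (simp add: kernel_outside)
qed

lemma kernel_nn_semigroup:
  assumes "0 < s" "0 < t" "x \<in> D" "h \<in> borel_measurable borel"
  shows "kernel_nn (s + t) h x = kernel_nn s (kernel_nn t h) x"
  using assms by (simp add: kernel_nn_eq nn_integral_markov_killed measurable_kernel_nn)

lemma kernel_semigroup:
  assumes "0 < s" "0 < t" and x: "x \<in> D" and f: "f \<in> borel_measurable borel"
    and int: "integrable (P x) (\<lambda>\<omega>. f (X (s + t) \<omega>))"
  shows "kernel (s + t) f x = kernel s (kernel t f) x"
  using assms by (simp add: kernel_eq integral_markov_killed[OF _ _ f int] measurable_kernel)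

lemma integrable_X_of_powr:
  assumes t: "0 < t" and [measurable]: "f \<in> borel_measurable borel" and r: "1 \<le> r"
    and fin: "(\<integral>\<^sup>+z. ennreal (\<bar>f z\<bar> powr r) \<partial>lborel) < \<infinity>"
  shows "integrable (P x) (\<lambda>\<omega>. f (X t \<omega>))" "integrable path_law (\<lambda>w. f (x + w t))"
proof -
  note [simp] = less_imp_le[OF t]
  have "(\<integral>\<^sup>+w. ennreal (norm (f (x + w t))) \<partial>path_law) \<le> (\<integral>\<^sup>+w. 1 + ennreal (\<bar>f (x + w t)\<bar> powr r) \<partial>path_law)"
  proof (intro nn_integral_mono)
    fix w
    have "\<bar>a\<bar> \<le> 1 + \<bar>a\<bar> powr r" for a :: real
    proof (cases "\<bar>a\<bar> \<le> 1")
      case False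
      then have "\<bar>a\<bar> powr 1 \<le> \<bar>a\<bar> powr r" using r by (intro powr_mono) auto
      then show ?thesis using False by simp
    qed (simp add: add_increasing2)
    then show "ennreal (norm (f (x + w t))) \<le> 1 + ennreal (\<bar>f (x + w t)\<bar> powr r)"
      by (simp add: ennreal_1[symmetric] ennreal_plus[symmetric] del: ennreal_1 ennreal_plus)
  qed
  also have "\<dots> = 1 + (\<integral>\<^sup>+w. ennreal (\<bar>f (x + w t)\<bar> powr r) \<partial>path_law)"
    by (subst nn_integral_add) (auto simp: L.emeasure_space_1)
  also have "\<dots> \<le> 1 + ennreal (dens_bound t) * (\<integral>\<^sup>+z. ennreal (\<bar>f z\<bar> powr r) \<partial>lborel)"
    by (intro add_left_mono nn_integral_path_component_le[OF t, of "\<lambda>z. ennreal (\<bar>f z\<bar> powr r)"]) simp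
  also have "\<dots> < \<infinity>" using fin by (simp add: ennreal_mult_less_top)
  finally have *: "(\<integral>\<^sup>+w. ennreal (norm (f (x + w t))) \<partial>path_law) < \<infinity>" .
  show "integrable path_law (\<lambda>w. f (x + w t))"
    using * by (intro integrableI_bounded) auto
  show "integrable (P x) (\<lambda>\<omega>. f (X t \<omega>))"
    using * nn_integral_X[of t "\<lambda>y. ennreal (norm (f y))" x] by (intro integrableI_bounded) auto
qed

lemma integrable_X_bounded:
  fixes f :: "'a \<Rightarrow> real"
  assumes t: "0 < t" and [measurable]: "f \<in> borel_measurable borel" and "\<And>y. \<bar>f y\<bar> \<le> M"
  shows "integrable (P x) (\<lambda>\<omega>. f (X t \<omega>))" "integrable path_law (\<lambda>w. f (x + w t))"
  using t assms(3) by (auto intro!: P.integrable_const_bound[where B=M] L.integrable_const_bound[where B=M])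

lemma kernel_linear:
  assumes t: "0 < t" and [measurable]: "f \<in> borel_measurable borel" "g \<in> borel_measurable borel"
    and int: "integrable path_law (\<lambda>w. f (x + w t))" "integrable path_law (\<lambda>w. g (x + w t))"
  shows "kernel t (\<lambda>y. a * f y + b * g y) x = a * kernel t f x + b * kernel t g x"
proof -
  note [simp] = less_imp_le[OF t]
  have "integrable path_law (\<lambda>w. f (x + w t) * indicator (alive_set t) (x, w))"
    by (rule Bochner_Integration.integrable_bound[OF int(1)]) (auto simp: indicator_def)
  moreover have "integrable path_law (\<lambda>w. g (x + w t) * indicator (alive_set t) (x, w))"
    by (rule Bochner_Integration.integrable_bound[OF int(2)]) (auto simp: indicator_def)
  ultimately show ?thesis
    unfolding kernel_def by (subst (1 2) integral_mult_right_zero[symmetric], subst Bochner_Integration.integral_add[symmetric])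
      (auto simp: algebra_simps)
qed

text \<open>The displacement at a positive time has a density, so a Lebesgue null set is hit with
  probability 0 from every starting point.\<close>

lemma kernel_cong_AE:
  assumes t: "0 < t" and [measurable]: "f \<in> borel_measurable borel" "g \<in> borel_measurable borel"
    and ae: "AE z in lborel. f z = g z"
  shows "kernel t f x = kernel t g x"
proof -
  note [simp] = less_imp_le[OF t]
  have "AE w in path_law. f (x + w t) = g (x + w t)"
    by (rule AE_path_component[OF t ae]) measurable
  then show ?thesis
    unfolding kernel_def by (intro integral_cong_AE) auto
qed

end

section \<open>Tails and equicontinuity\<close>

context killed_stable_process
begin

lemma measurable_far_indicator[measurable]:
  assumes [simp]: "0 \<le> t"
  shows "(\<lambda>w. indicator {w. \<rho> < norm (w t)} w :: ennreal) \<in> borel_measurable paths"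
proof -
  have "(\<lambda>w. if \<rho> < norm (w t) then 1 else 0 :: ennreal) \<in> borel_measurable paths" by measurable
  then show ?thesis by (simp add: indicator_def)
qed

text \<open>Displacements above \<open>\<rho>\<close> are split off. The rest only sees the part
  \<open>k\<close> of \<open>h\<close> near \<open>x\<close>, and two half-steps treat it: the inner
  one is at most \<open>dens_bound s\<close> times the integral of \<open>k\<close>, the outer one
  then contributes the survival probability.\<close>

lemma kernel_nn_tail_pointwise:
  assumes s: "0 < s" and h[measurable]: "h \<in> borel_measurable borel" and \<delta>: "0 \<le> \<delta>"
    and surv: "x \<in> D \<Longrightarrow> survival s x \<le> \<delta>"
  shows "kernel_nn (s + s) h x \<le> (\<integral>\<^sup>+w. h (x + w (s + s)) * indicator {w. \<rho> < norm (w (s + s))} w \<partial>path_law)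
    + ennreal (dens_bound s * \<delta>) * (\<integral>\<^sup>+y. h y * indicator (cball x \<rho>) y \<partial>lborel)"
proof (cases "x \<in> D")
  case False
  then show ?thesis by (simp add: kernel_nn_outside)
next
  case True
  note [simp] = less_imp_le[OF s]
  define k where "k y = h y * indicator (cball x \<rho>) y" for y
  have [measurable]: "cball x \<rho> \<in> sets borel" by (intro borel_closed closed_cball)
  have k[measurable]: "k \<in> borel_measurable borel" unfolding k_def[abs_def] by measurable
  have m1: "(\<lambda>w. h (x + w (s + s)) * indicator {w. \<rho> < norm (w (s + s))} w) \<in> borel_measurable path_law"
    unfolding measurable_cong_sets[OF sets_path_law refl] by measurable
  have m2: "(\<lambda>w. k (x + w (s + s)) * indicator (alive_set (s + s)) (x, w)) \<in> borel_measurable path_law"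
    unfolding measurable_cong_sets[OF sets_path_law refl] by measurable
  let ?c = "ennreal (dens_bound s) * (\<integral>\<^sup>+y. k y \<partial>lborel)"
  have "kernel_nn (s + s) h x \<le> (\<integral>\<^sup>+w. h (x + w (s + s)) * indicator {w. \<rho> < norm (w (s + s))} w
      + k (x + w (s + s)) * indicator (alive_set (s + s)) (x, w) \<partial>path_law)"
    unfolding kernel_nn_def by (intro nn_integral_mono) (auto simp: indicator_def dist_norm k_def)
  also have "\<dots> = (\<integral>\<^sup>+w. h (x + w (s + s)) * indicator {w. \<rho> < norm (w (s + s))} w \<partial>path_law) + kernel_nn (s + s) k x"
    unfolding kernel_nn_def by (rule nn_integral_add[OF m1 m2])
  also have "kernel_nn (s + s) k x = kernel_nn s (kernel_nn s k) x"
    by (rule kernel_nn_semigroup[OF s s True k])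
  also have "\<dots> \<le> kernel_nn s (\<lambda>_. ?c * 1) x"
    by (intro kernel_nn_mono) (simp add: kernel_nn_le[OF s])
  also have "\<dots> = ?c * ennreal (survival s x)"
    by (subst kernel_nn_cmult) (auto simp: survival_eq_kernel_nn[OF s True])
  also have "\<dots> \<le> ?c * ennreal \<delta>"
    by (intro mult_left_mono ennreal_leI surv True) auto
  also have "\<dots> = ennreal (dens_bound s * \<delta>) * (\<integral>\<^sup>+y. k y \<partial>lborel)"
    using \<delta> by (simp add: ennreal_mult dens_bound_nonneg mult_ac)
  finally show ?thesis by (simp add: add_left_mono k_def)
qed

text \<open>Integration of the pointwise bound over \<open>x\<close>: the far part is handled by
  translation, and in the near part Fubini counts each \<open>y\<close> once for every centre
  \<open>x\<close> within \<open>\<rho>\<close>, hence the volume of a ball. The resulting factor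
  does not depend on \<open>h\<close>.\<close>

lemma nn_integral_kernel_nn_tail:
  assumes s: "0 < s" and h[measurable]: "h \<in> borel_measurable borel" and \<delta>: "0 \<le> \<delta>" and \<rho>: "0 \<le> \<rho>"
    and surv: "\<And>x. x \<in> D \<Longrightarrow> R < norm x \<Longrightarrow> survival s x \<le> \<delta>"
  shows "(\<integral>\<^sup>+x. kernel_nn (s + s) h x * indicator {x. R < norm x} x \<partial>lborel)
    \<le> (ennreal (L.prob {w\<in>space path_law. \<rho> < norm (w (s + s))}
        + dens_bound s * \<delta> * (unit_ball_vol (real DIM('a)) * \<rho> ^ DIM('a)))) * (\<integral>\<^sup>+x. h x \<partial>lborel)"
proof -
  note [simp] = less_imp_le[OF s]
  let ?g = "\<lambda>w. indicator {w. \<rho> < norm (w (s + s))} w :: ennreal"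
  let ?V = "unit_ball_vol (real DIM('a)) * \<rho> ^ DIM('a)"
  have g[measurable]: "?g \<in> borel_measurable paths" by (rule measurable_far_indicator) simp
  have [measurable]: "(\<lambda>(x, y). indicator (cball x \<rho>) y :: ennreal) \<in> borel_measurable (borel \<Otimes>\<^sub>M (borel :: 'a measure))"
  proof -
    have "(\<lambda>(x, y). if dist x y \<le> \<rho> then 1 else 0 :: ennreal) \<in> borel_measurable (borel \<Otimes>\<^sub>M (borel :: 'a measure))"
      by measurable
    then show ?thesis by (simp add: indicator_def case_prod_beta')
  qed
  have "(\<integral>\<^sup>+x. kernel_nn (s + s) h x * indicator {x. R < norm x} x \<partial>lborel)
    \<le> (\<integral>\<^sup>+x. (\<integral>\<^sup>+w. h (x + w (s + s)) * ?g w \<partial>path_law)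
      + ennreal (dens_bound s * \<delta>) * (\<integral>\<^sup>+y. h y * indicator (cball x \<rho>) y \<partial>lborel) \<partial>lborel)"
    by (intro nn_integral_mono) (use kernel_nn_tail_pointwise[OF s h \<delta>] surv in \<open>auto simp: indicator_def\<close>)
  also have "\<dots> = (\<integral>\<^sup>+x. \<integral>\<^sup>+w. h (x + w (s + s)) * ?g w \<partial>path_law \<partial>lborel)
      + ennreal (dens_bound s * \<delta>) * (\<integral>\<^sup>+x. \<integral>\<^sup>+y. h y * indicator (cball x \<rho>) y \<partial>lborel \<partial>lborel)"
    by (subst nn_integral_add) (auto intro!: nn_integral_cmult)
  also have "(\<integral>\<^sup>+x. \<integral>\<^sup>+w. h (x + w (s + s)) * ?g w \<partial>path_law \<partial>lborel) = (\<integral>\<^sup>+x. h x \<partial>lborel) * (\<integral>\<^sup>+w. ?g w \<partial>path_law)"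
    by (rule nn_integral_path_translate) auto
  also have "(\<integral>\<^sup>+w. ?g w \<partial>path_law) = ennreal (L.prob {w\<in>space path_law. \<rho> < norm (w (s + s))})"
  proof -
    have "(\<integral>\<^sup>+w. ?g w \<partial>path_law) = (\<integral>\<^sup>+w. indicator {w\<in>space path_law. \<rho> < norm (w (s + s))} w \<partial>path_law)"
      by (intro nn_integral_cong) (auto simp: indicator_def)
    then show ?thesis by (simp add: L.emeasure_eq_measure)
  qed
  also have "(\<integral>\<^sup>+x. \<integral>\<^sup>+y. h y * indicator (cball x \<rho>) y \<partial>lborel \<partial>lborel)
      = (\<integral>\<^sup>+y. \<integral>\<^sup>+x. h y * indicator (cball x \<rho>) y \<partial>lborel \<partial>lborel)"
    by (rule lborel_pair.Fubini') measurable
  also have "\<dots> = (\<integral>\<^sup>+y. h y * ennreal ?V \<partial>lborel)"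
  proof (intro nn_integral_cong)
    fix y
    have "(\<integral>\<^sup>+x. h y * indicator (cball x \<rho>) y \<partial>lborel) = (\<integral>\<^sup>+x. h y * indicator (cball y \<rho>) x \<partial>lborel)"
      by (intro nn_integral_cong) (auto simp: indicator_def dist_commute)
    also have "\<dots> = h y * ennreal ?V" using \<rho> by (simp add: nn_integral_cmult emeasure_cball)
    finally show "(\<integral>\<^sup>+x. h y * indicator (cball x \<rho>) y \<partial>lborel) = h y * ennreal ?V" .
  qed
  also have "\<dots> = (\<integral>\<^sup>+y. h y \<partial>lborel) * ennreal ?V" by (rule nn_integral_multc) simp
  finally show ?thesis
    using \<delta> \<rho> by (simp add: ennreal_plus ennreal_mult dens_bound_nonneg distrib_right distrib_left mult_ac)
qed

lemma path_component_tight: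
  assumes t: "0 \<le> t" and \<epsilon>: "0 < \<epsilon>"
  obtains \<rho> where "0 \<le> \<rho>" "L.prob {w\<in>space path_law. \<rho> < norm (w t)} < \<epsilon>"
proof -
  note [simp] = t
  let ?A = "\<lambda>n::nat. {w\<in>space path_law. real n < norm (w t)}"
  have "(\<lambda>n. L.prob (?A n)) \<longlonglongrightarrow> L.prob (\<Inter>n. ?A n)"
    by (rule L.finite_Lim_measure_decseq) (auto simp: decseq_def intro: le_less_trans[rotated])
  also have "(\<Inter>n. ?A n) = {}"
  proof -
    have "\<exists>n. \<not> real n < norm (w t)" for w :: "real \<Rightarrow> 'a"
      using real_arch_simple[of "norm (w t)"] by (auto simp: not_less)
    then show ?thesis by blast
  qed
  finally have "\<forall>\<^sub>F n in sequentially. L.prob (?A n) < \<epsilon>" using \<epsilon> by (auto simp: order_tendsto_iff)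
  then obtain n where "L.prob (?A n) < \<epsilon>" by (auto simp: eventually_sequentially)
  then show ?thesis by (intro that[of "real n"]) auto
qed

definition survival_vanishes :: bool where
  "survival_vanishes \<longleftrightarrow> (\<forall>t>0. \<forall>\<epsilon>>0. \<exists>R. \<forall>x. R < norm x \<longrightarrow> survival t x \<le> \<epsilon>)"

lemma kernel_nn_uniform_tail:
  assumes s: "0 < s" and sv: survival_vanishes and \<epsilon>: "0 < \<epsilon>"
  shows "\<exists>R. \<forall>h\<in>borel_measurable borel.
    (\<integral>\<^sup>+x. kernel_nn (s + s) h x * indicator {x. R < norm x} x \<partial>lborel) \<le> ennreal \<epsilon> * (\<integral>\<^sup>+x. h x \<partial>lborel)"
proof -
  obtain \<rho> where \<rho>: "0 \<le> \<rho>" "L.prob {w\<in>space path_law. \<rho> < norm (w (s + s))} < \<epsilon> / 2"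
    using path_component_tight[of "s + s" "\<epsilon> / 2"] s \<epsilon> by auto
  define K where "K = dens_bound s * (unit_ball_vol (real DIM('a)) * \<rho> ^ DIM('a))"
  have K: "0 \<le> K" using \<rho> by (simp add: K_def dens_bound_nonneg)
  \<comment> \<open>\<open>\<rho>\<close> is fixed first, by tightness; \<open>\<delta>\<close> then
    compensates the ball volume contained in \<open>K\<close>. The summand 1 covers
    \<open>K = 0\<close>.\<close>
  define \<delta> where "\<delta> = \<epsilon> / (2 * (K + 1))"
  have \<delta>: "0 < \<delta>" using K \<epsilon> by (simp add: \<delta>_def)
  have "K * \<delta> \<le> \<epsilon> / 2" using K \<epsilon> by (simp add: \<delta>_def field_simps)
  obtain R where R: "\<And>x. R < norm x \<Longrightarrow> survival s x \<le> \<delta>"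
    using sv s \<delta> unfolding survival_vanishes_def by blast
  have "(\<integral>\<^sup>+x. kernel_nn (s + s) h x * indicator {x. R < norm x} x \<partial>lborel) \<le> ennreal \<epsilon> * (\<integral>\<^sup>+x. h x \<partial>lborel)"
    if h: "h \<in> borel_measurable borel" for h
  proof -
    have "(\<integral>\<^sup>+x. kernel_nn (s + s) h x * indicator {x. R < norm x} x \<partial>lborel)
        \<le> ennreal (L.prob {w\<in>space path_law. \<rho> < norm (w (s + s))}
        + dens_bound s * \<delta> * (unit_ball_vol (real DIM('a)) * \<rho> ^ DIM('a))) * (\<integral>\<^sup>+x. h x \<partial>lborel)"
      by (rule nn_integral_kernel_nn_tail[OF s h less_imp_le[OF \<delta>] \<rho>(1) R])
    also have "\<dots> \<le> ennreal \<epsilon> * (\<integral>\<^sup>+x. h x \<partial>lborel)"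
      using \<rho>(2) \<open>K * \<delta> \<le> \<epsilon> / 2\<close> by (intro mult_right_mono ennreal_leI) (auto simp: K_def mult_ac)
    finally show ?thesis .
  qed
  then show ?thesis by blast
qed

section \<open>Comparison with the free semigroup and equicontinuity\<close>

definition free_kernel :: "real \<Rightarrow> ('a \<Rightarrow> real) \<Rightarrow> 'a \<Rightarrow> real" where
  "free_kernel t g x = (\<integral>w. g (x + w t) \<partial>path_law)"

lemma kernel_free_diff:
  assumes t: "0 < t" and g[measurable]: "g \<in> borel_measurable borel" and M: "\<And>y. \<bar>g y\<bar> \<le> M"
  shows "\<bar>kernel t g y - free_kernel t g y\<bar> \<le> M * L.prob {w\<in>space path_law. (y, w) \<notin> alive_set t}"
proof -
  note [simp] = less_imp_le[OF t]
  let ?N = "{w\<in>space path_law. (y, w) \<notin> alive_set t}"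
  have int: "integrable path_law (\<lambda>w. g (y + w t))" by (rule integrable_X_bounded[OF t g M])
  have "integrable path_law (\<lambda>w. g (y + w t) * indicator (alive_set t) (y, w))"
    by (rule Bochner_Integration.integrable_bound[OF int]) (auto simp: indicator_def)
  then have "kernel t g y - free_kernel t g y = (\<integral>w. g (y + w t) * indicator (alive_set t) (y, w) - g (y + w t) \<partial>path_law)"
    using int by (simp add: kernel_def free_kernel_def)
  also have "\<bar>\<dots>\<bar> \<le> (\<integral>w. M * indicator ?N w \<partial>path_law)"
  proof (rule order_trans[OF integral_abs_bound], rule integral_mono_AE')
    show "AE w in path_law. \<bar>g (y + w t) * indicator (alive_set t) (y, w) - g (y + w t)\<bar> \<le> M * indicator ?N w"
      using AE_space by eventually_elim (use M in \<open>auto simp: indicator_def\<close>)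
    show "integrable path_law (\<lambda>w. M * indicator ?N w)"
      by (intro integrable_mult_right integrable_real_indicator) (auto simp: L.emeasure_eq_measure)
  qed (use order_trans[OF abs_ge_zero M] in \<open>auto intro!: AE_I2 mult_nonneg_nonneg\<close>)
  also have "\<dots> = M * L.prob ?N" by simp
  finally show ?thesis .
qed

text \<open>A path from \<open>y\<close> whose displacements stay below \<open>r / 2\<close> remains
  in \<open>deep D m\<close>. The time \<open>1 / Suc (Suc j)\<close> is strictly below
  \<open>1 / Suc j\<close> because the grid is closed on the right while \<open>jump_set\<close>
  uses an open interval; being rational, it also makes the grid consist of rationals.\<close>

lemma exit_prob_le_jump:
  assumes r: "ball y r \<subseteq> D" and m: "1 / Suc m < r / 2"
  shows "L.prob {w\<in>space path_law. (y, w) \<notin> alive_set (1 / Suc (Suc j))} \<le> L.prob (jump_set m (1 / Suc j))"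
proof (rule L.finite_measure_mono_AE)
  let ?t = "1 / real (Suc (Suc j))"
  show "AE w in path_law. w \<in> {w\<in>space path_law. (y, w) \<notin> alive_set ?t} \<longrightarrow> w \<in> jump_set m (1 / Suc j)"
    using AE_path_start AE_space
  proof eventually_elim
    case (elim w)
    have w: "w \<in> space paths" using elim(2) by (simp add: space_path_law)
    show ?case
    proof (rule impI, rule ccontr)
      assume out: "w \<in> {w\<in>space path_law. (y, w) \<notin> alive_set ?t}" and "w \<notin> jump_set m (1 / Suc j)"
      then have small: "norm (w v) \<le> 1 / Suc m" if "v \<in> \<rat> \<inter> {0<..<1 / Suc j}" for v
        using that w by (auto simp: jump_set_def not_less)
      have small': "norm (w v) < r / 2" if v: "v \<in> rgrid 0 ?t" for v
      proof (cases "v = 0")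
        case True
        have "(0::real) < r / 2" by (rule less_trans[OF _ m]) simp
        then show ?thesis using True elim(1) by simp
      next
        case False
        have "v \<in> {0..?t}" using v rgrid_subset[of 0 ?t] by auto
        moreover have "?t < 1 / Suc j" by (simp add: frac_less2)
        moreover have "v \<in> \<rat>" using v by (auto simp: rgrid_def intro!: Rats_divide Rats_mult Rats_add)
        ultimately show ?thesis using small[of v] False m by auto
      qed
      have "y + w v \<in> deep D m" if v: "v \<in> rgrid 0 ?t" for v
        using small'[OF v] m by (intro mem_deep_near[OF r]) (auto simp: dist_norm)
      then have "(y, w) \<in> alive_set ?t"
        using w by (auto simp: alive_set_def space_pair_measure)
      then show False using out by simp
    qed
  qed
qed (simp add: sets_path_law)

lemma free_kernel_density:
  assumes t: "0 < t" and g[measurable]: "g \<in> borel_measurable borel"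
  shows "free_kernel t g x = (\<integral>z. stable_density t (- x + z) * g z \<partial>lborel)"
proof -
  note [measurable] = measurable_stable_density[OF t]
  note [simp] = less_imp_le[OF t]
  have "free_kernel t g x = (\<integral>z. g (x + z) \<partial>distr path_law borel (\<lambda>w. w t))"
    unfolding free_kernel_def by (subst integral_distr) auto
  also have "\<dots> = (\<integral>z. stable_density t z * g (x + z) \<partial>lborel)"
    unfolding distr_path_component[OF t]
    by (subst integral_density) (auto simp: stable_density_nonneg t)
  also have "\<dots> = (\<integral>z. stable_density t (- x + z) * g z \<partial>lborel)"
    by (subst (2) integral_lborel_affine[where c=1 and t=x]) auto
  finally show ?thesis .
qed

text \<open>After writing both values with the density, the bound is the sup norm of
  \<open>g\<close> times the L1 distance of two translates of the density, uniformly in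
  \<open>g\<close>.\<close>

lemma free_kernel_diff:
  assumes t: "0 < t" and g[measurable]: "g \<in> borel_measurable borel" and M: "\<And>y. \<bar>g y\<bar> \<le> M"
  shows "ennreal \<bar>free_kernel t g y - free_kernel t g x\<bar>
    \<le> ennreal M * (\<integral>\<^sup>+z. ennreal \<bar>stable_density t ((x - y) + z) - stable_density t z\<bar> \<partial>lborel)"
proof -
  let ?p = "stable_density t"
  note measurable_path_component[measurable del]
  note [measurable] = measurable_stable_density[OF t]
  have ip: "integrable lborel (\<lambda>z. ?p (- x + z))" for x
    using integrable_lborel_affine[OF integrable_stable_density[OF t], of 1 "- x"] by simp
  have int: "integrable lborel (\<lambda>z. ?p (- x + z) * g z)" for x
  proof (rule Bochner_Integration.integrable_bound)
    show "integrable lborel (\<lambda>z. ?p (- x + z) * M)" by (intro integrable_mult_left ip)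
    show "AE z in lborel. norm (?p (- x + z) * g z) \<le> norm (?p (- x + z) * M)"
      using M by (intro AE_I2) (auto simp: abs_mult intro!: mult_left_mono intro: order_trans[OF M abs_ge_self])
  qed measurable
  have "free_kernel t g y - free_kernel t g x = (\<integral>z. ?p (- y + z) * g z - ?p (- x + z) * g z \<partial>lborel)"
    using int by (simp add: free_kernel_density[OF t g])
  also have "ennreal \<bar>\<dots>\<bar> \<le> (\<integral>\<^sup>+z. ennreal (norm (?p (- y + z) * g z - ?p (- x + z) * g z)) \<partial>lborel)"
    using integral_norm_bound_ennreal[of lborel "\<lambda>z. ?p (- y + z) * g z - ?p (- x + z) * g z"] int by simp
  also have "\<dots> \<le> (\<integral>\<^sup>+z. ennreal M * ennreal \<bar>?p (- y + z) - ?p (- x + z)\<bar> \<partial>lborel)"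
  proof (intro nn_integral_mono)
    fix z
    have "norm (?p (- y + z) * g z - ?p (- x + z) * g z) \<le> M * \<bar>?p (- y + z) - ?p (- x + z)\<bar>"
      using mult_right_mono[OF M[of z] abs_ge_zero[of "?p (- y + z) - ?p (- x + z)"]]
      by (simp add: abs_mult[symmetric] algebra_simps)
    then show "ennreal (norm (?p (- y + z) * g z - ?p (- x + z) * g z)) \<le> ennreal M * ennreal \<bar>?p (- y + z) - ?p (- x + z)\<bar>"
      using order_trans[OF abs_ge_zero M] by (simp add: ennreal_mult[symmetric] ennreal_leI)
  qed
  also have "\<dots> = ennreal M * (\<integral>\<^sup>+z. ennreal \<bar>?p (- y + z) - ?p (- x + z)\<bar> \<partial>lborel)"
    by (rule nn_integral_cmult) measurable
  also have "(\<integral>\<^sup>+z. ennreal \<bar>?p (- y + z) - ?p (- x + z)\<bar> \<partial>lborel)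
      = (\<integral>\<^sup>+z. ennreal \<bar>?p (- y + (x + z)) - ?p (- x + (x + z))\<bar> \<partial>lborel)"
    by (rule nn_integral_lborel_translate[symmetric]) measurable
  also have "\<dots> = (\<integral>\<^sup>+z. ennreal \<bar>?p ((x - y) + z) - ?p z\<bar> \<partial>lborel)"
    by (simp add: algebra_simps)
  finally show ?thesis .
qed

lemma kernel_equicontinuous:
  assumes s: "0 < s" and x: "x \<in> D" and M: "0 \<le> M" and \<eta>: "0 < \<eta>"
  shows "\<exists>d>0. \<forall>f\<in>borel_measurable borel. (\<forall>y. \<bar>f y\<bar> \<le> M) \<longrightarrow>
    (\<forall>y. dist y x < d \<longrightarrow> \<bar>kernel s f y - kernel s f x\<bar> \<le> \<eta>)"
proof -
  obtain r0 where r0: "0 < r0" "ball x r0 \<subseteq> D" using open_D x open_contains_ball by blast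
  \<comment> \<open>Half the radius, so that every point within \<open>r\<close> of \<open>x\<close>
    has a ball of that same radius \<open>r\<close> inside \<open>D\<close>; the exit bound then
    holds uniformly near \<open>x\<close>.\<close>
  define r where "r = r0 / 2"
  have r: "0 < r" using r0 by (simp add: r_def)
  have ball: "ball y r \<subseteq> D" if "dist y x < r" for y
  proof -
    have "ball y r \<subseteq> ball x r0"
    proof
      fix z assume "z \<in> ball y r"
      then show "z \<in> ball x r0" using that dist_triangle[of x z y] by (simp add: r_def dist_commute)
    qed
    then show ?thesis using r0(2) by blast
  qed
  obtain m :: nat where m: "1 / Suc m < r / 2" using nat_approx_posE[of "r / 2"] r by auto
  \<comment> \<open>Three errors, each at most \<open>M * \<eta>'\<close>: ignoring the killing at
    \<open>y\<close> and at \<open>x\<close>, and moving the free kernel from \<open>x\<close> to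
    \<open>y\<close>. The summand 1 covers \<open>M = 0\<close>.\<close>
  define \<eta>' where "\<eta>' = \<eta> / (3 * (M + 1))"
  have \<eta>': "0 < \<eta>'" "M * \<eta>' \<le> \<eta> / 3" using \<eta> M by (auto simp: \<eta>'_def field_simps)
  have "\<forall>\<^sub>F j in sequentially. L.prob (jump_set m (1 / Suc j)) < \<eta>'"
    using path_law_jump_set_tendsto[of m] \<eta>' by (auto simp: order_tendsto_iff)
  moreover have "\<forall>\<^sub>F j in sequentially. 1 / real (Suc (Suc j)) < s"
    using LIMSEQ_Suc[OF LIMSEQ_Suc[OF lim_1_over_n[where 'a=real]]] s by (auto simp: order_tendsto_iff)
  ultimately have "\<forall>\<^sub>F j in sequentially. L.prob (jump_set m (1 / Suc j)) < \<eta>' \<and> 1 / real (Suc (Suc j)) < s"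
    by (rule eventually_conj)
  then obtain j where j: "L.prob (jump_set m (1 / Suc j)) < \<eta>'" "1 / real (Suc (Suc j)) < s"
    by (auto simp: eventually_sequentially)
  define \<epsilon> where "\<epsilon> = 1 / real (Suc (Suc j))"
  have \<epsilon>: "0 < \<epsilon>" "\<epsilon> < s" using j by (auto simp: \<epsilon>_def)
  obtain d where d: "0 < d" "\<And>h. norm h < d \<Longrightarrow>
      (\<integral>\<^sup>+z. ennreal \<bar>stable_density \<epsilon> (h + z) - stable_density \<epsilon> z\<bar> \<partial>lborel) < ennreal \<eta>'"
    using small_translate_diff[OF integrable_stable_density[OF \<epsilon>(1)] continuous_on_stable_density[OF \<epsilon>(1)] \<eta>'(1)] by blast
  show ?thesis
  proof (intro exI[of _ "min r d"] conjI ballI impI allI)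
    show "0 < min r d" using r d by simp
    fix f :: "'a \<Rightarrow> real" and y assume f: "f \<in> borel_measurable borel" and fM: "\<forall>y. \<bar>f y\<bar> \<le> M" and y: "dist y x < min r d"
    define g where "g = kernel (s - \<epsilon>) f"
    have g: "g \<in> borel_measurable borel" unfolding g_def using \<epsilon> by (intro measurable_kernel f) simp
    have gM: "\<bar>g z\<bar> \<le> M" for z
      unfolding g_def by (rule abs_kernel_le) (use \<epsilon> f fM in auto)
    have close: "\<bar>kernel s f z - free_kernel \<epsilon> g z\<bar> \<le> \<eta> / 3" if z: "dist z x < r" for z
    proof -
      have zD: "z \<in> D" using ball[OF z] r by auto
      have "kernel s f z = kernel \<epsilon> g z"
        using kernel_semigroup[of \<epsilon> "s - \<epsilon>" z f] \<epsilon> zD f fM s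
        by (simp add: g_def integrable_X_bounded(1)[where M=M])
      then have "\<bar>kernel s f z - free_kernel \<epsilon> g z\<bar> \<le> M * L.prob {w\<in>space path_law. (z, w) \<notin> alive_set \<epsilon>}"
        using kernel_free_diff[OF \<epsilon>(1) g gM] by simp
      also have "\<dots> \<le> M * \<eta>'"
        using exit_prob_le_jump[OF ball[OF z] m, of j] j(1) M by (intro mult_left_mono) (auto simp: \<epsilon>_def)
      finally show ?thesis using \<eta>' by simp
    qed
    have "ennreal \<bar>free_kernel \<epsilon> g y - free_kernel \<epsilon> g x\<bar> \<le> ennreal M * ennreal \<eta>'"
      using d(2)[of "x - y"] y
      by (intro order_trans[OF free_kernel_diff[OF \<epsilon>(1) g gM]] mult_left_mono) (auto simp: dist_norm norm_minus_commute)
    also have "\<dots> = ennreal (M * \<eta>')" using M \<eta>' by (simp add: ennreal_mult)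
    finally have "\<bar>free_kernel \<epsilon> g y - free_kernel \<epsilon> g x\<bar> \<le> \<eta> / 3"
      using M \<eta>' by (simp add: ennreal_le_iff)
    moreover have "\<bar>kernel s f y - free_kernel \<epsilon> g y\<bar> \<le> \<eta> / 3" using close[of y] y by simp
    moreover have "\<bar>kernel s f x - free_kernel \<epsilon> g x\<bar> \<le> \<eta> / 3" using close[of x] r by simp
    ultimately show "\<bar>kernel s f y - kernel s f x\<bar> \<le> \<eta>" by linarith
  qed
qed

text \<open>Arzela-Ascoli in pointwise form: convergence on a countable dense set spreads to every
  point of \<open>D\<close> by equicontinuity there, and outside \<open>D\<close> the kernel is
  0.\<close>

lemma kernel_convergent_subsequence:
  assumes s: "0 < s" and F: "\<And>n. F n \<in> borel_measurable borel" and M: "\<And>n y. \<bar>F n y\<bar> \<le> M"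
  shows "\<exists>r :: nat \<Rightarrow> nat. strict_mono r \<and> (\<forall>x. convergent (\<lambda>n. kernel s (F (r n)) x))"
proof -
  have M0: "0 \<le> M" using order_trans[OF abs_ge_zero M] .
  obtain Q :: "'a set" where Q: "countable Q" "\<And>U. open U \<Longrightarrow> U \<noteq> {} \<Longrightarrow> \<exists>d\<in>Q. d \<in> U"
    using countable_dense_setE by blast
  obtain r where r: "strict_mono r" "\<And>q. q \<in> Q \<Longrightarrow> convergent (\<lambda>n. kernel s (F (r n)) q)"
    using convergent_subsequence_on_countable[OF Q(1), of "\<lambda>n. kernel s (F n)" M] abs_kernel_le[OF s F M] by metis
  have "convergent (\<lambda>n. kernel s (F (r n)) x)" for x
  proof (cases "x \<in> D")
    case False
    then show ?thesis by (simp add: kernel_outside convergent_const)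
  next
    case True
    have "Cauchy (\<lambda>n. kernel s (F (r n)) x)"
    proof (rule metric_CauchyI)
      fix e :: real assume e: "0 < e"
      have "0 < e / 4" using e by simp
      from kernel_equicontinuous[OF s True M0 this]
      obtain d where d: "0 < d" "\<forall>f\<in>borel_measurable borel. (\<forall>y. \<bar>f y\<bar> \<le> M) \<longrightarrow>
          (\<forall>y. dist y x < d \<longrightarrow> \<bar>kernel s f y - kernel s f x\<bar> \<le> e / 4)"
        by (elim exE conjE)
      obtain q where q: "q \<in> Q" "dist q x < d" using Q(2)[of "ball x d"] d(1) by (auto simp: dist_commute)
      have near: "\<bar>kernel s (F n) q - kernel s (F n) x\<bar> \<le> e / 4" for n
        using d(2)[rule_format, of "F n" q] F M q by simp
      have "Cauchy (\<lambda>n. kernel s (F (r n)) q)" using r(2)[OF q(1)] by (rule convergent_Cauchy)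
      from metric_CauchyD[OF this, of "e / 4"] e obtain N where N: "\<And>m n. m \<ge> N \<Longrightarrow> n \<ge> N \<Longrightarrow> dist (kernel s (F (r m)) q) (kernel s (F (r n)) q) < e / 4"
        by auto
      show "\<exists>N. \<forall>m\<ge>N. \<forall>n\<ge>N. dist (kernel s (F (r m)) x) (kernel s (F (r n)) x) < e"
      proof (intro exI[of _ N] allI impI)
        fix m n assume "N \<le> m" "N \<le> n"
        then have "\<bar>kernel s (F (r m)) q - kernel s (F (r n)) q\<bar> < e / 4"
          using N[of m n] by (simp add: dist_real_def)
        then show "dist (kernel s (F (r m)) x) (kernel s (F (r n)) x) < e"
          unfolding dist_real_def using near[of "r m"] near[of "r n"] by linarith
      qed
    qed
    then show ?thesis by (rule Cauchy_convergent)
  qed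
  with r(1) show ?thesis by (intro exI[of _ r] conjI allI)
qed

end

section \<open>Mean exit times and the resolvent\<close>

text \<open>Every time step of length \<open>T\<close> that begins after \<open>\<delta>\<close> and
  before \<open>e\<close> contributes \<open>T\<close>; together these steps cover what
  \<open>e\<close> has beyond \<open>\<delta>\<close>, also when \<open>e\<close> is
  infinite.\<close>

lemma ennreal_le_grid_sum:
  fixes e :: ennreal
  assumes \<delta>: "0 \<le> \<delta>" and T: "0 < T"
  shows "e \<le> ennreal \<delta> + (\<Sum>n. ennreal T * (if ennreal (\<delta> + real n * T) < e then 1 else 0))"
proof (rule ccontr)
  let ?f = "\<lambda>n. ennreal T * (if ennreal (\<delta> + real n * T) < e then 1 else 0)"
  assume "\<not> ?thesis"
  then have less: "ennreal \<delta> + suminf ?f < e" by simp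
  \<comment> \<open>Truncation at a grid point makes the induction work for infinite
    \<open>e\<close>; a large \<open>N\<close> then contradicts \<open>less\<close>.\<close>
  have part: "min e (ennreal (\<delta> + real N * T)) \<le> ennreal \<delta> + (\<Sum>n<N. ?f n)" for N
  proof (induction N)
    case (Suc N)
    have eq: "ennreal (\<delta> + real (Suc N) * T) = ennreal (\<delta> + real N * T) + ennreal T"
      using \<delta> T by (simp add: ennreal_plus[symmetric] algebra_simps del: ennreal_plus)
    have "min e (ennreal (\<delta> + real (Suc N) * T)) \<le> min e (ennreal (\<delta> + real N * T)) + ?f N"
      unfolding eq by (auto simp: min_def not_less intro: order_trans)
    also have "\<dots> \<le> (ennreal \<delta> + (\<Sum>n<N. ?f n)) + ?f N" by (rule add_right_mono[OF Suc])
    finally show ?case by (simp only: sum.lessThan_Suc add.assoc)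
  qed simp
  have "ennreal \<delta> + suminf ?f < \<infinity>" using less by (rule order_less_le_trans) simp
  then obtain b where b: "ennreal \<delta> + suminf ?f = ennreal b" "0 \<le> b"
    by (cases "ennreal \<delta> + suminf ?f") auto
  obtain N :: nat where N: "b < real N * T" using ex_less_of_nat_mult[OF T] by auto
  have "ennreal b < ennreal (\<delta> + real N * T)" using N \<delta> b by (intro ennreal_lessI) auto
  then have "ennreal \<delta> + suminf ?f < min e (ennreal (\<delta> + real N * T))"
    using less unfolding b(1) by (simp only: min_less_iff_conj)
  also have "\<dots> \<le> ennreal \<delta> + (\<Sum>n<N. ?f n)" by (rule part)
  also have "\<dots> \<le> ennreal \<delta> + suminf ?f" by (intro add_left_mono sum_le_suminf) auto
  finally show False by simp
qed

context killed_stable_process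
begin

lemma survival_vanishesD:
  "survival_vanishes \<Longrightarrow> 0 < t \<Longrightarrow> 0 < \<epsilon> \<Longrightarrow> \<exists>R. \<forall>x. R < norm x \<longrightarrow> survival t x \<le> \<epsilon>"
  by (simp add: survival_vanishes_def)

lemma survival_bounds: "0 \<le> survival t x" "survival t x \<le> 1"
  by (auto simp: survival_def)

lemma survival_le_mean_exit_time:
  assumes t: "0 < t"
  shows "ennreal (t * survival t x) \<le> mean_exit_time P X D x"
proof -
  have "ennreal (t * survival t x) = (\<integral>\<^sup>+\<omega>. ennreal t * indicator (past_alive t) (past t \<omega>) \<partial>P x)"
    using t by (simp add: ennreal_mult survival_bounds nn_integral_past_alive nn_integral_cmult)
  also have "\<dots> \<le> (\<integral>\<^sup>+\<omega>. exit_time X D \<omega> \<partial>P x)"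
  proof (rule nn_integral_mono_AE)
    show "AE \<omega> in P x. ennreal t * indicator (past_alive t) (past t \<omega>) \<le> exit_time X D \<omega>"
      using AE_less_exit_time_iff[OF t, of x]
      by eventually_elim (auto simp: indicator_def intro: less_imp_le)
  qed
  finally show ?thesis by (simp add: mean_exit_time_def nn_integral_completion)
qed

lemma survival_vanishes_of_mean_exit_time:
  assumes lim: "(mean_exit_time P X D \<longlongrightarrow> 0) at_infinity"
  shows survival_vanishes
  unfolding survival_vanishes_def
proof (intro allI impI)
  fix t \<epsilon> :: real assume t: "0 < t" and \<epsilon>: "0 < \<epsilon>"
  then have "\<forall>\<^sub>F x in at_infinity. mean_exit_time P X D x < ennreal (t * \<epsilon>)"
    using lim by (auto simp: order_tendsto_iff)
  then obtain R where R: "\<And>x. R \<le> norm x \<Longrightarrow> mean_exit_time P X D x < ennreal (t * \<epsilon>)"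
    by (auto simp: eventually_at_infinity)
  show "\<exists>R. \<forall>x. R < norm x \<longrightarrow> survival t x \<le> \<epsilon>"
  proof (intro exI allI impI)
    fix x :: 'a assume "R < norm x"
    then have "ennreal (t * survival t x) < ennreal (t * \<epsilon>)"
      using survival_le_mean_exit_time[OF t, of x] R[of x] by (auto intro: le_less_trans)
    then show "survival t x \<le> \<epsilon>" using t by (auto simp: ennreal_less_iff survival_bounds)
  qed
qed

lemma ennreal_survival_add:
  assumes "0 < s" "0 < t"
  shows "ennreal (survival (s + t) x) = (\<integral>\<^sup>+\<omega>. kernel_nn t (\<lambda>_. 1) (X s \<omega>) * indicator (past_alive s) (past s \<omega>) \<partial>P x)"
  using nn_integral_markov_killed[OF assms, of "\<lambda>_. 1" x] by (simp add: nn_integral_past_alive)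

text \<open>Vanishing at infinity says nothing on a bounded set; there the decay of the density
  helps. At a late time \<open>s\<close> the ball of radius \<open>R\<close> carries probability at
  most 1/2. From outside the ball one more unit of time is survived with probability at most 1/2,
  from inside at most 1: in total 1/2 + 1/2 * 1/2 = 3/4.\<close>

lemma survival_uniform_bound:
  assumes sv: survival_vanishes
  shows "\<exists>T>0. \<forall>x. survival T x \<le> 3 / 4"
proof -
  obtain R0 where R0: "\<And>x. R0 < norm x \<Longrightarrow> survival 1 x \<le> 1 / 2"
    using survival_vanishesD[OF sv zero_less_one, of "1 / 2"] by auto
  define R where "R = max R0 0"
  have R: "0 \<le> R" "\<And>x. R < norm x \<Longrightarrow> survival 1 x \<le> 1 / 2" using R0 by (auto simp: R_def)
  let ?V = "unit_ball_vol (real DIM('a)) * R ^ DIM('a)"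
  have "(\<lambda>n. dens_bound (real (Suc n)) * ?V) \<longlonglongrightarrow> 0 * ?V"
    by (intro tendsto_mult dens_bound_tendsto tendsto_const)
  then have "\<forall>\<^sub>F n in sequentially. dens_bound (real (Suc n)) * ?V < 1 / 2"
    by (rule order_tendstoD(2)) simp
  then obtain n where n: "dens_bound (real (Suc n)) * ?V < 1 / 2"
    unfolding eventually_sequentially by blast
  define s where "s = real (Suc n)"
  have s: "0 < s" by (simp add: s_def)
  have [measurable]: "X s \<in> borel_measurable (P x)" for x using s by simp
  have [measurable]: "cball (0::'a) R \<in> sets borel" by (intro borel_closed closed_cball)
  define b :: real where "b = 1 / 2"
  have b: "0 \<le> b" "b + b = 1" "b + b * b = 3 / 4" by (simp_all add: b_def)
  have half: "ennreal b + ennreal b = 1"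
    using b by (simp add: ennreal_plus[symmetric] del: ennreal_plus)
  have "survival (s + 1) x \<le> 3 / 4" for x
  proof -
    have pt: "kernel_nn 1 (\<lambda>_. 1) y \<le> ennreal b + ennreal b * indicator (cball 0 R) y" for y
    proof (cases "y \<in> cball 0 R")
      case True
      then show ?thesis using kernel_nn_one_le[of 1 y] by (simp only: indicator_simps half mult_1_right)
    next
      case False
      then have "survival 1 y \<le> b" using R by (simp add: b_def)
      then show ?thesis
        using False survival_eq_kernel_nn[of 1 y] by (cases "y \<in> D") (auto simp: kernel_nn_outside intro: ennreal_leI)
    qed
    have "(\<integral>\<^sup>+\<omega>. indicator (cball 0 R) (X s \<omega>) \<partial>P x) = (\<integral>\<^sup>+w. indicator (cball 0 R) (x + w s) \<partial>path_law)"
      using s by (intro nn_integral_X) auto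
    also have "\<dots> \<le> ennreal (dens_bound s) * (\<integral>\<^sup>+z. indicator (cball 0 R) z \<partial>(lborel :: 'a measure))"
      using s by (intro nn_integral_path_component_le) auto
    also have "\<dots> = ennreal (dens_bound s * ?V)"
      using R by (simp add: emeasure_cball ennreal_mult dens_bound_nonneg)
    also have "\<dots> \<le> ennreal b" using n by (intro ennreal_leI) (simp add: s_def b_def)
    finally have small: "(\<integral>\<^sup>+\<omega>. indicator (cball 0 R) (X s \<omega>) \<partial>P x) \<le> ennreal b" .
    have "ennreal (survival (s + 1) x) \<le> (\<integral>\<^sup>+\<omega>. ennreal b + ennreal b * indicator (cball 0 R) (X s \<omega>) \<partial>P x)"
      unfolding ennreal_survival_add[OF s zero_less_one]
      by (intro nn_integral_mono order_trans[OF mult_left_mono[of _ 1] order_trans[OF _ pt]]) (auto simp: indicator_def)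
    also have "\<dots> = ennreal b + ennreal b * (\<integral>\<^sup>+\<omega>. indicator (cball 0 R) (X s \<omega>) \<partial>P x)"
      by (subst nn_integral_add) (auto simp: nn_integral_cmult P.emeasure_space_1)
    also have "\<dots> \<le> ennreal b + ennreal b * ennreal b"
      by (intro add_left_mono mult_left_mono small) auto
    also have "\<dots> = ennreal (3 / 4)"
      using b(1) by (simp only: ennreal_mult[symmetric] ennreal_plus[symmetric] b(3)[symmetric] mult_nonneg_nonneg)
    finally show ?thesis by simp
  qed
  then show ?thesis using s by (intro exI[of _ "s + 1"]) auto
qed

lemma survival_geometric:
  assumes T: "0 < T" and q: "0 \<le> q" "\<And>x. survival T x \<le> q" and \<delta>: "0 < \<delta>"
  shows "survival (\<delta> + real n * T) x \<le> q ^ n * survival \<delta> x"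
proof (induction n)
  case (Suc n)
  let ?s = "\<delta> + real n * T"
  have s: "0 < ?s" using \<delta> T by (simp add: add_pos_nonneg)
  have pt: "kernel_nn T (\<lambda>_. 1) y \<le> ennreal q" for y
    using survival_eq_kernel_nn[OF T, of y] q(2)[of y]
    by (cases "y \<in> D") (auto simp: kernel_nn_outside intro: ennreal_leI)
  have "ennreal (survival (?s + T) x) \<le> (\<integral>\<^sup>+\<omega>. ennreal q * indicator (past_alive ?s) (past ?s \<omega>) \<partial>P x)"
    unfolding ennreal_survival_add[OF s T] by (intro nn_integral_mono mult_right_mono pt) auto
  also have "\<dots> = ennreal (q * survival ?s x)"
    using q(1) by (simp add: nn_integral_cmult nn_integral_past_alive ennreal_mult survival_bounds)
  finally have "survival (?s + T) x \<le> q * survival ?s x"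
    using q(1) by (simp add: survival_bounds)
  also have "\<dots> \<le> q * (q ^ n * survival \<delta> x)" by (rule mult_left_mono[OF Suc q(1)])
  finally show ?case by (simp add: algebra_simps)
qed simp

text \<open>Sampling at the times \<open>\<delta> + real n * T\<close> keeps the factor
  \<open>survival \<delta> x\<close> in every term of the geometric series, so smallness at the
  single time \<open>\<delta>\<close> controls the whole expectation.\<close>

lemma mean_exit_time_le:
  assumes T: "0 < T" and q: "0 \<le> q" "q < 1" "\<And>x. survival T x \<le> q" and \<delta>: "0 < \<delta>"
  shows "mean_exit_time P X D x \<le> ennreal (\<delta> + T / (1 - q) * survival \<delta> x)"
proof -
  let ?t = "\<lambda>n. \<delta> + real n * T"
  have t: "0 < ?t n" for n using \<delta> T by (simp add: add_pos_nonneg)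
  have "AE \<omega> in P x. \<forall>n. ennreal (?t n) < exit_time X D \<omega> \<longleftrightarrow> past (?t n) \<omega> \<in> past_alive (?t n)"
    unfolding AE_all_countable using AE_less_exit_time_iff[OF t] by blast
  then have "AE \<omega> in P x. exit_time X D \<omega>
      \<le> ennreal \<delta> + (\<Sum>n. ennreal T * indicator (past_alive (?t n)) (past (?t n) \<omega>))"
  proof eventually_elim
    case (elim \<omega>)
    have "ennreal T * indicator (past_alive (?t n)) (past (?t n) \<omega>)
        = ennreal T * (if ennreal (?t n) < exit_time X D \<omega> then 1 else 0)" for n
      using elim by (simp add: indicator_def)
    then show ?case using ennreal_le_grid_sum[of \<delta> T "exit_time X D \<omega>"] \<delta> T by simp
  qed
  then have "mean_exit_time P X D x
      \<le> (\<integral>\<^sup>+\<omega>. ennreal \<delta> + (\<Sum>n. ennreal T * indicator (past_alive (?t n)) (past (?t n) \<omega>)) \<partial>P x)"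
    unfolding mean_exit_time_def nn_integral_completion by (rule nn_integral_mono_AE)
  also have "\<dots> = ennreal \<delta> + (\<Sum>n. ennreal (T * survival (?t n) x))"
    using T by (subst nn_integral_add)
      (auto simp: nn_integral_suminf nn_integral_cmult nn_integral_past_alive P.emeasure_space_1 ennreal_mult survival_bounds)
  also have "\<dots> \<le> ennreal \<delta> + (\<Sum>n. ennreal (T * survival \<delta> x * q ^ n))"
  proof (intro add_left_mono suminf_le)
    show "ennreal (T * survival (?t n) x) \<le> ennreal (T * survival \<delta> x * q ^ n)" for n
      using survival_geometric[OF T q(1,3) \<delta>, of n x] T
      by (intro ennreal_leI) (simp add: mult.assoc mult.commute[of "survival \<delta> x"])
  qed auto
  also have "(\<Sum>n. ennreal (T * survival \<delta> x * q ^ n)) = ennreal (T * survival \<delta> x * (1 / (1 - q)))"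
    using T q by (intro suminf_ennreal_eq sums_mult geometric_sums) (auto simp: survival_bounds)
  also have "ennreal \<delta> + \<dots> = ennreal (\<delta> + T / (1 - q) * survival \<delta> x)"
    using \<delta> T q by (subst ennreal_plus[symmetric]) (auto simp: survival_bounds)
  finally show ?thesis .
qed

lemma mean_exit_time_of_survival_vanishes:
  assumes sv: survival_vanishes
  shows "(mean_exit_time P X D \<longlongrightarrow> 0) at_infinity"
proof (rule order_tendstoI)
  fix a :: ennreal assume a: "0 < a"
  then obtain \<epsilon> where \<epsilon>: "0 < \<epsilon>" "ennreal \<epsilon> \<le> a"
  proof (cases a)
    case (real r)
    then show ?thesis using a that[of r] by auto
  qed (use that[of 1] in auto)
  obtain T where T: "0 < T" "\<And>x. survival T x \<le> 3 / 4" using survival_uniform_bound[OF sv] by blast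
  define \<delta> where "\<delta> = \<epsilon> / 2"
  have \<delta>: "0 < \<delta>" using \<epsilon> by (simp add: \<delta>_def)
  \<comment> \<open>For \<open>q = 3 / 4\<close> the factor in \<open>mean_exit_time_le\<close> is
    \<open>4 * T\<close>, so this choice contributes \<open>\<epsilon> / 4\<close>, next to
    \<open>\<delta> = \<epsilon> / 2\<close>.\<close>
  have "0 < \<epsilon> / (16 * T)" using \<epsilon> T by simp
  from survival_vanishesD[OF sv \<delta> this]
  obtain R where R: "\<forall>x. R < norm x \<longrightarrow> survival \<delta> x \<le> \<epsilon> / (16 * T)" ..
  have "mean_exit_time P X D x < a" if "R + 1 \<le> norm x" for x
  proof -
    have "4 * T * survival \<delta> x \<le> 4 * T * (\<epsilon> / (16 * T))"
      using R that T by (intro mult_left_mono) auto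
    then have "\<delta> + T / (1 - 3 / 4) * survival \<delta> x \<le> \<epsilon> / 2 + \<epsilon> / 4" using T by (simp add: \<delta>_def)
    then have "ennreal (\<delta> + T / (1 - 3 / 4) * survival \<delta> x) < ennreal \<epsilon>"
      using \<epsilon> by (intro ennreal_lessI) auto
    then show ?thesis
      using mean_exit_time_le[OF T(1) _ _ T(2) \<delta>, of x] \<epsilon>(2) by (auto intro: le_less_trans less_le_trans)
  qed
  then show "\<forall>\<^sub>F x in at_infinity. mean_exit_time P X D x < a"
    unfolding eventually_at_infinity by blast
qed simp

definition resolvent :: "'a \<Rightarrow> real" where
  "resolvent x = (LBINT t:{0..}. exp (- t) * survival_prob P X D t x)"

lemma integrable_exp_minus: "integrable lborel (\<lambda>t. indicator {0..} t * exp (- t) :: real)"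
  and integral_exp_minus: "(\<integral>t. indicator {0..} t * exp (- t) \<partial>lborel) = (1::real)"
proof -
  have "(\<integral>\<^sup>+t. ennreal (indicator {0..} t * exp (- t)) \<partial>lborel) = ennreal 1"
    using nn_intergal_power_times_exp_Ici[of 0]
    by (simp add: ennreal_indicator[symmetric] ennreal_mult[symmetric] mult.commute)
  then have "has_bochner_integral lborel (\<lambda>t. indicator {0..} t * exp (- t) :: real) 1"
    by (intro has_bochner_integral_nn_integral) auto
  then show "integrable lborel (\<lambda>t. indicator {0..} t * exp (- t) :: real)"
    "(\<integral>t. indicator {0..} t * exp (- t) \<partial>lborel) = (1::real)"
    by (auto simp: has_bochner_integral_iff)
qed

text \<open>The integral is split at \<open>\<delta>\<close>. For the upper bound the integrand is
  at most 1 before \<open>\<delta>\<close>, and survival is at most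
  \<open>survival \<delta> x\<close> afterwards; for the lower bound only the part before
  \<open>\<delta>\<close> is kept.\<close>

lemma resolvent_bounds:
  assumes \<delta>: "0 < \<delta>"
  shows "resolvent x \<le> \<delta> + survival \<delta> x" and "\<delta> * exp (- \<delta>) * survival \<delta> x \<le> resolvent x"
proof -
  \<comment> \<open>The value 1 on the left gives an antitone function on the whole line, which is
    thereby measurable.\<close>
  define v where "v t = (if t \<le> 0 then 1 else survival t x)" for t
  have v_anti: "v t \<le> v s" if "s \<le> t" for s t
    using that survival_mono[of s t x] survival_bounds[of t x] by (auto simp: v_def)
  have v01: "0 \<le> v t" "v t \<le> 1" for t using survival_bounds by (auto simp: v_def)
  have "(\<lambda>t. - v t) \<in> borel_measurable borel"
    by (rule borel_measurable_mono) (auto intro!: monoI v_anti)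
  then have "(\<lambda>t. - (- v t)) \<in> borel_measurable borel" by (rule borel_measurable_uminus)
  then have [measurable]: "v \<in> borel_measurable borel" by simp
  let ?f = "\<lambda>t. indicator {0..} t * (exp (- t) * v t) :: real"
  have f: "integrable lborel ?f"
    by (rule Bochner_Integration.integrable_bound[OF integrable_exp_minus])
      (use v01 in \<open>auto simp: indicator_def abs_mult mult_left_le\<close>)
  have ae: "AE t in lborel. indicator {0..} t *\<^sub>R (exp (- t) * survival_prob P X D t x) = ?f t"
    using AE_lborel_singleton[of "0::real"]
    by eventually_elim (auto simp: indicator_def v_def less_exit_time_event(2))
  have eq: "resolvent x = (\<integral>t. ?f t \<partial>lborel)"
  proof -
    \<comment> \<open>\<open>survival_prob\<close> is identified with \<open>survival\<close> for
      positive \<open>t\<close> only; an exceptional value at the single point 0 affects neither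
      measurability nor the integral.\<close>
    have "(\<lambda>t. indicator {0..} t *\<^sub>R (exp (- t) * survival_prob P X D t x))
        = (\<lambda>t. if t = 0 then survival_prob P X D 0 x else ?f t)"
      by (auto simp: fun_eq_iff indicator_def v_def less_exit_time_event(2))
    also have "\<dots> \<in> borel_measurable lborel" by measurable
    finally show ?thesis
      unfolding resolvent_def set_lebesgue_integral_def by (intro integral_cong_AE ae) auto
  qed
  have ind: "integrable lborel (indicator {0..\<delta>} :: real \<Rightarrow> real)"
    by (intro integrable_real_indicator) (auto simp: emeasure_lborel_Icc_eq)
  have v\<delta>: "v \<delta> = survival \<delta> x" using \<delta> by (simp add: v_def)
  have "(\<integral>t. ?f t \<partial>lborel) \<le> (\<integral>t. indicator {0..\<delta>} t + indicator {0..} t * exp (- t) * survival \<delta> x \<partial>lborel)"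
  proof (rule integral_mono[OF f])
    show "integrable lborel (\<lambda>t. indicator {0..\<delta>} t + indicator {0..} t * exp (- t) * survival \<delta> x)"
      by (intro Bochner_Integration.integrable_add ind integrable_mult_left integrable_exp_minus)
    fix t
    show "?f t \<le> indicator {0..\<delta>} t + indicator {0..} t * exp (- t) * survival \<delta> x"
    proof (cases "t \<le> \<delta>")
      case True
      then show ?thesis using v01 survival_bounds(1)[of \<delta> x]
        by (auto simp: indicator_def intro!: add_increasing2 mult_le_one)
    next
      case False
      then show ?thesis using v_anti[of \<delta> t] v\<delta> by (auto simp: indicator_def)
    qed
  qed
  also have "\<dots> = \<delta> + survival \<delta> x"
    using \<delta> integrable_exp_minus integral_exp_minus by simp
  finally show "resolvent x \<le> \<delta> + survival \<delta> x" by (simp add: eq)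
  have "\<delta> * exp (- \<delta>) * survival \<delta> x = (\<integral>t. indicator {0..\<delta>} t * (exp (- \<delta>) * survival \<delta> x) \<partial>lborel)"
    using \<delta> by simp
  also have "\<dots> \<le> (\<integral>t. ?f t \<partial>lborel)"
  proof (rule integral_mono[OF _ f])
    show "integrable lborel (\<lambda>t. indicator {0..\<delta>} t * (exp (- \<delta>) * survival \<delta> x))"
      by (intro integrable_mult_left ind)
    show "indicator {0..\<delta>} t * (exp (- \<delta>) * survival \<delta> x) \<le> ?f t" for t
      using v_anti[of t \<delta>] v01 survival_bounds(1)[of \<delta> x] by (auto simp: indicator_def v\<delta> intro!: mult_mono)
  qed
  finally show "\<delta> * exp (- \<delta>) * survival \<delta> x \<le> resolvent x" by (simp add: eq)
qed

lemma resolvent_tendsto_iff: "(resolvent \<longlongrightarrow> 0) at_infinity \<longleftrightarrow> survival_vanishes"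
proof
  assume lim: "(resolvent \<longlongrightarrow> 0) at_infinity"
  show survival_vanishes
    unfolding survival_vanishes_def
  proof (intro allI impI)
    fix t \<epsilon> :: real assume t: "0 < t" and \<epsilon>: "0 < \<epsilon>"
    define b where "b = t * exp (- t)"
    have b: "0 < b" using t by (simp add: b_def)
    have "\<forall>\<^sub>F x in at_infinity. resolvent x < b * \<epsilon>"
      using lim b \<epsilon> by (auto simp: order_tendsto_iff)
    then obtain R where R: "\<And>x. R \<le> norm x \<Longrightarrow> resolvent x < b * \<epsilon>"
      by (auto simp: eventually_at_infinity)
    have "survival t x \<le> \<epsilon>" if "R < norm x" for x
    proof -
      have "b * survival t x < b * \<epsilon>"
        using resolvent_bounds(2)[OF t, of x] R[of x] that by (simp add: b_def)
      then show ?thesis using b by simp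
    qed
    then show "\<exists>R. \<forall>x. R < norm x \<longrightarrow> survival t x \<le> \<epsilon>" by blast
  qed
next
  assume sv: survival_vanishes
  show "(resolvent \<longlongrightarrow> 0) at_infinity"
  proof (rule tendstoI)
    fix \<epsilon> :: real assume \<epsilon>: "0 < \<epsilon>"
    have "0 < \<epsilon> / 3" using \<epsilon> by simp
    from survival_vanishesD[OF sv this this]
    obtain R where R: "\<forall>x. R < norm x \<longrightarrow> survival (\<epsilon> / 3) x \<le> \<epsilon> / 3" ..
    have "dist (resolvent x) 0 < \<epsilon>" if "R + 1 \<le> norm x" for x
    proof -
      have "0 \<le> \<epsilon> / 3 * exp (- (\<epsilon> / 3)) * survival (\<epsilon> / 3) x" using \<epsilon> by (simp add: survival_bounds)
      then show ?thesis
        using resolvent_bounds[of "\<epsilon> / 3" x] R[rule_format, of x] that \<epsilon> by (simp add: dist_real_def)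
    qed
    then show "\<forall>\<^sub>F x in at_infinity. dist (resolvent x) 0 < \<epsilon>"
      unfolding eventually_at_infinity by blast
  qed
qed

end

section \<open>Compactness\<close>

text \<open>The \<open>r\<close>-th power of the L^r norm, as an extended nonnegative integral, so
  that finiteness can be derived from inequalities.\<close>

definition Lp_mass :: "real \<Rightarrow> ('a::euclidean_space \<Rightarrow> real) \<Rightarrow> ennreal" where
  "Lp_mass r f = (\<integral>\<^sup>+x. ennreal (\<bar>f x\<bar> powr r) \<partial>lborel)"

lemma abs_diff_powr_le:
  fixes a b r :: real
  assumes "0 \<le> r"
  shows "\<bar>a - b\<bar> powr r \<le> 2 powr r * (\<bar>a\<bar> powr r + \<bar>b\<bar> powr r)"
proof -
  have "\<bar>a - b\<bar> powr r \<le> (2 * max \<bar>a\<bar> \<bar>b\<bar>) powr r"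
    using assms by (intro powr_mono2) auto
  also have "\<dots> = 2 powr r * (max \<bar>a\<bar> \<bar>b\<bar>) powr r" by (simp add: powr_mult)
  also have "\<dots> \<le> 2 powr r * (\<bar>a\<bar> powr r + \<bar>b\<bar> powr r)"
    by (intro mult_left_mono) (auto simp: max_def)
  finally show ?thesis .
qed

lemma nn_integral_diff_powr_le:
  assumes [measurable]: "f \<in> borel_measurable M" "g \<in> borel_measurable M" "A \<in> sets M" and r: "0 \<le> r"
  shows "(\<integral>\<^sup>+x. ennreal (\<bar>f x - g x\<bar> powr r) * indicator A x \<partial>M)
    \<le> ennreal (2 powr r) * ((\<integral>\<^sup>+x. ennreal (\<bar>f x\<bar> powr r) * indicator A x \<partial>M)
      + (\<integral>\<^sup>+x. ennreal (\<bar>g x\<bar> powr r) * indicator A x \<partial>M))"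
proof -
  have "(\<integral>\<^sup>+x. ennreal (\<bar>f x - g x\<bar> powr r) * indicator A x \<partial>M)
    \<le> (\<integral>\<^sup>+x. ennreal (2 powr r) * (ennreal (\<bar>f x\<bar> powr r) * indicator A x + ennreal (\<bar>g x\<bar> powr r) * indicator A x) \<partial>M)"
  proof (intro nn_integral_mono)
    fix x
    have "ennreal (\<bar>f x - g x\<bar> powr r) \<le> ennreal (2 powr r * (\<bar>f x\<bar> powr r + \<bar>g x\<bar> powr r))"
      by (intro ennreal_leI abs_diff_powr_le r)
    also have "\<dots> = ennreal (2 powr r) * (ennreal (\<bar>f x\<bar> powr r) + ennreal (\<bar>g x\<bar> powr r))"
      by (simp add: ennreal_mult)
    finally show "ennreal (\<bar>f x - g x\<bar> powr r) * indicator A x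
        \<le> ennreal (2 powr r) * (ennreal (\<bar>f x\<bar> powr r) * indicator A x + ennreal (\<bar>g x\<bar> powr r) * indicator A x)"
      by (auto simp: indicator_def)
  qed
  also have "\<dots> = ennreal (2 powr r) * ((\<integral>\<^sup>+x. ennreal (\<bar>f x\<bar> powr r) * indicator A x \<partial>M)
      + (\<integral>\<^sup>+x. ennreal (\<bar>g x\<bar> powr r) * indicator A x \<partial>M))"
    by (subst nn_integral_cmult) (auto simp: nn_integral_add)
  finally show ?thesis .
qed

lemma Lp_mass_diff_le:
  assumes "f \<in> borel_measurable borel" "g \<in> borel_measurable borel" "0 \<le> r"
  shows "Lp_mass r (\<lambda>x. f x - g x) \<le> ennreal (2 powr r) * (Lp_mass r f + Lp_mass r g)"
  using nn_integral_diff_powr_le[of f lborel g UNIV r] assms by (simp add: Lp_mass_def)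

context killed_stable_process
begin

section \<open>Function spaces on \<open>D\<close>\<close>

abbreviation MD :: "'a measure" where
  "MD \<equiv> restrict_space lborel D"

text \<open>Moves functions on \<open>D\<close> to the whole space, where translations act and the
  kernel is defined.\<close>

definition zero_ext :: "('a \<Rightarrow> real) \<Rightarrow> 'a \<Rightarrow> real" where
  "zero_ext f x = indicator D x * f x"

lemma D_borel[measurable]: "D \<in> sets borel"
  using open_D by simp

lemma measurable_MD_iff: "f \<in> borel_measurable MD \<longleftrightarrow> zero_ext f \<in> borel_measurable borel"
  using borel_measurable_restrict_space_iff[of D lborel f] by (simp add: zero_ext_def[abs_def])

lemma AE_MD_iff: "(AE x in MD. Q x) \<longleftrightarrow> (AE x in lborel. x \<in> D \<longrightarrow> Q x)"
  by (rule AE_restrict_space_iff) simp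

lemma nn_integral_MD_powr: "0 < r \<Longrightarrow> (\<integral>\<^sup>+x. ennreal (\<bar>f x\<bar> powr r) \<partial>MD) = Lp_mass r (zero_ext f)"
  unfolding Lp_mass_def
  by (subst nn_integral_restrict_space) (auto intro!: nn_integral_cong simp: zero_ext_def indicator_def)

lemma mem_Lp_iff:
  assumes "p \<noteq> \<infinity>" and r: "0 < enn2real p"
  shows "f \<in> Lp_space p MD \<longleftrightarrow> zero_ext f \<in> borel_measurable borel \<and> Lp_mass (enn2real p) (zero_ext f) < \<infinity>"
proof -
  have "integrable MD (\<lambda>x. \<bar>f x\<bar> powr enn2real p) \<longleftrightarrow> Lp_mass (enn2real p) (zero_ext f) < \<infinity>"
    if [measurable]: "f \<in> borel_measurable MD"
    using nn_integral_MD_powr[OF r, of f] by (subst integrable_iff_bounded) auto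
  then show ?thesis using assms by (auto simp: Lp_space_def measurable_MD_iff)
qed

lemma Lp_norm_eq:
  assumes p: "p \<noteq> \<infinity>" and r: "0 < enn2real p" and f: "zero_ext f \<in> borel_measurable borel"
  shows "Lp_norm p MD f = enn2real (Lp_mass (enn2real p) (zero_ext f)) powr (1 / enn2real p)"
proof -
  have [measurable]: "f \<in> borel_measurable MD" using f by (simp add: measurable_MD_iff)
  have "(\<integral>x. \<bar>f x\<bar> powr enn2real p \<partial>MD) = enn2real (Lp_mass (enn2real p) (zero_ext f))"
    unfolding nn_integral_MD_powr[OF r, symmetric] by (rule integral_eq_nn_integral) auto
  then show ?thesis using p by (simp add: Lp_norm_def)
qed

lemma mem_Linf_iff:
  "f \<in> Lp_space \<infinity> MD \<longleftrightarrow> zero_ext f \<in> borel_measurable borel \<and> (\<exists>C. AE x in lborel. \<bar>zero_ext f x\<bar> \<le> C)"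
proof -
  have "(\<exists>C. AE x in MD. \<bar>f x\<bar> \<le> C) \<longleftrightarrow> (\<exists>C. AE x in lborel. \<bar>zero_ext f x\<bar> \<le> C)"
  proof
    assume "\<exists>C. AE x in MD. \<bar>f x\<bar> \<le> C"
    then obtain C where "AE x in lborel. x \<in> D \<longrightarrow> \<bar>f x\<bar> \<le> C" unfolding AE_MD_iff by blast
    then have "AE x in lborel. \<bar>zero_ext f x\<bar> \<le> max C 0"
      by eventually_elim (auto simp: zero_ext_def indicator_def)
    then show "\<exists>C. AE x in lborel. \<bar>zero_ext f x\<bar> \<le> C" by blast
  next
    assume "\<exists>C. AE x in lborel. \<bar>zero_ext f x\<bar> \<le> C"
    then obtain C where "AE x in lborel. \<bar>zero_ext f x\<bar> \<le> C" by blast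
    then have "AE x in lborel. x \<in> D \<longrightarrow> \<bar>f x\<bar> \<le> C"
      by eventually_elim (auto simp: zero_ext_def)
    then show "\<exists>C. AE x in MD. \<bar>f x\<bar> \<le> C" unfolding AE_MD_iff by blast
  qed
  then show ?thesis by (simp add: Lp_space_def measurable_MD_iff)
qed

text \<open>\<open>real_of_ereal\<close> sends both infinities to 0, so a bound on the norm alone
  would be ambiguous. Membership in the space excludes positive infinity; negative infinity, which
  belongs to a null space, is covered by the maximum with 0.\<close>

lemma Linf_norm_AE:
  assumes f: "f \<in> Lp_space \<infinity> MD" and B: "Lp_norm \<infinity> MD f \<le> B"
  shows "AE x in lborel. \<bar>zero_ext f x\<bar> \<le> max B 0"
proof -
  have [measurable]: "f \<in> borel_measurable MD" using f by (simp add: Lp_space_def)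
  let ?e = "esssup MD (\<lambda>x. ereal \<bar>f x\<bar>)"
  obtain C where C: "AE x in MD. \<bar>f x\<bar> \<le> C" using f by (auto simp: Lp_space_def)
  have "?e \<le> ereal C" by (rule esssup_I) (use C in auto)
  then have "?e \<le> ereal (max B 0)"
    using B by (cases ?e) (auto simp: Lp_norm_def le_max_iff_disj)
  moreover have "AE x in MD. ereal \<bar>f x\<bar> \<le> ?e" by (rule esssup_AE) 
  ultimately have "AE x in MD. \<bar>f x\<bar> \<le> max B 0"
    by (elim eventually_mono) (meson ereal_less_eq(3) order_trans)
  then have "AE x in lborel. x \<in> D \<longrightarrow> \<bar>f x\<bar> \<le> max B 0" unfolding AE_MD_iff .
  then show ?thesis by eventually_elim (auto simp: zero_ext_def indicator_def)
qed

lemma Linf_norm_bounds: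
  assumes f: "zero_ext f \<in> borel_measurable borel" and C: "\<And>x. x \<in> D \<Longrightarrow> \<bar>f x\<bar> \<le> C" and C0: "0 \<le> C"
  shows "0 \<le> Lp_norm \<infinity> MD f" "Lp_norm \<infinity> MD f \<le> C"
proof -
  have [measurable]: "f \<in> borel_measurable MD" using f by (simp add: measurable_MD_iff)
  let ?e = "esssup MD (\<lambda>x. ereal \<bar>f x\<bar>)"
  have le: "?e \<le> ereal C" by (rule esssup_I) (auto simp: AE_MD_iff C)
  then show "Lp_norm \<infinity> MD f \<le> C" using C0 by (cases ?e) (auto simp: Lp_norm_def)
  show "0 \<le> Lp_norm \<infinity> MD f"
  proof (cases "0 \<le> ?e")
    case True
    then show ?thesis by (simp add: Lp_norm_def real_of_ereal_pos)
  next
    case False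
    \<comment> \<open>A negative essential supremum of an absolute value forces \<open>MD\<close> to
      be the null measure; then the supremum is negative infinity, and \<open>real_of_ereal\<close>
      turns it into 0.\<close>
    have "AE x in MD. ereal \<bar>f x\<bar> \<le> ?e" by (rule esssup_AE)
    then have "AE x in MD. False"
    proof eventually_elim
      case (elim x)
      have "0 \<le> ereal \<bar>f x\<bar>" by simp
      then show ?case using elim False by (metis order_trans)
    qed
    then obtain N where N: "{x\<in>space MD. \<not> False} \<subseteq> N" "emeasure MD N = 0" "N \<in> sets MD" by (rule AE_E)
    then have "emeasure MD (space MD) \<le> emeasure MD N" by (intro emeasure_mono) auto
    then have "emeasure MD (space MD) = 0" using N(2) by simp
    then have "?e = - \<infinity>" by (rule esssup_zero_space) simp
    then show ?thesis by (simp add: Lp_norm_def)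
  qed
qed

lemma zero_ext_part_semigroup:
  assumes "0 < t" and "zero_ext f \<in> borel_measurable borel"
  shows "zero_ext (part_semigroup P X D t f) = kernel t (zero_ext f)"
proof
  fix x
  show "zero_ext (part_semigroup P X D t f) x = kernel t (zero_ext f) x"
    using part_semigroup_eq_kernel[of t x f] assms
    by (cases "x \<in> D") (auto simp: zero_ext_def[abs_def] kernel_outside)
qed

lemma zero_ext_diff: "zero_ext (\<lambda>x. f x - g x) = (\<lambda>x. zero_ext f x - zero_ext g x)"
  by (auto simp: zero_ext_def fun_eq_iff right_diff_distrib)

lemma zero_ext_of_vanishing: "(\<And>x. x \<notin> D \<Longrightarrow> g x = 0) \<Longrightarrow> zero_ext g = g"
  by (auto simp: zero_ext_def fun_eq_iff indicator_def)

lemma Lp_mass_kernel_le: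
  assumes t: "0 \<le> t" and f[measurable]: "f \<in> borel_measurable borel" and r: "1 \<le> r"
  shows "Lp_mass r (kernel t f) \<le> ennreal (2 powr r) * Lp_mass r f"
proof -
  have m: "kernel_nn t (\<lambda>y. ennreal (\<bar>f y\<bar> powr r)) \<in> borel_measurable borel"
    by (intro measurable_kernel_nn t) measurable
  have "Lp_mass r (kernel t f) \<le> (\<integral>\<^sup>+x. ennreal (2 powr r) * kernel_nn t (\<lambda>y. ennreal (\<bar>f y\<bar> powr r)) x \<partial>lborel)"
    unfolding Lp_mass_def by (intro nn_integral_mono kernel_powr_le t f r)
  also have "\<dots> = ennreal (2 powr r) * (\<integral>\<^sup>+x. kernel_nn t (\<lambda>y. ennreal (\<bar>f y\<bar> powr r)) x \<partial>lborel)"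
    using m by (intro nn_integral_cmult) simp
  also have "\<dots> \<le> ennreal (2 powr r) * Lp_mass r f"
    unfolding Lp_mass_def by (intro mult_left_mono nn_integral_kernel_nn_le t) auto
  finally show ?thesis .
qed

section \<open>From compactness on L2 to vanishing survival\<close>

lemma kernel_nn_eq_kernel:
  assumes t: "0 < t" and f[measurable]: "f \<in> borel_measurable borel" and f0: "\<And>y. 0 \<le> f y" and M: "\<And>y. f y \<le> M"
  shows "kernel_nn t (\<lambda>y. ennreal (f y)) x = ennreal (kernel t f x)"
proof -
  note [simp] = less_imp_le[OF t]
  have int: "integrable path_law (\<lambda>w. f (x + w t))"
    by (rule integrable_X_bounded[OF t f, where M=M]) (use f0 M in auto)
  have int': "integrable path_law (\<lambda>w. f (x + w t) * indicator (alive_set t) (x, w))"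
    by (rule Bochner_Integration.integrable_bound[OF int]) (auto simp: indicator_def)
  have "kernel_nn t (\<lambda>y. ennreal (f y)) x = (\<integral>\<^sup>+w. ennreal (f (x + w t) * indicator (alive_set t) (x, w)) \<partial>path_law)"
    unfolding kernel_nn_def by (intro nn_integral_cong) (auto simp: indicator_def)
  also have "\<dots> = ennreal (kernel t f x)"
    unfolding kernel_def by (rule nn_integral_eq_integral[OF int']) (auto simp: f0)
  finally show ?thesis .
qed

text \<open>A surviving path is displaced by more than \<open>\<rho>\<close> or ends in the ball.
  The probability of the latter is at most the mean of \<open>kernel s \<phi>\<close> over the
  position at time \<open>s\<close>; with \<open>a <= \<eta> + a^2 / \<eta>\<close> and the density
  bound, the L2 mass of \<open>kernel s \<phi>\<close> controls this mean at the given
  point.\<close>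

lemma survival_le_ball_kernel:
  fixes \<rho> :: real and x :: 'a
  assumes s: "0 < s" and \<eta>: "0 < \<eta>"
  defines "\<phi> \<equiv> (\<lambda>y. indicator D y * indicator (cball x \<rho>) y :: real)"
  shows "ennreal (survival (s + s) x) \<le> ennreal (L.prob {w\<in>space path_law. \<rho> < norm (w (s + s))})
    + (ennreal \<eta> + ennreal (dens_bound s / \<eta>) * Lp_mass 2 (kernel s \<phi>))"
proof -
  note [simp] = less_imp_le[OF s]
  let ?t = "s + s"
  have t: "0 < ?t" using s by simp
  have [measurable]: "cball x \<rho> \<in> sets borel" by (intro borel_closed closed_cball)
  have \<phi>[measurable]: "\<phi> \<in> borel_measurable borel" unfolding \<phi>_def by measurable
  have \<phi>01: "0 \<le> \<phi> y" "\<phi> y \<le> 1" for y by (auto simp: \<phi>_def indicator_def)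
  let ?k = "kernel s \<phi>"
  have k[measurable]: "?k \<in> borel_measurable borel" by (rule measurable_kernel[OF \<phi>]) simp
  have [measurable]: "X ?t \<in> borel_measurable (P x)" by simp
  let ?far = "\<lambda>y. if \<rho> < norm (y - x) then 1 else 0 :: ennreal"
  have "ennreal (survival ?t x) = (\<integral>\<^sup>+\<omega>. indicator (past_alive ?t) (past ?t \<omega>) \<partial>P x)"
    by (simp add: nn_integral_past_alive)
  also have "\<dots> \<le> (\<integral>\<^sup>+\<omega>. ?far (X ?t \<omega>) + ennreal (\<phi> (X ?t \<omega>)) * indicator (past_alive ?t) (past ?t \<omega>) \<partial>P x)"
  proof (rule nn_integral_mono_AE)
    show "AE \<omega> in P x. indicator (past_alive ?t) (past ?t \<omega>)
        \<le> ?far (X ?t \<omega>) + ennreal (\<phi> (X ?t \<omega>)) * indicator (past_alive ?t) (past ?t \<omega>)"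
      using AE_less_exit_time_iff[OF t, of x]
    proof eventually_elim
      case (elim \<omega>)
      show ?case
        using elim mem_D_of_less_exit_time[OF t, of \<omega>]
        by (auto simp: indicator_def \<phi>_def dist_norm norm_minus_commute)
    qed
  qed
  also have "\<dots> = (\<integral>\<^sup>+\<omega>. ?far (X ?t \<omega>) \<partial>P x) + (\<integral>\<^sup>+\<omega>. ennreal (\<phi> (X ?t \<omega>)) * indicator (past_alive ?t) (past ?t \<omega>) \<partial>P x)"
    by (rule nn_integral_add) measurable
  also have "(\<integral>\<^sup>+\<omega>. ?far (X ?t \<omega>) \<partial>P x) = ennreal (L.prob {w\<in>space path_law. \<rho> < norm (w ?t)})"
  proof -
    have "(\<integral>\<^sup>+\<omega>. ?far (X ?t \<omega>) \<partial>P x) = (\<integral>\<^sup>+w. ?far (x + w ?t) \<partial>path_law)"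
      by (rule nn_integral_X) auto
    also have "\<dots> = (\<integral>\<^sup>+w. indicator {w\<in>space path_law. \<rho> < norm (w ?t)} w \<partial>path_law)"
      by (intro nn_integral_cong) (auto simp: indicator_def)
    also have "\<dots> = ennreal (L.prob {w\<in>space path_law. \<rho> < norm (w ?t)})"
      by (simp add: L.emeasure_eq_measure)
    finally show ?thesis .
  qed
  also have "(\<integral>\<^sup>+\<omega>. ennreal (\<phi> (X ?t \<omega>)) * indicator (past_alive ?t) (past ?t \<omega>) \<partial>P x)
      \<le> ennreal \<eta> + ennreal (dens_bound s / \<eta>) * Lp_mass 2 ?k"
  proof -
    have m: "kernel_nn s (\<lambda>y. ennreal (\<phi> y)) \<in> borel_measurable borel"
      by (rule measurable_kernel_nn) auto
    have pt: "kernel_nn s (\<lambda>y. ennreal (\<phi> y)) y \<le> ennreal \<eta> + ennreal (1 / \<eta>) * ennreal (\<bar>?k y\<bar> powr 2)" for y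
    proof -
      have "?k y \<le> \<eta> + 1 / \<eta> * \<bar>?k y\<bar> powr 2"
      proof (cases "?k y \<le> \<eta>")
        case False
        then have "?k y * \<eta> \<le> ?k y * ?k y" using \<eta> by (intro mult_left_mono) auto
        moreover have "\<bar>?k y\<bar> powr 2 = ?k y * ?k y" using False \<eta> by (simp add: powr_numeral power2_eq_square)
        ultimately show ?thesis using \<eta> by (simp add: field_simps add_increasing)
      qed (use \<eta> in \<open>auto simp: add_increasing2\<close>)
      then have "ennreal (?k y) \<le> ennreal (\<eta> + 1 / \<eta> * \<bar>?k y\<bar> powr 2)" by (rule ennreal_leI)
      then show ?thesis
        using \<eta> by (simp add: kernel_nn_eq_kernel[OF s \<phi> \<phi>01] ennreal_plus[symmetric] ennreal_mult[symmetric] del: ennreal_plus)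
    qed
    have "(\<integral>\<^sup>+\<omega>. ennreal (\<phi> (X ?t \<omega>)) * indicator (past_alive ?t) (past ?t \<omega>) \<partial>P x)
        = (\<integral>\<^sup>+\<omega>. kernel_nn s (\<lambda>y. ennreal (\<phi> y)) (X s \<omega>) * indicator (past_alive s) (past s \<omega>) \<partial>P x)"
      by (rule nn_integral_markov_killed[OF s s]) measurable
    also have "\<dots> \<le> (\<integral>\<^sup>+\<omega>. kernel_nn s (\<lambda>y. ennreal (\<phi> y)) (X s \<omega>) \<partial>P x)"
      by (intro nn_integral_mono) (auto simp: indicator_def)
    also have "\<dots> = (\<integral>\<^sup>+w. kernel_nn s (\<lambda>y. ennreal (\<phi> y)) (x + w s) \<partial>path_law)"
      by (rule nn_integral_X[OF _ m]) simp
    also have "\<dots> \<le> (\<integral>\<^sup>+w. ennreal \<eta> + ennreal (1 / \<eta>) * ennreal (\<bar>?k (x + w s)\<bar> powr 2) \<partial>path_law)"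
      by (intro nn_integral_mono pt)
    also have "\<dots> = ennreal \<eta> + ennreal (1 / \<eta>) * (\<integral>\<^sup>+w. ennreal (\<bar>?k (x + w s)\<bar> powr 2) \<partial>path_law)"
      by (subst nn_integral_add) (auto simp: nn_integral_cmult L.emeasure_space_1)
    also have "\<dots> \<le> ennreal \<eta> + ennreal (1 / \<eta>) * (ennreal (dens_bound s) * Lp_mass 2 ?k)"
      unfolding Lp_mass_def
      by (intro add_left_mono mult_left_mono nn_integral_path_component_le[OF s, of "\<lambda>y. ennreal (\<bar>?k y\<bar> powr 2)"]) auto
    also have "\<dots> = ennreal \<eta> + ennreal (dens_bound s / \<eta>) * Lp_mass 2 ?k"
      using \<eta> by (simp add: mult.assoc[symmetric] ennreal_mult[symmetric] dens_bound_nonneg)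
    finally show ?thesis .
  qed
  finally show ?thesis by (simp add: add_left_mono)
qed

lemma kernel_indicator_tendsto:
  assumes s: "0 < s" and x: "\<And>n. real n < norm (x n)"
  shows "(\<lambda>n. kernel s (\<lambda>y. indicator D y * indicator (cball (x n) \<rho>) y) z) \<longlonglongrightarrow> 0"
proof -
  note [simp] = less_imp_le[OF s]
  have [measurable]: "cball (x n) \<rho> \<in> sets borel" for n by (intro borel_closed closed_cball)
  have [measurable]: "(\<lambda>y. indicator D y * indicator (cball (x n) \<rho>) y :: real) \<in> borel_measurable borel" for n
    by measurable
  let ?f = "\<lambda>n w. indicator D (z + w s) * indicator (cball (x n) \<rho>) (z + w s) * indicator (alive_set s) (z, w) :: real"
  have "(\<lambda>n. \<integral>w. ?f n w \<partial>path_law) \<longlonglongrightarrow> (\<integral>w. 0 \<partial>path_law)"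
  proof (rule integral_dominated_convergence[where w="\<lambda>_. 1"])
    show "AE w in path_law. (\<lambda>n. ?f n w) \<longlonglongrightarrow> 0"
    proof (intro AE_I2 tendsto_eventually)
      fix w
      obtain N :: nat where N: "norm (z + w s) + \<rho> < real N" using reals_Archimedean2 by blast
      have "?f n w = 0" if "N \<le> n" for n
      proof -
        have "norm (z + w s) + \<rho> < norm (x n)"
          using N that x[of n] by (meson less_le_trans less_trans of_nat_mono order.strict_trans2)
        then have "z + w s \<notin> cball (x n) \<rho>"
          using norm_triangle_sub[of "x n" "z + w s"] by (auto simp: dist_norm)
        then show ?thesis by simp
      qed
      then show "\<forall>\<^sub>F n in sequentially. ?f n w = 0" by (auto simp: eventually_sequentially)
    qed
    show "(\<lambda>w. ?f n w) \<in> borel_measurable path_law" for n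
      unfolding measurable_cong_sets[OF sets_path_law refl] by measurable
    show "AE w in path_law. norm (?f n w) \<le> 1" for n by (intro AE_I2) (auto simp: indicator_def)
  qed auto
  then show ?thesis by (simp add: kernel_def)
qed

lemma survival_vanishes_of_compact_L2:
  assumes comp: "compact_semigroup_Lp 2 MD (part_semigroup P X D)"
  shows survival_vanishes
proof (rule ccontr)
  note measurable_path_component[measurable del]
  assume "\<not> survival_vanishes"
  then obtain t \<epsilon> where t: "0 < t" and \<epsilon>: "0 < \<epsilon>" and far: "\<And>R. \<exists>x. R < norm x \<and> \<epsilon> < survival t x"
    unfolding survival_vanishes_def by (auto simp: not_le)
  have "\<forall>n. \<exists>x. real n < norm x \<and> \<epsilon> < survival t x" using far by blast
  then obtain x where x: "\<And>n. real n < norm (x n)" and surv: "\<And>n. \<epsilon> < survival t (x n)" by metis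
  define s where "s = t / 2"
  have s: "0 < s" and ss: "s + s = t" using t by (auto simp: s_def)
  note [simp] = less_imp_le[OF s]
  obtain \<rho> where \<rho>: "0 \<le> \<rho>" "L.prob {w\<in>space path_law. \<rho> < norm (w t)} < \<epsilon> / 2"
    using path_component_tight[of t "\<epsilon> / 2"] t \<epsilon> by auto
  define F where "F n y = (indicator (cball (x n) \<rho>) y :: real)" for n y
  define \<phi> where "\<phi> n y = (indicator D y * indicator (cball (x n) \<rho>) y :: real)" for n y
  have extF: "zero_ext (F n) = \<phi> n" for n by (auto simp: zero_ext_def F_def \<phi>_def)
  have [measurable]: "cball (x n) \<rho> \<in> sets borel" for n by (intro borel_closed closed_cball)
  have \<phi>[measurable]: "\<phi> n \<in> borel_measurable borel" for n unfolding \<phi>_def[abs_def] by measurable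
  let ?V = "unit_ball_vol (real DIM('a)) * \<rho> ^ DIM('a)"
  have V0: "0 \<le> ?V" using \<rho> by simp
  have N\<phi>: "Lp_mass 2 (\<phi> n) \<le> ennreal ?V" for n
  proof -
    have "Lp_mass 2 (\<phi> n) \<le> (\<integral>\<^sup>+y. indicator (cball (x n) \<rho>) y \<partial>lborel)"
      unfolding Lp_mass_def by (intro nn_integral_mono) (auto simp: \<phi>_def indicator_def)
    then show ?thesis using \<rho> by (simp add: emeasure_cball)
  qed
  have two: "(2::ennreal) \<noteq> \<infinity>" "enn2real 2 = 2" by auto
  have FL: "F n \<in> Lp_space 2 MD" for n
    using N\<phi>[of n] by (subst mem_Lp_iff) (auto simp: extF intro: le_less_trans)
  have FB: "Lp_norm 2 MD (F n) \<le> ?V powr (1 / 2)" for n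
  proof -
    have "enn2real (Lp_mass 2 (\<phi> n)) \<le> ?V" by (rule enn2real_leI[OF V0 N\<phi>])
    then show ?thesis by (subst Lp_norm_eq) (auto simp: extF intro!: powr_mono2)
  qed
  have "compact_operator_Lp 2 MD (part_semigroup P X D s)"
    using comp s by (simp add: compact_semigroup_Lp_def)
  then obtain g r where g: "g \<in> Lp_space 2 MD" and r: "strict_mono (r :: nat \<Rightarrow> nat)"
    and lim: "(\<lambda>n. Lp_norm 2 MD (\<lambda>y. part_semigroup P X D s (F (r n)) y - g y)) \<longlonglongrightarrow> 0"
    unfolding compact_operator_Lp_def using FL FB by blast
  define k where "k n = kernel s (\<phi> (r n))" for n
  have k[measurable]: "k n \<in> borel_measurable borel" for n
    unfolding k_def by (rule measurable_kernel) auto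
  have eg[measurable]: "zero_ext g \<in> borel_measurable borel" and Ng: "Lp_mass 2 (zero_ext g) < \<infinity>"
    using g by (auto simp: mem_Lp_iff)
  have extd: "zero_ext (\<lambda>y. part_semigroup P X D s (F (r n)) y - g y) = (\<lambda>y. k n y - zero_ext g y)" for n
    using zero_ext_part_semigroup[OF s, of "F (r n)"] by (simp add: zero_ext_diff k_def extF)
  let ?N = "\<lambda>n. Lp_mass 2 (\<lambda>y. k n y - zero_ext g y)"
  \<comment> \<open>\<open>enn2real\<close> sends infinity to 0, so convergence of the norms carries
    information only once the masses are known to be finite.\<close>
  have N_fin: "?N n < \<infinity>" for n
  proof -
    have "Lp_mass 2 (k n) \<le> ennreal (2 powr 2) * Lp_mass 2 (\<phi> (r n))"
      unfolding k_def by (rule Lp_mass_kernel_le) auto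
    also have "\<dots> < \<infinity>" using N\<phi>[of "r n"] by (auto simp: ennreal_mult_less_top intro: le_less_trans)
    finally have "ennreal (2 powr 2) * (Lp_mass 2 (k n) + Lp_mass 2 (zero_ext g)) < \<infinity>"
      using Ng by (auto simp: ennreal_mult_less_top)
    moreover have "?N n \<le> ennreal (2 powr 2) * (Lp_mass 2 (k n) + Lp_mass 2 (zero_ext g))"
      by (rule Lp_mass_diff_le) auto
    ultimately show ?thesis by (rule le_less_trans[rotated])
  qed
  have "(\<lambda>n. (enn2real (?N n) powr (1 / 2)) powr 2) \<longlonglongrightarrow> 0 powr 2"
  proof (rule tendsto_powr2)
    show "(\<lambda>n. enn2real (?N n) powr (1 / 2)) \<longlonglongrightarrow> 0"
      using lim by (subst (asm) Lp_norm_eq) (auto simp: extd)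
  qed auto
  then have "(\<lambda>n. enn2real (?N n)) \<longlonglongrightarrow> 0" by (simp add: powr_powr)
  then have "(\<lambda>n. ennreal (enn2real (?N n))) \<longlonglongrightarrow> ennreal 0" by (rule tendsto_ennrealI)
  then have N_lim: "?N \<longlonglongrightarrow> 0" using N_fin by simp
  have k_lim: "(\<lambda>n. k n y) \<longlonglongrightarrow> 0" for y
    using LIMSEQ_subseq_LIMSEQ[OF kernel_indicator_tendsto[OF s x, of \<rho> y] r]
    by (simp add: k_def \<phi>_def[abs_def] comp_def)
  \<comment> \<open>The images tend to 0 pointwise and to \<open>g\<close> in L2; Fatou forces
    \<open>g\<close> to vanish almost everywhere.\<close>
  have "Lp_mass 2 (zero_ext g) = (\<integral>\<^sup>+y. liminf (\<lambda>n. ennreal (\<bar>k n y - zero_ext g y\<bar> powr 2)) \<partial>lborel)"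
    unfolding Lp_mass_def
  proof (intro nn_integral_cong)
    fix y
    have "(\<lambda>n. ennreal (\<bar>k n y - zero_ext g y\<bar> powr 2)) \<longlonglongrightarrow> ennreal (\<bar>0 - zero_ext g y\<bar> powr 2)"
      by (intro tendsto_ennrealI tendsto_powr2 tendsto_rabs tendsto_diff k_lim tendsto_const) auto
    then show "ennreal (\<bar>zero_ext g y\<bar> powr 2) = liminf (\<lambda>n. ennreal (\<bar>k n y - zero_ext g y\<bar> powr 2))"
      using lim_imp_Liminf[OF sequentially_bot] by fastforce
  qed
  also have "\<dots> \<le> liminf ?N"
    unfolding Lp_mass_def by (rule nn_integral_liminf) measurable
  also have "\<dots> = 0" by (rule lim_imp_Liminf[OF sequentially_bot N_lim])
  finally have "Lp_mass 2 (zero_ext g) = 0" by simp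
  then have "AE y in lborel. zero_ext g y = 0"
    unfolding Lp_mass_def by (subst (asm) nn_integral_0_iff_AE) auto
  then have "?N n = Lp_mass 2 (k n)" for n
    unfolding Lp_mass_def by (intro nn_integral_cong_AE) auto
  then have k_N: "(\<lambda>n. Lp_mass 2 (k n)) \<longlonglongrightarrow> 0" using N_lim by simp
  \<comment> \<open>The far displacements, \<open>\<eta>\<close> and the L2 term contribute at most
    1/2, 1/4 and 1/8 of \<open>\<epsilon>\<close>, in total 7/8, which contradicts
    \<open>surv\<close>. The summand 1 in \<open>b\<close> makes it positive.\<close>
  define \<eta> where "\<eta> = \<epsilon> / 4"
  have \<eta>: "0 < \<eta>" using \<epsilon> by (simp add: \<eta>_def)
  define b where "b = dens_bound s / \<eta> + 1"
  have b: "0 < b" using dens_bound_nonneg[of s] \<eta> by (simp add: b_def add_nonneg_pos)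
  have "0 < ennreal (\<epsilon> / (8 * b))" using \<epsilon> b by simp
  then have "\<forall>\<^sub>F n in sequentially. Lp_mass 2 (k n) < ennreal (\<epsilon> / (8 * b))"
    by (rule order_tendstoD(2)[OF k_N])
  then obtain n where n: "Lp_mass 2 (k n) < ennreal (\<epsilon> / (8 * b))" by (auto simp: eventually_sequentially)
  have "ennreal (survival t (x (r n))) \<le> ennreal (L.prob {w\<in>space path_law. \<rho> < norm (w t)})
      + (ennreal \<eta> + ennreal (dens_bound s / \<eta>) * Lp_mass 2 (k n))"
    using survival_le_ball_kernel[OF s \<eta>, of "x (r n)" \<rho>] by (simp add: ss k_def \<phi>_def[abs_def])
  also have "\<dots> \<le> ennreal (\<epsilon> / 2) + (ennreal \<eta> + ennreal b * ennreal (\<epsilon> / (8 * b)))"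
    using \<rho>(2) n by (intro add_mono mult_mono ennreal_leI) (auto simp: b_def)
  also have "\<dots> = ennreal (\<epsilon> / 2 + (\<eta> + b * (\<epsilon> / (8 * b))))"
    using \<epsilon> \<eta> b by (simp add: ennreal_mult[symmetric] ennreal_plus[symmetric] del: ennreal_plus)
  also have "\<epsilon> / 2 + (\<eta> + b * (\<epsilon> / (8 * b))) = 7 / 8 * \<epsilon>" using b by (simp add: \<eta>_def)
  finally have "survival t (x (r n)) \<le> 7 / 8 * \<epsilon>" using \<epsilon> by simp
  then show False using surv[of "r n"] \<epsilon> by simp
qed

end

section \<open>From vanishing survival to compactness\<close>

lemma ennreal_tendsto_0I:
  fixes f :: "nat \<Rightarrow> ennreal"
  assumes "\<And>\<epsilon>. 0 < \<epsilon> \<Longrightarrow> \<forall>\<^sub>F n in sequentially. f n \<le> ennreal \<epsilon>"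
  shows "f \<longlonglongrightarrow> 0"
proof (rule order_tendstoI)
  fix a :: ennreal assume a: "0 < a"
  obtain \<epsilon> where \<epsilon>: "0 < \<epsilon>" "ennreal \<epsilon> < a"
  proof (cases a)
    case (real r)
    then show ?thesis using a that[of "r / 2"] by (auto simp: ennreal_less_iff)
  qed (use that[of 1] in auto)
  show "\<forall>\<^sub>F n in sequentially. f n < a"
    using assms[OF \<epsilon>(1)] by eventually_elim (rule le_less_trans[OF _ \<epsilon>(2)])
qed simp

context killed_stable_process
begin

text \<open>Independence of the representative and linearity are the same for all exponents: they
  hold for the kernel at every point, the former since displacements have a density, the latter by
  integrability along the displacement. What depends on \<open>p\<close> is left as
  hypotheses.\<close>

lemma compact_operator_LpI:
  assumes t: "0 < t"
    and meas: "\<And>f. f \<in> Lp_space p MD \<Longrightarrow> zero_ext f \<in> borel_measurable borel"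
    and int: "\<And>f x. f \<in> Lp_space p MD \<Longrightarrow> integrable path_law (\<lambda>w. zero_ext f (x + w t))"
    and into: "\<And>f. f \<in> Lp_space p MD \<Longrightarrow> part_semigroup P X D t f \<in> Lp_space p MD"
    and comp: "\<And>F B. (\<And>n::nat. F n \<in> Lp_space p MD) \<Longrightarrow> (\<And>n. Lp_norm p MD (F n) \<le> B) \<Longrightarrow>
      \<exists>g\<in>Lp_space p MD. \<exists>r. strict_mono (r :: nat \<Rightarrow> nat) \<and>
        (\<lambda>n. Lp_norm p MD (\<lambda>x. part_semigroup P X D t (F (r n)) x - g x)) \<longlonglongrightarrow> 0"
  shows "compact_operator_Lp p MD (part_semigroup P X D t)"
proof -
  let ?T = "part_semigroup P X D t"
  have T: "?T f x = kernel t (zero_ext f) x" if "zero_ext f \<in> borel_measurable borel" "x \<in> D" for f x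
    using part_semigroup_eq_kernel[OF t that(2), of f] that(1) by (simp add: zero_ext_def[abs_def])
  show ?thesis
    unfolding compact_operator_Lp_def
  proof (intro conjI ballI impI allI)
    fix f g assume f: "f \<in> Lp_space p MD" and g: "g \<in> Lp_space p MD"
    { assume "AE x in MD. f x = g x"
      then have "AE x in lborel. x \<in> D \<longrightarrow> f x = g x" unfolding AE_MD_iff .
      then have "AE x in lborel. zero_ext f x = zero_ext g x" by eventually_elim (auto simp: zero_ext_def indicator_def)
      then have "kernel t (zero_ext f) x = kernel t (zero_ext g) x" for x
        by (intro kernel_cong_AE t meas f g)
      then show "AE x in MD. ?T f x = ?T g x"
        unfolding AE_MD_iff by (intro AE_I2) (simp add: T meas f g) }
    fix a b
    have e: "zero_ext (\<lambda>y. a * f y + b * g y) = (\<lambda>y. a * zero_ext f y + b * zero_ext g y)"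
      by (auto simp: zero_ext_def fun_eq_iff algebra_simps)
    have [measurable]: "zero_ext f \<in> borel_measurable borel" "zero_ext g \<in> borel_measurable borel"
      by (rule meas[OF f], rule meas[OF g])
    have "(\<lambda>y. a * zero_ext f y + b * zero_ext g y) \<in> borel_measurable borel" by (intro borel_measurable_add borel_measurable_times) auto
    then show "AE x in MD. ?T (\<lambda>y. a * f y + b * g y) x = a * ?T f x + b * ?T g x"
      unfolding AE_MD_iff
      by (intro AE_I2 impI) (simp add: T e kernel_linear[OF t] meas f g int)
  next
    fix F :: "nat \<Rightarrow> 'a \<Rightarrow> real"
    assume "(\<forall>n. F n \<in> Lp_space p MD) \<and> (\<exists>B. \<forall>n. Lp_norm p MD (F n) \<le> B)"
    then obtain B where "\<And>n. F n \<in> Lp_space p MD" "\<And>n. Lp_norm p MD (F n) \<le> B" by blast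
    then show "\<exists>g\<in>Lp_space p MD. \<exists>r. strict_mono (r :: nat \<Rightarrow> nat) \<and>
        (\<lambda>n. Lp_norm p MD (\<lambda>x. ?T (F (r n)) x - g x)) \<longlonglongrightarrow> 0"
      by (rule comp)
  qed (rule into)
qed

lemma nn_integral_dominated_near:
  assumes [measurable]: "\<And>n. d n \<in> borel_measurable borel" and lim: "\<And>x. (\<lambda>n. d n x) \<longlonglongrightarrow> (0::real)"
    and bd: "\<And>n x. \<bar>d n x\<bar> \<le> M" and r: "0 < r"
  shows "(\<lambda>n. \<integral>\<^sup>+x. ennreal (\<bar>d n x\<bar> powr r) * indicator (cball (0::'a) R) x \<partial>lborel) \<longlonglongrightarrow> 0"
proof -
  note measurable_path_component[measurable del]
  have [measurable]: "cball (0::'a) R \<in> sets borel" by (intro borel_closed closed_cball)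
  have "(\<lambda>n. \<integral>\<^sup>+x. ennreal (\<bar>d n x\<bar> powr r) * indicator (cball 0 R) x \<partial>lborel) \<longlonglongrightarrow> (\<integral>\<^sup>+x. 0 \<partial>(lborel :: 'a measure))"
  proof (rule nn_integral_dominated_convergence[where w="\<lambda>x. ennreal (M powr r) * indicator (cball 0 R) x"])
    show "AE x in lborel. ennreal (\<bar>d n x\<bar> powr r) * indicator (cball 0 R) x \<le> ennreal (M powr r) * indicator (cball 0 R) x" for n
      using bd r by (intro AE_I2 mult_right_mono ennreal_leI powr_mono2) auto
    show "(\<integral>\<^sup>+x. ennreal (M powr r) * indicator (cball (0::'a) R) x \<partial>lborel) < \<infinity>"
      by (simp add: nn_integral_cmult ennreal_mult_less_top emeasure_lborel_cball_finite[unfolded infinity_ennreal_def])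
    show "AE x in lborel. (\<lambda>n. ennreal (\<bar>d n x\<bar> powr r) * indicator (cball 0 R) x) \<longlonglongrightarrow> 0"
    proof (intro AE_I2)
      fix x
      have "(\<lambda>n. ennreal (\<bar>d n x\<bar> powr r)) \<longlonglongrightarrow> ennreal (\<bar>0\<bar> powr r)"
        using r by (intro tendsto_ennrealI tendsto_powr2 tendsto_rabs lim tendsto_const) auto
      then show "(\<lambda>n. ennreal (\<bar>d n x\<bar> powr r) * indicator (cball 0 R) x) \<longlonglongrightarrow> 0"
        by (cases "x \<in> cball 0 R") auto
    qed
  qed measurable
  then show ?thesis by simp
qed

text \<open>The first half-step turns the L^p bound into the uniform bound \<open>M\<close>, the
  second gives pointwise convergence along a subsequence. On a ball \<open>M\<close> dominates;
  outside, \<open>kernel_nn_uniform_tail\<close> treats all members of the sequence at once, and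
  Fatou passes the tail bound to the limit.\<close>

lemma compact_Lp_finite:
  assumes sv: survival_vanishes and p: "p \<noteq> \<infinity>" "1 \<le> p" and t: "0 < t"
  shows "compact_operator_Lp p MD (part_semigroup P X D t)"
proof -
  note measurable_path_component[measurable del]
  define r where "r = enn2real p"
  have r: "1 \<le> r"
    using p by (cases p) (auto simp: r_def ennreal_1[symmetric] simp del: ennreal_1)
  then have r0: "0 < r" and er: "0 < enn2real p" by (auto simp: r_def)
  note mem = mem_Lp_iff[OF p(1) er, folded r_def] and nrm = Lp_norm_eq[OF p(1) er, folded r_def]
  define s where "s = t / 2"
  have s: "0 < s" and ss: "s + s = t" using t by (auto simp: s_def)
  note [simp] = less_imp_le[OF s] less_imp_le[OF t]
  define K where "K = 2 powr r"
  have K: "0 < K" by (simp add: K_def)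
  show ?thesis
  proof (rule compact_operator_LpI[OF t])
    fix f assume f: "f \<in> Lp_space p MD"
    then show ef: "zero_ext f \<in> borel_measurable borel" by (simp add: mem)
    have Nf: "Lp_mass r (zero_ext f) < \<infinity>" using f by (simp add: mem)
    then show "integrable path_law (\<lambda>w. zero_ext f (x + w t))" for x
      unfolding Lp_mass_def by (rule integrable_X_of_powr(2)[OF t ef r])
    have "Lp_mass r (kernel t (zero_ext f)) \<le> ennreal (2 powr r) * Lp_mass r (zero_ext f)"
      by (rule Lp_mass_kernel_le[OF _ ef r]) simp
    also have "\<dots> < \<infinity>" using Nf by (simp add: ennreal_mult_less_top)
    finally show "part_semigroup P X D t f \<in> Lp_space p MD"
      by (simp add: mem zero_ext_part_semigroup[OF t ef] measurable_kernel ef)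
  next
    fix F :: "nat \<Rightarrow> 'a \<Rightarrow> real" and B
    assume F: "\<And>n. F n \<in> Lp_space p MD" and B: "\<And>n. Lp_norm p MD (F n) \<le> B"
    define \<phi> where "\<phi> n = zero_ext (F n)" for n
    have \<phi>[measurable]: "\<phi> n \<in> borel_measurable borel" and N\<phi>': "Lp_mass r (\<phi> n) < \<infinity>" for n
      using F[of n] by (auto simp: mem \<phi>_def)
    define C where "C = B powr r"
    have C: "0 \<le> C" by (simp add: C_def)
    have N\<phi>: "Lp_mass r (\<phi> n) \<le> ennreal C" for n
    proof -
      have "enn2real (Lp_mass r (\<phi> n)) powr (1 / r) \<le> B"
        using B[of n] \<phi>[of n] by (simp add: nrm \<phi>_def)
      then have "(enn2real (Lp_mass r (\<phi> n)) powr (1 / r)) powr r \<le> C"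
        unfolding C_def using r0 by (intro powr_mono2) auto
      then have "enn2real (Lp_mass r (\<phi> n)) \<le> C" using r0 by (simp add: powr_powr)
      then have "ennreal (enn2real (Lp_mass r (\<phi> n))) \<le> ennreal C" by (rule ennreal_leI)
      then show ?thesis using N\<phi>'[of n] by simp
    qed
    define h where "h n = kernel s (\<phi> n)" for n
    have h[measurable]: "h n \<in> borel_measurable borel" for n
      unfolding h_def by (rule measurable_kernel) auto
    define M where "M = (K * (dens_bound s * C)) powr (1 / r)"
    have hM: "\<bar>h n x\<bar> \<le> M" for n x
    proof -
      have "ennreal (\<bar>h n x\<bar> powr r) \<le> ennreal K * kernel_nn s (\<lambda>y. ennreal (\<bar>\<phi> n y\<bar> powr r)) x"
        unfolding h_def K_def by (rule kernel_powr_le[OF _ \<phi> r]) simp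
      also have "\<dots> \<le> ennreal K * (ennreal (dens_bound s) * Lp_mass r (\<phi> n))"
        unfolding Lp_mass_def by (intro mult_left_mono kernel_nn_le[OF s]) auto
      also have "\<dots> \<le> ennreal K * (ennreal (dens_bound s) * ennreal C)"
        by (intro mult_left_mono N\<phi>) auto
      also have "\<dots> = ennreal (K * (dens_bound s * C))"
        using C K by (simp add: ennreal_mult dens_bound_nonneg)
      finally have "\<bar>h n x\<bar> powr r \<le> K * (dens_bound s * C)"
        using C K by (subst (asm) ennreal_le_iff) (auto simp: dens_bound_nonneg)
      then have "(\<bar>h n x\<bar> powr r) powr (1 / r) \<le> M"
        unfolding M_def using r0 by (intro powr_mono2) auto
      then show ?thesis using r0 by (simp add: powr_powr)
    qed
    from kernel_convergent_subsequence[where F=h and M=M, OF s h hM]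
    obtain \<rho> where \<rho>: "strict_mono (\<rho> :: nat \<Rightarrow> nat)"
      and conv: "\<forall>x. convergent (\<lambda>n. kernel s (h (\<rho> n)) x)" by (elim exE conjE)
    define k where "k n = kernel t (\<phi> (\<rho> n))" for n
    have k[measurable]: "k n \<in> borel_measurable borel" for n
      unfolding k_def by (rule measurable_kernel) auto
    have k_eq: "k n x = kernel s (h (\<rho> n)) x" for n x
    proof (cases "x \<in> D")
      case True
      have "integrable (P x) (\<lambda>\<omega>. \<phi> (\<rho> n) (X (s + s) \<omega>))"
        using N\<phi>' by (intro integrable_X_of_powr(1)[OF _ \<phi> r]) (auto simp: s Lp_mass_def)
      then have "kernel (s + s) (\<phi> (\<rho> n)) x = kernel s (kernel s (\<phi> (\<rho> n))) x"
        by (rule kernel_semigroup[OF s s True \<phi>])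
      then show ?thesis by (simp only: k_def h_def ss)
    qed (simp add: k_def kernel_outside)
    have kM: "\<bar>k n x\<bar> \<le> M" for n x
      unfolding k_eq by (rule abs_kernel_le[OF s h hM])
    define g where "g x = lim (\<lambda>n. k n x)" for x
    have k_lim: "(\<lambda>n. k n x) \<longlonglongrightarrow> g x" for x
      using conv[rule_format, of x] unfolding g_def k_eq[abs_def] convergent_LIMSEQ_iff .
    have g[measurable]: "g \<in> borel_measurable borel"
      by (rule borel_measurable_LIMSEQ_metric[OF k k_lim])
    have gM: "\<bar>g x\<bar> \<le> M" for x
      by (rule LIMSEQ_le_const2[OF tendsto_rabs[OF k_lim]]) (use kM in auto)
    have "g x = 0" if "x \<notin> D" for x
    proof -
      have "(\<lambda>n. k n x) \<longlonglongrightarrow> 0" using that by (simp add: k_def kernel_outside)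
      then show ?thesis using LIMSEQ_unique k_lim by blast
    qed
    then have zero_ext_g: "zero_ext g = g" by (rule zero_ext_of_vanishing)
    have N_lim: "(\<lambda>n. Lp_mass r (\<lambda>x. k n x - g x)) \<longlonglongrightarrow> 0"
    proof (rule ennreal_tendsto_0I)
      fix \<epsilon> :: real assume \<epsilon>: "0 < \<epsilon>"
      \<comment> \<open>The tails of \<open>k n\<close> and of \<open>g\<close> cost
        \<open>K * (\<epsilon>' * C)\<close> each, and taking the difference another factor
        \<open>K\<close>. The 4 reserves half of \<open>\<epsilon>\<close> for the ball, and the
        summand 1 covers \<open>C = 0\<close>.\<close>
      define \<epsilon>' where "\<epsilon>' = \<epsilon> / (4 * K * K * (C + 1))"
      have \<epsilon>': "0 < \<epsilon>'" using \<epsilon> K C by (simp add: \<epsilon>'_def)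
      have small: "K * (K * (\<epsilon>' * C) + K * (\<epsilon>' * C)) \<le> \<epsilon> / 2"
      proof -
        have "K * (K * (\<epsilon>' * C) + K * (\<epsilon>' * C)) = \<epsilon> / 2 * (C / (C + 1))"
          using K C by (simp add: \<epsilon>'_def divide_simps add_nonneg_eq_0_iff)
        also have "\<dots> \<le> \<epsilon> / 2 * 1" using C \<epsilon> by (intro mult_left_mono) auto
        finally show ?thesis by simp
      qed
      from kernel_nn_uniform_tail[OF s sv \<epsilon>'] obtain R where
        R: "\<forall>h\<in>borel_measurable borel. (\<integral>\<^sup>+x. kernel_nn (s + s) h x * indicator {x. R < norm x} x \<partial>lborel) \<le> ennreal \<epsilon>' * (\<integral>\<^sup>+x. h x \<partial>lborel)" ..
      let ?A = "{x::'a. R < norm x}"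
      have A[measurable]: "?A \<in> sets borel" by measurable
      have cb[measurable]: "cball (0::'a) R \<in> sets borel" by (intro borel_closed closed_cball)
      have k_tail: "(\<integral>\<^sup>+x. ennreal (\<bar>k n x\<bar> powr r) * indicator ?A x \<partial>lborel) \<le> ennreal (K * (\<epsilon>' * C))" for n
      proof -
        let ?h = "\<lambda>y. ennreal (\<bar>\<phi> (\<rho> n) y\<bar> powr r)"
        have hm: "?h \<in> borel_measurable borel" by measurable
        have km: "kernel_nn (s + s) ?h \<in> borel_measurable borel"
          by (rule measurable_kernel_nn[OF hm]) simp
        have "(\<integral>\<^sup>+x. ennreal (\<bar>k n x\<bar> powr r) * indicator ?A x \<partial>lborel)
            \<le> (\<integral>\<^sup>+x. ennreal K * (kernel_nn (s + s) ?h x * indicator ?A x) \<partial>lborel)"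
          unfolding mult.assoc[symmetric] ss k_def K_def
          by (intro nn_integral_mono mult_right_mono kernel_powr_le[OF _ \<phi> r]) auto
        also have "\<dots> = ennreal K * (\<integral>\<^sup>+x. kernel_nn (s + s) ?h x * indicator ?A x \<partial>lborel)"
          using km by (intro nn_integral_cmult) simp
        also have "\<dots> \<le> ennreal K * (ennreal \<epsilon>' * Lp_mass r (\<phi> (\<rho> n)))"
          unfolding Lp_mass_def by (intro mult_left_mono R[rule_format] hm) auto
        also have "\<dots> \<le> ennreal K * (ennreal \<epsilon>' * ennreal C)"
          by (intro mult_left_mono N\<phi>) auto
        also have "\<dots> = ennreal (K * (\<epsilon>' * C))" using K \<epsilon>' C by (simp add: ennreal_mult)
        finally show ?thesis .
      qed
      have g_tail: "(\<integral>\<^sup>+x. ennreal (\<bar>g x\<bar> powr r) * indicator ?A x \<partial>lborel) \<le> ennreal (K * (\<epsilon>' * C))"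
      proof -
        have "(\<integral>\<^sup>+x. ennreal (\<bar>g x\<bar> powr r) * indicator ?A x \<partial>lborel)
          = (\<integral>\<^sup>+x. liminf (\<lambda>n. ennreal (\<bar>k n x\<bar> powr r) * indicator ?A x) \<partial>lborel)"
        proof (intro nn_integral_cong)
          fix x
          have "(\<lambda>n. ennreal (\<bar>k n x\<bar> powr r)) \<longlonglongrightarrow> ennreal (\<bar>g x\<bar> powr r)"
            using r0 by (intro tendsto_ennrealI tendsto_powr2 tendsto_rabs k_lim tendsto_const) auto
          then have "(\<lambda>n. ennreal (\<bar>k n x\<bar> powr r) * indicator ?A x) \<longlonglongrightarrow> ennreal (\<bar>g x\<bar> powr r) * indicator ?A x"
            by (cases "x \<in> ?A") auto
          then show "ennreal (\<bar>g x\<bar> powr r) * indicator ?A x = liminf (\<lambda>n. ennreal (\<bar>k n x\<bar> powr r) * indicator ?A x)"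
            by (rule lim_imp_Liminf[OF sequentially_bot, symmetric])
        qed
        also have "\<dots> \<le> liminf (\<lambda>n. \<integral>\<^sup>+x. ennreal (\<bar>k n x\<bar> powr r) * indicator ?A x \<partial>lborel)"
          by (rule nn_integral_liminf) measurable
        also have "\<dots> \<le> limsup (\<lambda>n. \<integral>\<^sup>+x. ennreal (\<bar>k n x\<bar> powr r) * indicator ?A x \<partial>lborel)"
          by (rule Liminf_le_Limsup) simp
        also have "\<dots> \<le> ennreal (K * (\<epsilon>' * C))"
          by (rule Limsup_bounded) (use k_tail in auto)
        finally show ?thesis .
      qed
      have tail: "(\<integral>\<^sup>+x. ennreal (\<bar>k n x - g x\<bar> powr r) * indicator ?A x \<partial>lborel) \<le> ennreal (\<epsilon> / 2)" for n
      proof -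
        have "(\<integral>\<^sup>+x. ennreal (\<bar>k n x - g x\<bar> powr r) * indicator ?A x \<partial>lborel)
          \<le> ennreal K * ((\<integral>\<^sup>+x. ennreal (\<bar>k n x\<bar> powr r) * indicator ?A x \<partial>lborel)
            + (\<integral>\<^sup>+x. ennreal (\<bar>g x\<bar> powr r) * indicator ?A x \<partial>lborel))"
          unfolding K_def by (rule nn_integral_diff_powr_le) (use r0 in auto)
        also have "\<dots> \<le> ennreal K * (ennreal (K * (\<epsilon>' * C)) + ennreal (K * (\<epsilon>' * C)))"
          by (intro mult_left_mono add_mono k_tail g_tail) auto
        also have "\<dots> = ennreal (K * (K * (\<epsilon>' * C) + K * (\<epsilon>' * C)))"
          using K \<epsilon>' C by (simp add: ennreal_mult[symmetric] ennreal_plus[symmetric] del: ennreal_plus)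
        also have "\<dots> \<le> ennreal (\<epsilon> / 2)" by (rule ennreal_leI[OF small])
        finally show ?thesis .
      qed
      have "(\<lambda>n. \<integral>\<^sup>+x. ennreal (\<bar>k n x - g x\<bar> powr r) * indicator (cball 0 R) x \<partial>lborel) \<longlonglongrightarrow> 0"
      proof (rule nn_integral_dominated_near[where M="2 * M"])
        show "(\<lambda>n. k n x - g x) \<longlonglongrightarrow> 0" for x
          using tendsto_diff[OF k_lim[of x] tendsto_const[of "g x"]] by simp
        show "\<bar>k n x - g x\<bar> \<le> 2 * M" for n x using kM[of n x] gM[of x] by linarith
      qed (use r0 in auto)
      then have "\<forall>\<^sub>F n in sequentially. (\<integral>\<^sup>+x. ennreal (\<bar>k n x - g x\<bar> powr r) * indicator (cball 0 R) x \<partial>lborel) < ennreal (\<epsilon> / 2)"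
        using \<epsilon> by (intro order_tendstoD(2)) auto
      then show "\<forall>\<^sub>F n in sequentially. Lp_mass r (\<lambda>x. k n x - g x) \<le> ennreal \<epsilon>"
      proof eventually_elim
        case (elim n)
        have "Lp_mass r (\<lambda>x. k n x - g x)
          = (\<integral>\<^sup>+x. ennreal (\<bar>k n x - g x\<bar> powr r) * indicator (cball 0 R) x + ennreal (\<bar>k n x - g x\<bar> powr r) * indicator ?A x \<partial>lborel)"
          unfolding Lp_mass_def by (intro nn_integral_cong) (auto simp: indicator_def)
        also have "\<dots> = (\<integral>\<^sup>+x. ennreal (\<bar>k n x - g x\<bar> powr r) * indicator (cball 0 R) x \<partial>lborel)
            + (\<integral>\<^sup>+x. ennreal (\<bar>k n x - g x\<bar> powr r) * indicator ?A x \<partial>lborel)"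
          by (rule nn_integral_add) measurable
        also have "\<dots> \<le> ennreal (\<epsilon> / 2) + ennreal (\<epsilon> / 2)"
          by (intro add_mono tail less_imp_le[OF elim])
        also have "\<dots> = ennreal \<epsilon>" using \<epsilon> by (simp add: ennreal_plus[symmetric] del: ennreal_plus)
        finally show ?case .
      qed
    qed
    have g_mem: "g \<in> Lp_space p MD"
    proof -
      have "\<forall>\<^sub>F n in sequentially. Lp_mass r (\<lambda>x. k n x - g x) < 1"
        using N_lim by (rule order_tendstoD(2)) simp
      then obtain n where n: "Lp_mass r (\<lambda>x. k n x - g x) < 1" by (auto simp: eventually_sequentially)
      have "Lp_mass r (k n) \<le> ennreal (2 powr r) * Lp_mass r (\<phi> (\<rho> n))"
        unfolding k_def by (rule Lp_mass_kernel_le[OF _ \<phi> r]) simp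
      also have "\<dots> < \<infinity>" using N\<phi>' by (simp add: ennreal_mult_less_top)
      finally have kn: "Lp_mass r (k n) < \<infinity>" .
      \<comment> \<open>Finite distance to a single \<open>k n\<close> of finite mass already puts
        \<open>g\<close> into the space.\<close>
      have "Lp_mass r g = Lp_mass r (\<lambda>x. k n x - (k n x - g x))" by simp
      also have "\<dots> \<le> ennreal (2 powr r) * (Lp_mass r (k n) + Lp_mass r (\<lambda>x. k n x - g x))"
        by (rule Lp_mass_diff_le) (use r0 in auto)
      also have "\<dots> < \<infinity>" using kn n by (auto simp: ennreal_mult_less_top intro: less_trans)
      finally show ?thesis by (simp add: mem zero_ext_g)
    qed
    have "(\<lambda>n. Lp_norm p MD (\<lambda>x. part_semigroup P X D t (F (\<rho> n)) x - g x)) \<longlonglongrightarrow> 0"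
    proof -
      have ed: "zero_ext (\<lambda>x. part_semigroup P X D t (F (\<rho> n)) x - g x) = (\<lambda>x. k n x - g x)" for n
        using zero_ext_part_semigroup[OF t, of "F (\<rho> n)"] \<phi>[of "\<rho> n"] by (simp add: zero_ext_diff zero_ext_g k_def \<phi>_def)
      have "(\<lambda>n. enn2real (Lp_mass r (\<lambda>x. k n x - g x))) \<longlonglongrightarrow> 0"
        by (rule tendsto_enn2real) (use N_lim in simp_all)
      then have "(\<lambda>n. enn2real (Lp_mass r (\<lambda>x. k n x - g x)) powr (1 / r)) \<longlonglongrightarrow> 0 powr (1 / r)"
        using r0 by (intro tendsto_powr2 tendsto_const) auto
      then show ?thesis by (simp add: nrm ed)
    qed
    then show "\<exists>g\<in>Lp_space p MD. \<exists>r. strict_mono (r :: nat \<Rightarrow> nat) \<and>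
        (\<lambda>n. Lp_norm p MD (\<lambda>x. part_semigroup P X D t (F (r n)) x - g x)) \<longlonglongrightarrow> 0"
      using g_mem \<rho> by blast
  qed
qed

lemmas mem_Ltop_iff = mem_Linf_iff[unfolded infinity_ennreal_def]

text \<open>For the sup norm the half-steps exchange roles. The first gives pointwise convergence
  together with the bound \<open>B * survival s x\<close>, which is small outside a ball. Inside the
  ball dominated convergence gives L1 convergence, and the density bound of the second half-step
  turns it into uniform convergence.\<close>

lemma compact_Linf:
  assumes sv: survival_vanishes and t: "0 < t"
  shows "compact_operator_Lp \<infinity> MD (part_semigroup P X D t)"
proof -
  note measurable_path_component[measurable del]
  define s where "s = t / 2"
  have s: "0 < s" and ss: "s + s = t" using t by (auto simp: s_def)
  note [simp] = less_imp_le[OF s] less_imp_le[OF t]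
  \<comment> \<open>Representatives are bounded only almost everywhere. Clipping makes them bounded
    everywhere and leaves the kernel unchanged, since null sets are not charged.\<close>
  define clip :: "real \<Rightarrow> real \<Rightarrow> real" where "clip B y = max (- B) (min B y)" for B y
  have clip: "\<bar>clip B y\<bar> \<le> B" if "0 \<le> B" for B y using that by (auto simp: clip_def)
  have clip_id: "clip B y = y" if "\<bar>y\<bar> \<le> B" for B y using that by (auto simp: clip_def)
  have clip_meas: "(\<lambda>x. clip B (f x)) \<in> borel_measurable borel" if "f \<in> borel_measurable borel" for B and f :: "'a \<Rightarrow> real"
    unfolding clip_def using that by (intro borel_measurable_max borel_measurable_min) auto
  have clip_kernel: "kernel u f = kernel u (\<lambda>x. clip B (f x))"
    if "0 < u" "f \<in> borel_measurable borel" "AE x in lborel. \<bar>f x\<bar> \<le> B" for u B and f :: "'a \<Rightarrow> real"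
  proof
    fix x
    have "AE x in lborel. f x = clip B (f x)" using that(3) by eventually_elim (simp add: clip_id)
    then show "kernel u f x = kernel u (\<lambda>x. clip B (f x)) x"
      by (rule kernel_cong_AE[OF that(1,2) clip_meas[OF that(2)]])
  qed
  show ?thesis
  proof (rule compact_operator_LpI[OF t])
    fix f assume f: "f \<in> Lp_space \<infinity> MD"
    then show ef: "zero_ext f \<in> borel_measurable borel" by (simp add: mem_Ltop_iff)
    obtain C' where C': "AE x in lborel. \<bar>zero_ext f x\<bar> \<le> C'" using f by (auto simp: mem_Ltop_iff)
    define C where "C = max C' 0"
    have C: "AE x in lborel. \<bar>zero_ext f x\<bar> \<le> C" "0 \<le> C"
      using C' by (auto simp: C_def)
    have pr: "Measurable.pred borel (\<lambda>x. \<bar>zero_ext f x\<bar> \<le> C)" using ef by measurable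
    show "integrable path_law (\<lambda>w. zero_ext f (x + w t))" for x
    proof (rule L.integrable_const_bound)
      show "AE w in path_law. norm (zero_ext f (x + w t)) \<le> C"
        using AE_path_component[OF t C(1) pr, of x] by simp
      show "(\<lambda>w. zero_ext f (x + w t)) \<in> borel_measurable path_law"
        unfolding measurable_cong_sets[OF sets_path_law refl]
        by (rule measurable_compose[OF _ ef]) (intro borel_measurable_add borel_measurable_const paths_component, simp)
    qed
    have "\<bar>kernel t (zero_ext f) x\<bar> \<le> C" for x
      unfolding clip_kernel[OF t ef C(1)] by (intro abs_kernel_le[OF t clip_meas[OF ef]] clip C(2))
    then show "part_semigroup P X D t f \<in> Lp_space \<infinity> MD"
      by (auto simp: mem_Ltop_iff zero_ext_part_semigroup[OF t ef] measurable_kernel ef)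
  next
    fix F :: "nat \<Rightarrow> 'a \<Rightarrow> real" and B0
    assume F: "\<And>n. F n \<in> Lp_space \<infinity> MD" and B0: "\<And>n. Lp_norm \<infinity> MD (F n) \<le> B0"
    define B where "B = max B0 0"
    have B: "0 \<le> B" by (simp add: B_def)
    define \<phi> where "\<phi> n = zero_ext (F n)" for n
    have \<phi>: "\<phi> n \<in> borel_measurable borel" for n using F[of n] by (auto simp: mem_Ltop_iff \<phi>_def)
    have \<phi>B: "AE x in lborel. \<bar>\<phi> n x\<bar> \<le> B" for n
      unfolding \<phi>_def B_def by (rule Linf_norm_AE[OF F B0])
    define b where "b n x = clip B (\<phi> n x)" for n x
    have b: "b n \<in> borel_measurable borel" and bB: "\<bar>b n x\<bar> \<le> B" for n x
      unfolding b_def[abs_def] by (intro clip_meas \<phi>, intro clip B)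
    have kb: "kernel u (\<phi> n) = kernel u (b n)" if "0 < u" for u n
      unfolding b_def[abs_def] by (rule clip_kernel[OF that \<phi> \<phi>B])
    from kernel_convergent_subsequence[where F=b and M=B, OF s b bB]
    obtain \<rho> where \<rho>: "strict_mono (\<rho> :: nat \<Rightarrow> nat)"
      and conv: "\<forall>x. convergent (\<lambda>n. kernel s (b (\<rho> n)) x)" by (elim exE conjE)
    define h where "h n = kernel s (b (\<rho> n))" for n
    have h[measurable]: "h n \<in> borel_measurable borel" for n
      unfolding h_def by (rule measurable_kernel[OF b]) simp
    have hB: "\<bar>h n x\<bar> \<le> B" for n x unfolding h_def by (rule abs_kernel_le[OF s b bB])
    define g0 where "g0 x = lim (\<lambda>n. h n x)" for x
    have h_lim: "(\<lambda>n. h n x) \<longlonglongrightarrow> g0 x" for x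
      using conv[rule_format, of x] unfolding g0_def h_def convergent_LIMSEQ_iff .
    have g0[measurable]: "g0 \<in> borel_measurable borel"
      by (rule borel_measurable_LIMSEQ_metric[OF h h_lim])
    have g0B: "\<bar>g0 x\<bar> \<le> B" for x
      by (rule LIMSEQ_le_const2[OF tendsto_rabs[OF h_lim]]) (use hB in auto)
    have h_surv: "\<bar>h n x\<bar> \<le> B * survival s x" for n x
    proof (cases "x \<in> D")
      case True
      then show ?thesis unfolding h_def by (rule abs_kernel_le_survival[OF s b bB])
    next
      case False
      then show ?thesis using B by (simp add: h_def kernel_outside survival_bounds)
    qed
    have g0_surv: "\<bar>g0 x\<bar> \<le> B * survival s x" for x
      by (rule LIMSEQ_le_const2[OF tendsto_rabs[OF h_lim]]) (use h_surv in auto)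
    \<comment> \<open>With the limit defined as a half-step applied to \<open>g0\<close>, the error
      is the same half-step applied to \<open>h n - g0\<close>.\<close>
    define g where "g = kernel s g0"
    have g: "g \<in> borel_measurable borel" unfolding g_def by (rule measurable_kernel[OF g0]) simp
    have gB: "\<bar>g x\<bar> \<le> B" for x unfolding g_def by (rule abs_kernel_le[OF s g0 g0B])
    have zero_ext_g: "zero_ext g = g" by (rule zero_ext_of_vanishing) (simp add: g_def kernel_outside)
    have k_eq: "kernel t (\<phi> (\<rho> n)) x = kernel s (h n) x" if x: "x \<in> D" for n x
    proof -
      have "kernel (s + s) (b (\<rho> n)) x = kernel s (kernel s (b (\<rho> n))) x"
        by (rule kernel_semigroup[OF s s x b], rule integrable_X_bounded(1)[OF _ b bB]) (simp add: s)
      then show ?thesis by (simp only: kb[OF t] h_def ss)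
    qed
    have diff_eq: "part_semigroup P X D t (F (\<rho> n)) x - g x = kernel s (\<lambda>y. h n y - g0 y) x" if x: "x \<in> D" for n x
    proof -
      have "part_semigroup P X D t (F (\<rho> n)) x = zero_ext (part_semigroup P X D t (F (\<rho> n))) x"
        using x by (simp add: zero_ext_def)
      also have "\<dots> = kernel s (h n) x"
        using zero_ext_part_semigroup[OF t, of "F (\<rho> n)"] \<phi>[of "\<rho> n"] k_eq[OF x] by (simp add: \<phi>_def)
      finally show ?thesis
        using kernel_linear[OF s h g0 integrable_X_bounded(2)[OF s h hB] integrable_X_bounded(2)[OF s g0 g0B],
          where a=1 and b="- 1"]
        by (simp add: g_def)
    qed
    have lim: "(\<lambda>n. Lp_norm \<infinity> MD (\<lambda>x. part_semigroup P X D t (F (\<rho> n)) x - g x)) \<longlonglongrightarrow> 0"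
    proof (rule tendstoI)
      fix \<epsilon> :: real assume \<epsilon>: "0 < \<epsilon>"
      \<comment> \<open>Outside the ball \<open>h n\<close> and \<open>g0\<close> are each at most
        \<open>B * \<delta>\<close>, together at most \<open>\<epsilon> / 4\<close>; the choice of
        \<open>q\<close> below allots another \<open>\<epsilon> / 4\<close> to the ball.\<close>
      define \<delta> where "\<delta> = \<epsilon> / (8 * (B + 1))"
      have \<delta>: "0 < \<delta>" using \<epsilon> B by (simp add: \<delta>_def)
      have B\<delta>: "2 * (B * \<delta>) \<le> \<epsilon> / 4"
      proof -
        have "2 * (B * \<delta>) = \<epsilon> / 4 * (B / (B + 1))" using B by (simp add: \<delta>_def divide_simps add_nonneg_eq_0_iff)
        also have "\<dots> \<le> \<epsilon> / 4 * 1" using B \<epsilon> by (intro mult_left_mono) auto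
        finally show ?thesis by simp
      qed
      from survival_vanishesD[OF sv s \<delta>] obtain R where R: "\<forall>x. R < norm x \<longrightarrow> survival s x \<le> \<delta>" ..
      have cb[measurable]: "cball (0::'a) R \<in> sets borel" by (intro borel_closed closed_cball)
      let ?d = "\<lambda>n y. h n y - g0 y"
      \<comment> \<open>The exponent 1 is written out so that
        \<open>nn_integral_dominated_near\<close> applies literally.\<close>
      let ?I = "\<lambda>n. \<integral>\<^sup>+y. ennreal (\<bar>?d n y\<bar> powr 1) * indicator (cball 0 R) y \<partial>lborel"
      have "?I \<longlonglongrightarrow> 0"
      proof (rule nn_integral_dominated_near[where M="2 * B"])
        show "(\<lambda>n. ?d n y) \<longlonglongrightarrow> 0" for y
          using tendsto_diff[OF h_lim[of y] tendsto_const[of "g0 y"]] by simp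
        show "\<bar>?d n y\<bar> \<le> 2 * B" for n y using hB[of n y] g0B[of y] by linarith
      qed auto
      moreover define q where "q = \<epsilon> / (4 * (dens_bound s + 1))"
      have q: "0 < q" using \<epsilon> dens_bound_nonneg[of s] by (simp add: q_def)
      ultimately have "\<forall>\<^sub>F n in sequentially. ?I n < ennreal q"
        by (intro order_tendstoD(2)) auto
      then show "\<forall>\<^sub>F n in sequentially. dist (Lp_norm \<infinity> MD (\<lambda>x. part_semigroup P X D t (F (\<rho> n)) x - g x)) 0 < \<epsilon>"
      proof eventually_elim
        case (elim n)
        have dm[measurable]: "?d n \<in> borel_measurable borel" by measurable
        have bound: "\<bar>kernel s (?d n) x\<bar> \<le> \<epsilon> / 2" for x
        proof -
          have pt: "ennreal \<bar>?d n y\<bar> \<le> ennreal (\<epsilon> / 4) + ennreal (\<bar>?d n y\<bar> powr 1) * indicator (cball 0 R) y" for y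
          proof (cases "y \<in> cball 0 R")
            case False
            then have "survival s y \<le> \<delta>" using R by simp
            then have "B * survival s y \<le> B * \<delta>" using B by (intro mult_left_mono) auto
            then have "\<bar>?d n y\<bar> \<le> \<epsilon> / 4" using h_surv[of n y] g0_surv[of y] B\<delta> by linarith
            then show ?thesis using False by (simp add: ennreal_leI)
          qed (simp add: add_increasing)
          have "ennreal \<bar>kernel s (?d n) x\<bar> \<le> kernel_nn s (\<lambda>y. ennreal \<bar>?d n y\<bar>) x"
            by (rule abs_kernel_le_nn[OF _ dm]) simp
          also have "\<dots> \<le> (\<integral>\<^sup>+w. ennreal \<bar>?d n (x + w s)\<bar> \<partial>path_law)" by (rule kernel_nn_le_free)
          also have "\<dots> \<le> (\<integral>\<^sup>+w. ennreal (\<epsilon> / 4) + ennreal (\<bar>?d n (x + w s)\<bar> powr 1) * indicator (cball 0 R) (x + w s) \<partial>path_law)"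
            by (intro nn_integral_mono pt)
          also have "\<dots> = ennreal (\<epsilon> / 4) + (\<integral>\<^sup>+w. ennreal (\<bar>?d n (x + w s)\<bar> powr 1) * indicator (cball 0 R) (x + w s) \<partial>path_law)"
          proof -
            have "(\<lambda>y. ennreal (\<bar>?d n y\<bar> powr 1) * indicator (cball 0 R) y) \<in> borel_measurable borel" by measurable
            then have "(\<lambda>w. ennreal (\<bar>?d n (x + w s)\<bar> powr 1) * indicator (cball 0 R) (x + w s)) \<in> borel_measurable path_law"
              unfolding measurable_cong_sets[OF sets_path_law refl]
              by (rule measurable_compose[rotated]) (intro borel_measurable_add borel_measurable_const paths_component, simp)
            then show ?thesis by (subst nn_integral_add) (auto simp: L.emeasure_space_1)
          qed
          also have "\<dots> \<le> ennreal (\<epsilon> / 4) + ennreal (dens_bound s) * ?I n"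
            by (intro add_left_mono nn_integral_path_component_le[OF s, of "\<lambda>y. ennreal (\<bar>?d n y\<bar> powr 1) * indicator (cball 0 R) y"]) measurable
          also have "\<dots> \<le> ennreal (\<epsilon> / 4) + ennreal (dens_bound s) * ennreal q"
            by (intro add_left_mono mult_left_mono less_imp_le[OF elim]) auto
          also have "\<dots> = ennreal (\<epsilon> / 4 + dens_bound s * q)"
            using \<epsilon> q by (simp add: ennreal_mult[symmetric] ennreal_plus[symmetric] dens_bound_nonneg del: ennreal_plus)
          finally have "\<bar>kernel s (?d n) x\<bar> \<le> \<epsilon> / 4 + dens_bound s * q"
            using \<epsilon> q by (subst (asm) ennreal_le_iff) (auto simp: dens_bound_nonneg)
          also have "dens_bound s * q \<le> \<epsilon> / 4"
          proof -
            have "dens_bound s * q = \<epsilon> / 4 * (dens_bound s / (dens_bound s + 1))"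
              using dens_bound_nonneg[of s] by (simp add: q_def divide_simps add_nonneg_eq_0_iff)
            also have "\<dots> \<le> \<epsilon> / 4 * 1" using dens_bound_nonneg[of s] \<epsilon> by (intro mult_left_mono) auto
            finally show ?thesis by simp
          qed
          finally show ?thesis by simp
        qed
        let ?u = "\<lambda>x. part_semigroup P X D t (F (\<rho> n)) x - g x"
        have "zero_ext ?u = (\<lambda>x. kernel t (\<phi> (\<rho> n)) x - g x)"
          using zero_ext_part_semigroup[OF t, of "F (\<rho> n)"] \<phi>[of "\<rho> n"] by (simp add: zero_ext_diff zero_ext_g \<phi>_def)
        also have "\<dots> \<in> borel_measurable borel"
          using g measurable_kernel[OF \<phi>, of t] by (intro borel_measurable_diff) auto
        finally have um: "zero_ext ?u \<in> borel_measurable borel" .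
        have ub: "\<bar>?u x\<bar> \<le> \<epsilon> / 2" if "x \<in> D" for x
          using diff_eq[OF that, of n] bound[of x] by simp
        have "0 \<le> Lp_norm \<infinity> MD ?u" "Lp_norm \<infinity> MD ?u \<le> \<epsilon> / 2"
          using Linf_norm_bounds[OF um ub] \<epsilon> by simp_all
        then show ?case using \<epsilon> by (simp add: dist_real_def)
      qed
    qed
    have "g \<in> Lp_space \<infinity> MD" using g gB by (auto simp: mem_Ltop_iff zero_ext_g)
    then show "\<exists>g\<in>Lp_space \<infinity> MD. \<exists>r. strict_mono (r :: nat \<Rightarrow> nat) \<and>
        (\<lambda>n. Lp_norm \<infinity> MD (\<lambda>x. part_semigroup P X D t (F (r n)) x - g x)) \<longlonglongrightarrow> 0"
      using lim \<rho> by blast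
  qed
qed

lemma compact_semigroup_of_survival_vanishes:
  assumes "survival_vanishes" "1 \<le> p"
  shows "compact_semigroup_Lp p MD (part_semigroup P X D)"
  using compact_Lp_finite[OF assms(1) _ assms(2)] compact_Linf[OF assms(1)]
  by (cases "p = \<infinity>") (simp_all add: compact_semigroup_Lp_def)

end

theorem theorem4p2:
  fixes \<alpha> c :: real
    and P :: "'a::euclidean_space \<Rightarrow> 'w measure"
    and X :: "real \<Rightarrow> 'w \<Rightarrow> 'a"
    and D :: "'a set"
  assumes "0 < \<alpha>" and "\<alpha> \<le> 2" and "0 < c"
    and "rotsym_stable_process \<alpha> c P X"
    and "open D"
  shows "((\<forall>p::ennreal. 1 \<le> p \<longrightarrow>
            compact_semigroup_Lp p (restrict_space lborel D) (part_semigroup P X D))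
          \<longleftrightarrow> compact_semigroup_Lp 2 (restrict_space lborel D) (part_semigroup P X D))
       \<and> (compact_semigroup_Lp 2 (restrict_space lborel D) (part_semigroup P X D)
          \<longleftrightarrow> (mean_exit_time P X D \<longlongrightarrow> 0) at_infinity)
       \<and> ((mean_exit_time P X D \<longlongrightarrow> 0) at_infinity
          \<longleftrightarrow> ((\<lambda>x. LBINT t:{0..}. exp (- t) * survival_prob P X D t x) \<longlongrightarrow> 0) at_infinity)"
proof -
  have "killed_stable_process \<alpha> c P X D"
    unfolding killed_stable_process_def stable_process_def stable_process_axioms_def killed_stable_process_axioms_def
    by (intro conjI assms)
  interpret killed_stable_process \<alpha> c P X D by fact
  have two: "(1::ennreal) \<le> 2" by simp
  have i: "(\<forall>p::ennreal. 1 \<le> p \<longrightarrow> compact_semigroup_Lp p MD (part_semigroup P X D)) \<longleftrightarrow> survival_vanishes"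
  proof
    assume "\<forall>p::ennreal. 1 \<le> p \<longrightarrow> compact_semigroup_Lp p MD (part_semigroup P X D)"
    with two have "compact_semigroup_Lp 2 MD (part_semigroup P X D)" by simp
    then show survival_vanishes by (rule survival_vanishes_of_compact_L2)
  qed (intro allI impI compact_semigroup_of_survival_vanishes)
  have ii: "compact_semigroup_Lp 2 MD (part_semigroup P X D) \<longleftrightarrow> survival_vanishes"
    by (rule iffI[OF survival_vanishes_of_compact_L2 compact_semigroup_of_survival_vanishes[OF _ two]])
  have iii: "(mean_exit_time P X D \<longlongrightarrow> 0) at_infinity \<longleftrightarrow> survival_vanishes"
    by (rule iffI[OF survival_vanishes_of_mean_exit_time mean_exit_time_of_survival_vanishes])
  have iv: "((\<lambda>x. LBINT t:{0..}. exp (- t) * survival_prob P X D t x) \<longlongrightarrow> 0) at_infinity \<longleftrightarrow> survival_vanishes"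
    by (rule resolvent_tendsto_iff[unfolded resolvent_def[abs_def]])
  show ?thesis unfolding i ii iii iv by simp
qed

end
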